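(* Let $f\in\mathbb{R}[x]$, $x=(x_1,\ldots,x_n)$, have even degree $2d$, let $f_{min}$ be its global minimum value over $\mathbb{R}^n$, and let $f_{sos}$ be the optimal value of $$\max\ \gamma\quad\text{s.t.}\quad f-\gamma\ \text{is SOS}.$$ Suppose $f_{min}=f_{sos}$ and the set of global minimizers of $f$ over $\mathbb{R}^n$ is nonempty and finite. Then, for all $k$ big enough, every minimizer $y^*$ of $$\min_{y\in\mathscr{M}_{2k}}\ \langle f,y\rangle\quad\text{s.t.}\quad M_k(y)\succeq0,\ \ \langle1,y\rangle=1$$ has a flat truncation, i.e. there exists an integer $t\in[\max\{d,1\},k]$ with $\operatorname{rank}M_{t-1}(y^* )=\operatorname{rank}M_t(y^* )$.
   Context: A polynomial is SOS if it is a sum of squares of polynomials with real coefficients. $\mathscr{M}_{2k}$ is the space of truncated moment sequences $y=(y_\alpha)$ indexed by $\alpha\in\mathbb{N}^n$ with $|\alpha|=\alpha_1+\cdots+\alpha_n\le 2k$ ($\mathbb{N}$ includes $0$). For $p=\sum_\alpha p_\alpha x^\alpha$ of degree at most $2k$, $\langle p,y\rangle:=\sum_\alpha p_\alpha y_\alpha$. The moment matrix $M_t(y)$, for $t\le k$, is the symmetric matrix $(y_{\alpha+\beta})$ with rows and columns indexed by $\alpha,\beta\in\mathbb{N}^n$, $|\alpha|,|\beta|\le t$. $X\succeq0$ means positive semidefinite. (The feasible set $\mathbb{R}^n$ is regarded as defined by the trivial constraint $1\ge0$, so the degree gap in the definition of flat truncation equals $1$.) *)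

theory Defs
  imports "HOL-Analysis.Analysis" "HOL-Analysis.Finite_Function_Topology"
begin

text \<open>
  The variables $x_1, \dots, x_n$ are indexed by a finite type \<open>'n\<close>, so $n$ is \<open>CARD('n)\<close>.
  Multiplication of polynomials is the convolution product of \<open>HOL-Library.Poly_Mapping\<close>.
\<close>

type_synonym 'n mexp = "'n \<Rightarrow>\<^sub>0 nat"
type_synonym 'n rpoly = "'n mexp \<Rightarrow>\<^sub>0 real"

definition mdeg :: "'n::finite mexp \<Rightarrow> nat" where
  "mdeg \<alpha> = (\<Sum>i\<in>UNIV. Poly_Mapping.lookup \<alpha> i)"

definition mexps :: "nat \<Rightarrow> 'n::finite mexp set" where
  "mexps t = {\<alpha>. mdeg \<alpha> \<le> t}"

text \<open>The total degree; the zero polynomial is given degree 0.\<close>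

definition tdeg :: "'n::finite rpoly \<Rightarrow> nat" where
  "tdeg p = Max (insert 0 (mdeg ` Poly_Mapping.keys p))"

definition peval :: "'n::finite rpoly \<Rightarrow> real ^ 'n \<Rightarrow> real" where
  "peval p x = (\<Sum>\<alpha>\<in>Poly_Mapping.keys p.
     Poly_Mapping.lookup p \<alpha> * (\<Prod>i\<in>UNIV. (x $ i) ^ Poly_Mapping.lookup \<alpha> i))"

definition pconst :: "real \<Rightarrow> 'n::finite rpoly" where
  "pconst c = Poly_Mapping.single 0 c"

definition SOS :: "'n::finite rpoly \<Rightarrow> bool" where
  "SOS p \<longleftrightarrow> (\<exists>qs. p = (\<Sum>q\<leftarrow>qs. q ^ 2))"

text \<open>
  Both optimal values are extended reals, so that an unbounded or an infeasible problem has
  the value \<open>-\<infinity>\<close>.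
\<close>

definition f_min :: "'n::finite rpoly \<Rightarrow> ereal" where
  "f_min f = (INF x. ereal (peval f x))"

definition f_sos :: "'n::finite rpoly \<Rightarrow> ereal" where
  "f_sos f = (SUP \<gamma>\<in>{\<gamma>. SOS (f - pconst \<gamma>)}. ereal \<gamma>)"

definition global_minimizers :: "'n::finite rpoly \<Rightarrow> (real ^ 'n) set" where
  "global_minimizers f = {x. \<forall>z. peval f x \<le> peval f z}"

text \<open>
  A truncated moment sequence of degree $m$ is a family indexed by the
  exponents of degree at most $m$; it is represented by its extension by zero.
\<close>

definition tms :: "nat \<Rightarrow> ('n::finite mexp \<Rightarrow> real) set" where
  "tms m = {y. \<forall>\<alpha>. \<alpha> \<notin> mexps m \<longrightarrow> y \<alpha> = 0}"

definition pairing :: "'n::finite rpoly \<Rightarrow> ('n mexp \<Rightarrow> real) \<Rightarrow> real" where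
  "pairing p y = (\<Sum>\<alpha>\<in>Poly_Mapping.keys p. Poly_Mapping.lookup p \<alpha> * y \<alpha>)"

text \<open>
  A square matrix with rows and columns indexed by a finite set \<open>I\<close> is a function of two
  arguments, of which only the values on \<open>I\<close> count. Its rank is the dimension of the span of its
  columns; each column is a finitely supported function, an element of the real vector space
  \<open>'a \<Rightarrow>\<^sub>0 real\<close>.
\<close>

definition psd_on :: "'a set \<Rightarrow> ('a \<Rightarrow> 'a \<Rightarrow> real) \<Rightarrow> bool" where
  "psd_on I A \<longleftrightarrow> (\<forall>i\<in>I. \<forall>j\<in>I. A i j = A j i) \<and>
     (\<forall>v. 0 \<le> (\<Sum>i\<in>I. \<Sum>j\<in>I. v i * A i j * v j))"

definition column_on :: "'a set \<Rightarrow> ('a \<Rightarrow> 'a \<Rightarrow> real) \<Rightarrow> 'a \<Rightarrow> ('a \<Rightarrow>\<^sub>0 real)" where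
  "column_on I A j = (\<Sum>i\<in>I. Poly_Mapping.single i (A i j))"

definition rank_on :: "'a set \<Rightarrow> ('a \<Rightarrow> 'a \<Rightarrow> real) \<Rightarrow> nat" where
  "rank_on I A = dim (column_on I A ` I)"

text \<open>The moment matrix $M_t(y)$ is \<open>moment_matrix y\<close> on the index set \<open>mexps t\<close>.\<close>

definition moment_matrix :: "('n::finite mexp \<Rightarrow> real) \<Rightarrow> 'n mexp \<Rightarrow> 'n mexp \<Rightarrow> real" where
  "moment_matrix y \<alpha> \<beta> = y (\<alpha> + \<beta>)"

definition moment_feasible :: "nat \<Rightarrow> ('n::finite mexp \<Rightarrow> real) set" where
  "moment_feasible k =
     {y \<in> tms (2 * k). psd_on (mexps k) (moment_matrix y) \<and> pairing 1 y = 1}"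

definition moment_minimizers :: "'n::finite rpoly \<Rightarrow> nat \<Rightarrow> ('n mexp \<Rightarrow> real) set" where
  "moment_minimizers f k =
     {y \<in> moment_feasible k. \<forall>z\<in>moment_feasible k. pairing f y \<le> pairing f z}"

text \<open>
  Flat truncation for an objective of degree $2d$ with degree gap 1.
\<close>

definition flat_truncation :: "nat \<Rightarrow> nat \<Rightarrow> ('n::finite mexp \<Rightarrow> real) \<Rightarrow> bool" where
  "flat_truncation d k y \<longleftrightarrow> (\<exists>t. max d 1 \<le> t \<and> t \<le> k \<and>
     rank_on (mexps (t - 1)) (moment_matrix y) = rank_on (mexps t) (moment_matrix y))"

lemma finite_mexps: "finite (mexps t :: 'n::finite mexp set)"
proof (rule finite_imageD)
  show "inj_on Poly_Mapping.lookup (mexps t :: 'n mexp set)"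
    by (auto simp: inj_on_def poly_mapping_eqI)
  have "Poly_Mapping.lookup ` (mexps t :: 'n mexp set) \<subseteq> {g. range g \<subseteq> {..t}}"
  proof safe
    fix \<alpha> :: "'n mexp" and i
    assume "\<alpha> \<in> mexps t"
    moreover have "Poly_Mapping.lookup \<alpha> i \<le> mdeg \<alpha>"
      unfolding mdeg_def by (rule member_le_sum) auto
    ultimately show "Poly_Mapping.lookup \<alpha> i \<le> t"
      by (simp add: mexps_def)
  qed
  moreover have "finite {g :: 'n \<Rightarrow> nat. range g \<subseteq> {..t}}"
    using finite_set_of_finite_funs[of "UNIV :: 'n set" "{..t}" 0]
    by (auto simp: image_subset_iff elim: rev_finite_subset)
  ultimately show "finite (Poly_Mapping.lookup ` (mexps t :: 'n mexp set))"
    by (rule finite_subset)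
qed

lemma lookup_column_on:
  "finite I \<Longrightarrow> Poly_Mapping.lookup (column_on I A j) i = (if i \<in> I then A i j else 0)"
  by (simp add: column_on_def lookup_sum lookup_single when_def)

end

theory Submission
  imports Defs "HOL-Computational_Algebra.Fundamental_Theorem_Algebra"
begin

text \<open>
  The equality of ranks comes from linear relations between columns of the moment matrix. Let
  $m$ be the minimum of $f$ and let $S$ be the finite set of its minimizers. For each monomial
  $x^\alpha$ there is a polynomial of degree at most $|S| - 1$ with the same values on $S$. If
  the difference $p_\alpha$ is in the kernel of $M_k(y)$ for all $|\alpha| \le t$, where $t =
  \max \{d, 1, |S|\}$, then every column of $M_t(y)$ is a combination of columns of degree at
  most $t - 1$, and the ranks of $M_{t - 1}(y)$ and $M_t(y)$ agree (\<open>rank_on_eq\<close>).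

  So it has to be shown that a polynomial $p$ that vanishes on $S$ satisfies $\langle p^2, y
  \rangle = 0$ for all minimizers $y$ of all large orders $k$. The set $J$ of the polynomials
  $h$ with this property for $h$ in place of $p$ is a real ideal: if it contains $\sum_i q_i^2$,
  it contains every $q_i$ (\<open>real_ideal_J\<close>). It contains $F = f - m$ as well:
  $\langle F, y \rangle = 0$ because the relaxation is tight, and testing $y$ on $(F + s)(t -
  F)^2$ with $F + s$ a sum of squares gives $\langle F^2, y \rangle = 0$
  (\<open>pairing_F_square\<close>). The real zeros of $F$ are the points of $S$. Hence the
  claim is the real Nullstellensatz: a polynomial that vanishes at all real zeros of a member of
  a real ideal belongs to the ideal (\<open>real_nullstellensatz\<close>).

  The real Nullstellensatz is proved by reduction to a real prime ideal $M$ that avoids $p$.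
  Only countably many real numbers occur as coefficients that matter, so the residue ring of $M$
  embeds into $\mathbb{C}$ as the ring of values at a generic point $z$
  (\<open>generic_point_exists\<close>), and its field of fractions can be ordered. In
  $\mathbb{C}$ there is room for a maximal ordered subfield $K$ above it, which is real closed
  by the theorem of Artin and Schreier (\<open>intermediate_value\<close>). Over $K$ the system
  $F = 0$, $p \ne 0$ has the solution $z$. Sign tables in the style of Cohen and Hoermander are
  the same over all real closed fields (\<open>realize_sign_vector\<close>), so one coordinate
  after the other can be moved to $\mathbb{R}$ (\<open>transfer_to_reals\<close>), and a real
  solution of the system results.
\<close>

section \<open>Polynomials over a subring\<close>

text \<open>
  The rings and fields below depend on the data of the theorem, so they are subsets of a fixed
  type, and a polynomial over such a ring is a polynomial over the type with coefficients in it.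
\<close>

definition subring_set :: "'a::comm_ring_1 set \<Rightarrow> bool" where
  "subring_set B \<longleftrightarrow> 1 \<in> B \<and> (\<forall>x\<in>B. \<forall>y\<in>B. x - y \<in> B \<and> x * y \<in> B)"

definition polys_over :: "'a::comm_ring_1 set \<Rightarrow> 'a poly set" where
  "polys_over B = {p. \<forall>i. coeff p i \<in> B}"

lemma subring_setD:
  assumes "subring_set B"
  shows "0 \<in> B" "1 \<in> B" "x \<in> B \<Longrightarrow> - x \<in> B"
    "x \<in> B \<Longrightarrow> y \<in> B \<Longrightarrow> x + y \<in> B" "x \<in> B \<Longrightarrow> y \<in> B \<Longrightarrow> x - y \<in> B"
    "x \<in> B \<Longrightarrow> y \<in> B \<Longrightarrow> x * y \<in> B" "x \<in> B \<Longrightarrow> x ^ n \<in> B"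
    "(\<And>i. i \<in> I \<Longrightarrow> g i \<in> B) \<Longrightarrow> sum g I \<in> B"
    "(\<And>i. i \<in> I \<Longrightarrow> g i \<in> B) \<Longrightarrow> prod g I \<in> B"
    "of_nat n \<in> B"
proof -
  show one: "1 \<in> B" using assms by (simp add: subring_set_def)
  have diff: "x - y \<in> B" if "x \<in> B" "y \<in> B" for x y
    using assms that by (simp add: subring_set_def)
  have mult: "x * y \<in> B" if "x \<in> B" "y \<in> B" for x y
    using assms that by (simp add: subring_set_def)
  show zero: "0 \<in> B" using diff[OF one one] by simp
  have neg: "- x \<in> B" if "x \<in> B" for x using diff[OF zero that] by simp
  have add: "x + y \<in> B" if "x \<in> B" "y \<in> B" for x y
    using diff[OF that(1) neg[OF that(2)]] by simp
  show "x \<in> B \<Longrightarrow> - x \<in> B" by (rule neg)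
  show "x \<in> B \<Longrightarrow> y \<in> B \<Longrightarrow> x + y \<in> B" by (rule add)
  show "x \<in> B \<Longrightarrow> y \<in> B \<Longrightarrow> x - y \<in> B" by (rule diff)
  show "x \<in> B \<Longrightarrow> y \<in> B \<Longrightarrow> x * y \<in> B" by (rule mult)
  show "x \<in> B \<Longrightarrow> x ^ n \<in> B" by (induction n) (auto simp: one mult)
  show "(\<And>i. i \<in> I \<Longrightarrow> g i \<in> B) \<Longrightarrow> sum g I \<in> B"
    by (induction I rule: infinite_finite_induct) (auto simp: zero add)
  show "(\<And>i. i \<in> I \<Longrightarrow> g i \<in> B) \<Longrightarrow> prod g I \<in> B"
    by (induction I rule: infinite_finite_induct) (auto simp: one mult)
  show "of_nat n \<in> B" by (induction n) (auto simp: zero add one)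
qed

lemma polys_overI: "(\<And>i. coeff p i \<in> B) \<Longrightarrow> p \<in> polys_over B"
  by (simp add: polys_over_def)

lemma polys_overD: "p \<in> polys_over B \<Longrightarrow> coeff p i \<in> B"
  by (simp add: polys_over_def)

lemma polys_over_closed:
  assumes B: "subring_set B"
  shows "0 \<in> polys_over B" "1 \<in> polys_over B"
    "c \<in> B \<Longrightarrow> [:c:] \<in> polys_over B"
    "c \<in> B \<Longrightarrow> p \<in> polys_over B \<Longrightarrow> pCons c p \<in> polys_over B"
    "p \<in> polys_over B \<Longrightarrow> - p \<in> polys_over B"
    "p \<in> polys_over B \<Longrightarrow> q \<in> polys_over B \<Longrightarrow> p + q \<in> polys_over B"
    "p \<in> polys_over B \<Longrightarrow> q \<in> polys_over B \<Longrightarrow> p - q \<in> polys_over B"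
    "p \<in> polys_over B \<Longrightarrow> q \<in> polys_over B \<Longrightarrow> p * q \<in> polys_over B"
    "p \<in> polys_over B \<Longrightarrow> p ^ n \<in> polys_over B"
    "c \<in> B \<Longrightarrow> p \<in> polys_over B \<Longrightarrow> smult c p \<in> polys_over B"
    "c \<in> B \<Longrightarrow> monom c n \<in> polys_over B"
    "p \<in> polys_over B \<Longrightarrow> x \<in> B \<Longrightarrow> poly p x \<in> B"
proof -
  note c = subring_setD[OF B]
  show one: "1 \<in> polys_over B"
    by (auto simp: polys_over_def coeff_1 c)
  have mult: "p * q \<in> polys_over B" if "p \<in> polys_over B" "q \<in> polys_over B" for p q
    using that by (auto simp: polys_over_def coeff_mult intro!: c)
  show "p \<in> polys_over B \<Longrightarrow> p ^ n \<in> polys_over B"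
    by (induction n) (auto simp: one mult)
  show "p \<in> polys_over B \<Longrightarrow> q \<in> polys_over B \<Longrightarrow> p * q \<in> polys_over B" by (rule mult)
  show "p \<in> polys_over B \<Longrightarrow> x \<in> B \<Longrightarrow> poly p x \<in> B"
    by (auto simp: polys_over_def poly_altdef intro!: c)
qed (use subring_setD[OF B] in \<open>auto simp: polys_over_def coeff_pCons split: nat.split\<close>)

lemma polys_over_pderiv:
  fixes p :: "'a::idom poly"
  shows "subring_set B \<Longrightarrow> p \<in> polys_over B \<Longrightarrow> pderiv p \<in> polys_over B"
  unfolding polys_over_def using subring_setD(6,10)[of B]
  by (auto simp: coeff_pderiv simp del: of_nat_Suc)

text \<open>
  The leading coefficient of the divisor need not be a unit, so a power of it multiplies the
  dividend.
\<close>

lemma pseudo_division: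
  fixes f g :: "'a::comm_ring_1 poly"
  assumes B: "subring_set B" and g: "g \<in> polys_over B" "g \<noteq> 0" and f: "f \<in> polys_over B"
  shows "\<exists>N q r. q \<in> polys_over B \<and> r \<in> polys_over B \<and>
    smult (lead_coeff g ^ N) f = g * q + r \<and> (r = 0 \<or> degree r < degree g)"
  using f
proof (induction "degree f" arbitrary: f rule: less_induct)
  case less
  note cl = polys_over_closed[OF B]
  show ?case
  proof (cases "f = 0 \<or> degree f < degree g")
    case True
    then show ?thesis
      using less.prems cl(1) by (intro exI[of _ 0] exI[of _ 0] exI[of _ f]) auto
  next
    case False
    define m where "m = monom (lead_coeff f) (degree f - degree g)"
    define f1 where "f1 = smult (lead_coeff g) f - m * g"
    have m: "m \<in> polys_over B" unfolding m_def by (rule cl) (use less.prems in \<open>auto dest: polys_overD\<close>)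
    have f1: "f1 \<in> polys_over B"
      unfolding f1_def using m g less.prems by (intro cl) (auto dest: polys_overD)
    have degf1: "f1 = 0 \<or> degree f1 < degree f"
    proof -
      have le: "degree f1 \<le> degree f"
      proof -
        have "degree (m * g) \<le> (degree f - degree g) + degree g"
          unfolding m_def by (rule order_trans[OF degree_mult_le]) (auto simp: degree_monom_le)
        then have "degree (m * g) \<le> degree f" using False by auto
        then show ?thesis
          unfolding f1_def by (intro degree_diff_le) (auto intro: degree_smult_le)
      qed
      have "coeff f1 (degree f) = 0"
      proof -
        have "coeff (m * g) (degree f) = lead_coeff f * lead_coeff g"
          using False unfolding m_def by (subst coeff_monom_mult) auto
        then show ?thesis by (simp add: f1_def mult.commute)
      qed
      then show ?thesis using le by (metis le_neq_implies_less leading_coeff_0_iff)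
    qed
    have "\<exists>N q r. q \<in> polys_over B \<and> r \<in> polys_over B \<and>
      smult (lead_coeff g ^ N) f1 = g * q + r \<and> (r = 0 \<or> degree r < degree g)"
    proof (cases "f1 = 0")
      case True
      then show ?thesis by (intro exI[of _ 0] exI[of _ 0] exI[of _ 0]) (simp add: cl)
    next
      case False
      then show ?thesis using less.hyps degf1 f1 by blast
    qed
    then obtain N q r where h: "q \<in> polys_over B" "r \<in> polys_over B"
      "smult (lead_coeff g ^ N) f1 = g * q + r" "r = 0 \<or> degree r < degree g" by blast
    have "smult (lead_coeff g ^ Suc N) f = g * (q + smult (lead_coeff g ^ N) m) + r"
    proof -
      have "smult (lead_coeff g ^ Suc N) f = smult (lead_coeff g ^ N) (f1 + m * g)"
        by (simp add: f1_def mult.commute)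
      also have "\<dots> = g * q + r + smult (lead_coeff g ^ N) (m * g)"
        by (simp add: smult_add_right h(3))
      finally show ?thesis by (simp add: algebra_simps)
    qed
    moreover have "q + smult (lead_coeff g ^ N) m \<in> polys_over B"
      using h m g by (intro cl subring_setD[OF B]) (auto dest: polys_overD)
    ultimately show ?thesis using h by blast
  qed
qed

lemma division_over_subfield:
  fixes f g :: "'a::field poly"
  assumes B: "subring_set B" and inv: "\<And>x. x \<in> B \<Longrightarrow> inverse x \<in> B"
    and g: "g \<in> polys_over B" "g \<noteq> 0" and f: "f \<in> polys_over B"
  obtains q r where "q \<in> polys_over B" "r \<in> polys_over B" "f = g * q + r"
    "r = 0 \<or> degree r < degree g"
proof -
  obtain N q r where h: "q \<in> polys_over B" "r \<in> polys_over B"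
    "smult (lead_coeff g ^ N) f = g * q + r" "r = 0 \<or> degree r < degree g"
    using pseudo_division[OF B g f] by blast
  define c where "c = inverse (lead_coeff g ^ N)"
  have c: "c \<in> B" unfolding c_def using g by (intro inv subring_setD[OF B]) (auto dest: polys_overD)
  have "f = smult c (smult (lead_coeff g ^ N) f)" using g by (simp add: c_def)
  also have "\<dots> = g * smult c q + smult c r" by (simp add: h(3) smult_add_right)
  finally have "f = g * smult c q + smult c r" .
  moreover have "smult c r = 0 \<or> degree (smult c r) < degree g"
    using h(4) by (metis degree_smult_le le_less_trans smult_0_right)
  ultimately show ?thesis
    using that h c polys_over_closed(10)[OF B] by blast
qed

section \<open>Ordered subfields\<close>

text \<open>
  \<open>T\<close> is the set of nonnegative elements; the ordered field itself is
  \<open>K\<close>, the union of \<open>T\<close> and \<open>- T\<close>.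
\<close>

locale ordered_subfield =
  fixes T :: "'a::field_char_0 set"
  assumes one_mem: "1 \<in> T"
    and add_mem: "x \<in> T \<Longrightarrow> y \<in> T \<Longrightarrow> x + y \<in> T"
    and mult_mem: "x \<in> T \<Longrightarrow> y \<in> T \<Longrightarrow> x * y \<in> T"
    and inverse_mem: "x \<in> T \<Longrightarrow> inverse x \<in> T"
    and total: "x \<in> T \<Longrightarrow> y \<in> T \<Longrightarrow> x - y \<in> T \<or> y - x \<in> T"
    and antisym: "x \<in> T \<Longrightarrow> - x \<in> T \<Longrightarrow> x = 0"
begin

definition K :: "'a set" where "K = T \<union> uminus ` T"
definition pos :: "'a \<Rightarrow> bool" where "pos x \<longleftrightarrow> x \<in> T \<and> x \<noteq> 0"
definition sg :: "'a \<Rightarrow> int" where "sg x = (if x = 0 then 0 else if x \<in> T then 1 else -1)"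

lemma zero_mem: "0 \<in> T"
  using total[OF one_mem one_mem] by simp

lemma in_K: "x \<in> K \<longleftrightarrow> x \<in> T \<or> - x \<in> T"
  unfolding K_def by (auto simp: image_iff) (metis minus_minus)

lemma K_diff: "x \<in> T \<Longrightarrow> y \<in> T \<Longrightarrow> x - y \<in> K"
  using total[of x y] by (auto simp: in_K)

lemma subring_K: "subring_set K"
proof -
  have add: "x + y \<in> K" if "x \<in> K" "y \<in> K" for x y
  proof -
    have "x + y \<in> T \<or> - x - y \<in> T \<or> x - (-y) \<in> K \<or> y - (-x) \<in> K"
      using that add_mem[of x y] add_mem[of "-x" "-y"] K_diff[of x "-y"] K_diff[of y "-x"]
      by (auto simp: in_K)
    then show ?thesis by (auto simp: in_K algebra_simps)
  qed
  have "- x \<in> K" if "x \<in> K" for x using that by (auto simp: in_K)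
  then have "x - y \<in> K" if "x \<in> K" "y \<in> K" for x y
    using add[of x "-y"] that by simp
  moreover have "x * y \<in> K" if "x \<in> K" "y \<in> K" for x y
    using that mult_mem[of x y] mult_mem[of "-x" y] mult_mem[of x "-y"] mult_mem[of "-x" "-y"]
    by (auto simp: in_K)
  ultimately show ?thesis using one_mem by (auto simp: subring_set_def in_K)
qed

lemmas K_closed = subring_setD(1-6)[OF subring_K]
lemmas K_power = subring_setD(7)[OF subring_K]
lemmas K_polys = polys_over_closed[OF subring_K]

lemma T_K: "x \<in> T \<Longrightarrow> x \<in> K" by (simp add: in_K)

lemma K_inverse: "x \<in> K \<Longrightarrow> inverse x \<in> K"
  using inverse_mem[of x] inverse_mem[of "-x"] by (auto simp: in_K)

lemma K_division:
  assumes g: "g \<in> polys_over K" "g \<noteq> 0" and f: "f \<in> polys_over K"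
  obtains q r where "q \<in> polys_over K" "r \<in> polys_over K" "f = g * q + r"
    "r = 0 \<or> degree r < degree g"
  by (rule division_over_subfield[OF subring_K _ g f]) (auto simp: K_inverse intro: that)

lemma K_divide: "x \<in> K \<Longrightarrow> y \<in> K \<Longrightarrow> x / y \<in> K"
  by (simp add: divide_inverse K_closed K_inverse)

lemma pos_K: "pos x \<Longrightarrow> x \<in> K" by (simp add: pos_def in_K)

lemma pos_cases: "x \<in> K \<Longrightarrow> pos x \<or> x = 0 \<or> pos (- x)"
  by (auto simp: pos_def in_K)

lemma pos_asym: "pos x \<Longrightarrow> \<not> pos (- x)"
  using antisym by (auto simp: pos_def)

lemma pos_zero [simp]: "\<not> pos 0" by (simp add: pos_def)

lemma pos_one: "pos 1" by (simp add: pos_def one_mem)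

lemma pos_add: "pos x \<Longrightarrow> pos y \<Longrightarrow> pos (x + y)"
proof -
  assume a: "pos x" "pos y"
  have "x + y \<noteq> 0"
  proof
    assume "x + y = 0"
    then have "y = - x" by (simp add: eq_neg_iff_add_eq_0 add.commute)
    then show False using a antisym[of x] by (auto simp: pos_def)
  qed
  then show ?thesis using a add_mem by (auto simp: pos_def)
qed

lemma pos_add_T: "pos x \<Longrightarrow> y \<in> T \<Longrightarrow> pos (x + y)"
  using pos_add[of x y] by (cases "y = 0") (auto simp: pos_def)

lemma pos_mult: "pos x \<Longrightarrow> pos y \<Longrightarrow> pos (x * y)"
  using mult_mem by (auto simp: pos_def)

lemma pos_inverse: "pos x \<Longrightarrow> pos (inverse x)"
  using inverse_mem by (auto simp: pos_def)

lemma pos_divide: "pos x \<Longrightarrow> pos y \<Longrightarrow> pos (x / y)"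
  by (simp add: divide_inverse pos_mult pos_inverse)

lemma pos_of_nat: "pos (of_nat (Suc n))"
proof (induction n)
  case (Suc n)
  have "of_nat (Suc (Suc n)) = (1::'a) + of_nat (Suc n)" by simp
  then show ?case using pos_add[OF pos_one Suc] by metis
qed (simp add: pos_one)

lemma sg_simps [simp]: "sg 0 = 0" "sg 1 = 1"
  by (auto simp: sg_def one_mem)

lemma sg_pos: "x \<in> K \<Longrightarrow> sg x = 1 \<longleftrightarrow> pos x"
  by (auto simp: sg_def pos_def)

lemma sg_neg: "x \<in> K \<Longrightarrow> sg x = - 1 \<longleftrightarrow> pos (- x)"
  using antisym[of x] by (auto simp: sg_def pos_def in_K)

lemma sg_zero: "sg x = 0 \<longleftrightarrow> x = 0"
  by (auto simp: sg_def)

lemma sg_cases: "sg x = 1 \<or> sg x = 0 \<or> sg x = - 1"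
  by (auto simp: sg_def)

lemma sg_minus: "x \<in> K \<Longrightarrow> sg (- x) = - sg x"
  using pos_cases[of x] sg_pos[of x] sg_neg[of x] sg_pos[of "-x"] sg_neg[of "-x"] K_closed(3)[of x]
    sg_zero[of x] sg_zero[of "-x"] by fastforce

lemma sg_mult: assumes "x \<in> K" "y \<in> K" shows "sg (x * y) = sg x * sg y"
proof -
  have *: "sg (x * y) = sg x * sg y" if "pos x" "pos y" for x y
    using pos_mult[OF that] that pos_K by (metis mult_1 sg_pos)
  consider "x = 0 \<or> y = 0" | "pos x" "pos y" | "pos x" "pos (-y)" | "pos (-x)" "pos y" | "pos (-x)" "pos (-y)"
    using pos_cases assms by blast
  then show ?thesis
  proof cases
    case 3
    then show ?thesis using *[of x "-y"] sg_minus[of "x*y"] sg_minus[of y] assms K_closed by auto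
  next
    case 4
    then show ?thesis using *[of "-x" y] sg_minus[of "x*y"] sg_minus[of x] assms K_closed by auto
  next
    case 5
    then show ?thesis using *[of "-x" "-y"] sg_minus[of y] sg_minus[of x] assms K_closed by auto
  qed (use * in auto)
qed

lemma neg_prod_cases:
  assumes "x \<in> K" "y \<in> K"
  shows "pos (- (x * y)) \<longleftrightarrow> (pos x \<and> pos (- y)) \<or> (pos (- x) \<and> pos y)"
proof -
  have "pos (- (x * y)) \<longleftrightarrow> sg x * sg y = - 1"
    using sg_neg[of "x*y"] sg_mult assms K_closed by metis
  also have "\<dots> \<longleftrightarrow> (sg x = 1 \<and> sg y = - 1) \<or> (sg x = - 1 \<and> sg y = 1)"
    using sg_cases[of x] sg_cases[of y] by auto
  finally show ?thesis using sg_pos sg_neg assms by auto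
qed

end

locale real_closed_subfield = ordered_subfield +
  assumes IVT: "p \<in> polys_over K \<Longrightarrow> a \<in> K \<Longrightarrow> b \<in> K \<Longrightarrow> pos (b - a) \<Longrightarrow>
      pos (- (poly p a * poly p b)) \<Longrightarrow> \<exists>c\<in>K. pos (c - a) \<and> pos (b - c) \<and> poly p c = 0"

section \<open>Maximal orderings and real closed subfields of the complex numbers\<close>

text \<open>
  Such a \<open>T\<close> is a preordering of the field \<open>diffs T\<close>. That field is
  determined by \<open>T\<close>, because $x = ((x + 1)/2)^2 - ((x - 1)/2)^2$ writes each of its
  elements as a difference of squares. Hence inclusion of preorderings compares both the fields
  and their orderings, and one application of Zorn's lemma enlarges both.
\<close>

definition field_preorder :: "'a::field_char_0 set \<Rightarrow> bool" where
  "field_preorder T \<longleftrightarrow> 1 \<in> T \<and> - 1 \<notin> T \<and> (\<forall>x\<in>T. inverse x \<in> T) \<and>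
     (\<forall>x\<in>T. \<forall>y\<in>T. x + y \<in> T \<and> x * y \<in> T \<and> (x - y)\<^sup>2 \<in> T)"

definition diffs :: "'a::field_char_0 set \<Rightarrow> 'a set" where
  "diffs T = {x - y |x y. x \<in> T \<and> y \<in> T}"

lemma field_preorderD:
  assumes "field_preorder T"
  shows "1 \<in> T" "0 \<in> T" "- 1 \<notin> T" "x \<in> T \<Longrightarrow> inverse x \<in> T"
    "x \<in> T \<Longrightarrow> y \<in> T \<Longrightarrow> x + y \<in> T" "x \<in> T \<Longrightarrow> y \<in> T \<Longrightarrow> x * y \<in> T"
    "x \<in> diffs T \<Longrightarrow> x\<^sup>2 \<in> T" "x \<in> T \<Longrightarrow> - x \<in> T \<Longrightarrow> x = 0"
proof -
  note h = assms[unfolded field_preorder_def]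
  show "0 \<in> T" proof -
    have "(1 - 1)\<^sup>2 \<in> T" using h by blast
    then show ?thesis by simp
  qed
  show "x = 0" if "x \<in> T" "- x \<in> T"
  proof (rule ccontr)
    assume "x \<noteq> 0"
    moreover have "- x * inverse x \<in> T" using that h by blast
    ultimately show False using h by simp
  qed
  show "x \<in> diffs T \<Longrightarrow> x\<^sup>2 \<in> T" using h by (auto simp: diffs_def)
qed (use assms[unfolded field_preorder_def] in auto)

lemma diffs_subfield:
  assumes T: "field_preorder T"
  shows "subring_set (diffs T)" "T \<subseteq> diffs T" "x \<in> diffs T \<Longrightarrow> inverse x \<in> diffs T"
proof -
  note h = field_preorderD[OF T]
  show sub: "T \<subseteq> diffs T"
    unfolding diffs_def using h(2) by force
  have "x - y \<in> diffs T \<and> x * y \<in> diffs T" if xy: "x \<in> diffs T" "y \<in> diffs T" for x y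
  proof -
    obtain a b c d where "x = a - b" "y = c - d" and m: "a \<in> T" "b \<in> T" "c \<in> T" "d \<in> T"
      using xy unfolding diffs_def by auto
    then have "x - y = (a + d) - (b + c)" "x * y = (a * c + b * d) - (a * d + b * c)"
      by (auto simp: algebra_simps)
    moreover have "a + d \<in> T" "b + c \<in> T" "a * c + b * d \<in> T" "a * d + b * c \<in> T"
      using m h by auto
    ultimately show ?thesis unfolding diffs_def by blast
  qed
  then show ring: "subring_set (diffs T)" unfolding subring_set_def using sub h(1) by auto
  show "inverse x \<in> diffs T" if "x \<in> diffs T"
  proof -
    have "inverse (x\<^sup>2) \<in> diffs T" using h(4)[OF h(7)[OF that]] sub by blast
    then have "x * inverse (x\<^sup>2) \<in> diffs T" using ring that by (simp add: subring_set_def)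
    moreover have "x * inverse (x\<^sup>2) = inverse x" by (cases "x = 0") (auto simp: power2_eq_square)
    ultimately show ?thesis by simp
  qed
qed

lemma field_preorder_extend:
  fixes T :: "'a::field_char_0 set"
  assumes "field_preorder T"
  obtains M where "field_preorder M" "T \<subseteq> M" "\<And>T'. field_preorder T' \<Longrightarrow> M \<subseteq> T' \<Longrightarrow> T' = M"
proof -
  define A where "A = {S. field_preorder S \<and> T \<subseteq> S}"
  have "\<exists>M\<in>A. \<forall>X\<in>A. M \<subseteq> X \<longrightarrow> X = M"
  proof (rule subset_Zorn_nonempty)
    show "A \<noteq> {}" using assms by (auto simp: A_def)
    fix C assume C: "C \<noteq> {}" "subset.chain A C"
    have each: "field_preorder S" "T \<subseteq> S" if "S \<in> C" for S
      using C that by (auto simp: subset_chain_def A_def)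
    have two: "\<exists>S\<in>C. x \<in> S \<and> y \<in> S" if "x \<in> \<Union>C" "y \<in> \<Union>C" for x y
    proof -
      obtain S1 S2 where "S1 \<in> C" "x \<in> S1" "S2 \<in> C" "y \<in> S2" using \<open>x \<in> \<Union>C\<close> \<open>y \<in> \<Union>C\<close> by blast
      then show ?thesis using C(2) by (metis subset_chain_def subsetD)
    qed
    have "field_preorder (\<Union>C)"
      unfolding field_preorder_def
    proof (intro conjI ballI)
      show "1 \<in> \<Union>C" using C(1) each field_preorderD(1) by blast
      show "- 1 \<notin> \<Union>C" using each field_preorderD(3) by blast
      show "inverse x \<in> \<Union>C" if "x \<in> \<Union>C" for x using that each field_preorderD(4) by blast
      fix x y assume "x \<in> \<Union>C" "y \<in> \<Union>C"
      then obtain S where S: "S \<in> C" "x \<in> S" "y \<in> S" using two by blast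
      then show "x + y \<in> \<Union>C" "x * y \<in> \<Union>C" "(x - y)\<^sup>2 \<in> \<Union>C"
        using each(1)[OF S(1)] unfolding field_preorder_def by blast+
    qed
    then show "\<Union>C \<in> A" using C(1) each by (auto simp: A_def)
  qed
  then obtain M where "M \<in> A" "\<forall>X\<in>A. M \<subseteq> X \<longrightarrow> X = M" by blast
  then show ?thesis using that[of M] unfolding A_def by blast
qed

locale maximal_preorder =
  fixes T :: "complex set"
  assumes preorder: "field_preorder T"
    and maximal: "field_preorder T' \<Longrightarrow> T \<subseteq> T' \<Longrightarrow> T' = T"
begin

lemmas T_closed = field_preorderD[OF preorder]
lemmas D_subfield = diffs_subfield[OF preorder]
lemmas D_closed = subring_setD(1-7)[OF D_subfield(1)]

text \<open>
  If neither $x$ nor $-x$ is in $T$, then $T + xT$ is a strictly larger preordering of the same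
  field.
\<close>

lemma total_diffs:
  assumes x: "x \<in> diffs T"
  shows "x \<in> T \<or> - x \<in> T"
proof (rule ccontr)
  assume nx: "\<not> (x \<in> T \<or> - x \<in> T)"
  define T' where "T' = {s + x * t |s t. s \<in> T \<and> t \<in> T}"
  have T'I: "s + x * t \<in> T'" if "s \<in> T" "t \<in> T" for s t using that by (auto simp: T'_def)
  have sub: "T \<subseteq> T'" using T'I[OF _ T_closed(2)] by auto
  have T'D: "T' \<subseteq> diffs T"
    using x D_subfield(2) by (auto simp: T'_def intro!: D_closed)
  have mult: "u * v \<in> T'" if "u \<in> T'" "v \<in> T'" for u v
  proof -
    obtain s t s' t' where e: "u = s + x * t" "v = s' + x * t'" and m: "s \<in> T" "t \<in> T" "s' \<in> T" "t' \<in> T"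
      using \<open>u \<in> T'\<close> \<open>v \<in> T'\<close> unfolding T'_def by blast
    have "u * v = (s * s' + x\<^sup>2 * (t * t')) + x * (s * t' + s' * t)"
      unfolding e by (simp add: algebra_simps power2_eq_square)
    then show ?thesis using m T_closed x by (auto intro!: T'I)
  qed
  have "field_preorder T'"
    unfolding field_preorder_def
  proof (intro conjI ballI)
    show "1 \<in> T'" using sub T_closed by blast
    show "- 1 \<notin> T'"
    proof
      assume "- 1 \<in> T'"
      then obtain s t where st: "- 1 = s + x * t" "s \<in> T" "t \<in> T" unfolding T'_def by blast
      have "t \<noteq> 0"
      proof
        assume "t = 0"
        then have "- 1 = s" using st(1) by simp
        then show False using T_closed(3) st(2) by simp
      qed
      have "s = - 1 - x * t" unfolding st(1) by simp
      then have "- x = (1 + s) * inverse t" using \<open>t \<noteq> 0\<close> by simp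
      then show False
        using nx T_closed(6)[OF T_closed(5)[OF T_closed(1) st(2)] T_closed(4)[OF st(3)]] by simp
    qed
    fix u assume u: "u \<in> T'"
    show "inverse u \<in> T'"
    proof -
      have "inverse u \<in> diffs T" using u T'D D_subfield(3) by blast
      then have "u * (inverse u)\<^sup>2 \<in> T'" using mult[OF u] sub T_closed(7) by blast
      moreover have "u * (inverse u)\<^sup>2 = inverse u" by (cases "u = 0") (auto simp: power2_eq_square)
      ultimately show ?thesis by simp
    qed
    fix v assume v: "v \<in> T'"
    show "u * v \<in> T'" using mult u v .
    show "(u - v)\<^sup>2 \<in> T'" using u v T'D sub D_closed(5) T_closed(7) by blast
    obtain s t s' t' where e: "u = s + x * t" "v = s' + x * t'" and m: "s \<in> T" "t \<in> T" "s' \<in> T" "t' \<in> T"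
      using u v unfolding T'_def by blast
    have "u + v = (s + s') + x * (t + t')" by (simp add: e algebra_simps)
    then show "u + v \<in> T'" using T'I[OF T_closed(5)[OF m(1,3)] T_closed(5)[OF m(2,4)]] by simp
  qed
  then have "T' = T" using maximal sub by blast
  moreover have "x \<in> T'" using T'I[OF T_closed(2) T_closed(1)] by simp
  ultimately show False using nx by blast
qed

sublocale ordered_subfield T
proof
  show "1 \<in> T" by (rule T_closed)
  show "x \<in> T \<Longrightarrow> y \<in> T \<Longrightarrow> x + y \<in> T" for x y by (rule T_closed)
  show "x \<in> T \<Longrightarrow> y \<in> T \<Longrightarrow> x * y \<in> T" for x y by (rule T_closed)
  show "x \<in> T \<Longrightarrow> inverse x \<in> T" for x by (rule T_closed)
  show "x \<in> T \<Longrightarrow> - x \<in> T \<Longrightarrow> x = 0" for x by (rule T_closed)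
  show "x - y \<in> T \<or> y - x \<in> T" if "x \<in> T" "y \<in> T" for x y
    using total_diffs[of "x - y"] that by (auto simp: diffs_def)
qed

lemma diffs_eq_K: "diffs T = K"
proof
  show "diffs T \<subseteq> K" using total_diffs by (auto simp: in_K)
  show "K \<subseteq> diffs T"
  proof
    fix x assume "x \<in> K"
    then have "x \<in> T \<or> - x \<in> T" by (simp add: in_K)
    then show "x \<in> diffs T" using D_subfield(2) D_closed(3)[of "- x"] by auto
  qed
qed

text \<open>
  The polynomials $\sum_i k_i s_i^2$ with $k_i \ge 0$ in $K$: their values at a root $z$ form
  the smallest candidate for a preordering of $K(z)$ that extends the ordering of $K$.
\<close>

inductive_set weighted_sos :: "complex poly set" where
  zero: "0 \<in> weighted_sos"
| add: "u \<in> weighted_sos \<Longrightarrow> k \<in> T \<Longrightarrow> s \<in> polys_over K \<Longrightarrow> u + smult k (s\<^sup>2) \<in> weighted_sos"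

lemma weighted_sos_polys: "u \<in> weighted_sos \<Longrightarrow> u \<in> polys_over K"
  by (induction rule: weighted_sos.induct) (auto intro!: K_polys T_K)

lemma weighted_sos_add: "v \<in> weighted_sos \<Longrightarrow> u \<in> weighted_sos \<Longrightarrow> u + v \<in> weighted_sos"
proof (induction rule: weighted_sos.induct)
  case (add v k s)
  have "u + (v + smult k (s\<^sup>2)) = (u + v) + smult k (s\<^sup>2)" by simp
  then show ?case using weighted_sos.add[OF add.IH[OF add.prems] add.hyps(2,3)] by (simp only:)
qed simp

lemma weighted_sos_smult_square: "u \<in> weighted_sos \<Longrightarrow> k \<in> T \<Longrightarrow> s \<in> polys_over K \<Longrightarrow> smult k (s\<^sup>2) * u \<in> weighted_sos"
proof (induction rule: weighted_sos.induct)
  case (add v k' s')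
  have "smult k (s\<^sup>2) * (v + smult k' (s'\<^sup>2)) = smult k (s\<^sup>2) * v + smult (k * k') ((s * s')\<^sup>2)"
    by (simp add: algebra_simps power_mult_distrib)
  moreover have "k * k' \<in> T" "s * s' \<in> polys_over K"
    using add by (auto intro!: K_polys T_closed)
  ultimately show ?case using weighted_sos.add[OF add.IH] add.prems by (simp only:)
qed (simp add: weighted_sos.zero)

lemma weighted_sos_mult: "v \<in> weighted_sos \<Longrightarrow> u \<in> weighted_sos \<Longrightarrow> u * v \<in> weighted_sos"
proof (induction rule: weighted_sos.induct)
  case (add v k s)
  have "u * (v + smult k (s\<^sup>2)) = u * v + smult k (s\<^sup>2) * u" by (simp add: algebra_simps)
  then show ?case using weighted_sos_add[OF weighted_sos_smult_square[OF add.prems add.hyps(2,3)] add.IH[OF add.prems]] by (simp only:)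
qed (simp add: weighted_sos.zero)

lemma weighted_sos_poly: "u \<in> weighted_sos \<Longrightarrow> a \<in> K \<Longrightarrow> poly u a \<in> T"
proof (induction rule: weighted_sos.induct)
  case (add v k s)
  have "poly s a \<in> diffs T" using add diffs_eq_K K_polys(12) by auto
  then show ?case using add T_closed by auto
qed (simp add: zero_mem)

lemma weighted_sos_square: "s \<in> polys_over K \<Longrightarrow> s\<^sup>2 \<in> weighted_sos"
  using weighted_sos.add[OF weighted_sos.zero one_mem, of s] by simp

text \<open>
  Each $s_i$ is replaced by its remainder modulo $g$; then no degree exceeds $2 (\deg g - 1)$.
\<close>

lemma weighted_sos_reduce:
  assumes u: "u \<in> weighted_sos" and g: "g \<in> polys_over K" "degree g \<ge> 1"
  shows "\<exists>v\<in>weighted_sos. \<exists>h\<in>polys_over K. u = v + g * h \<and> degree v \<le> 2 * degree g - 2"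
  using u
proof induction
  case zero
  then show ?case using weighted_sos.zero K_polys(1) by (intro bexI[of _ 0]) auto
next
  case (add u k s)
  obtain v h where vh: "v \<in> weighted_sos" "h \<in> polys_over K" "u = v + g * h" "degree v \<le> 2 * degree g - 2"
    using add.IH by blast
  obtain q r where qr: "q \<in> polys_over K" "r \<in> polys_over K" "s = g * q + r" "r = 0 \<or> degree r < degree g"
    using K_division[OF g(1) _ add.hyps(3)] g(2) by (metis degree_0 not_one_le_zero)
  define v' where "v' = v + smult k (r\<^sup>2)"
  define h' where "h' = h + smult k (g * q\<^sup>2 + (q * r + q * r))"
  have "v' \<in> weighted_sos" unfolding v'_def using vh add qr by (intro weighted_sos.add) auto
  moreover have "h' \<in> polys_over K"
    unfolding h'_def using vh qr g add.hyps by (intro K_polys T_K)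
  moreover have "u + smult k (s\<^sup>2) = v' + g * h'"
    unfolding v'_def h'_def vh(3) qr(3) by (simp add: algebra_simps power2_eq_square smult_add_right)
  moreover have "degree (smult k (r\<^sup>2)) \<le> 2 * degree g - 2"
  proof -
    have "degree (r\<^sup>2) \<le> degree r * 2" by (rule degree_power_le)
    moreover have "degree r \<le> degree g - 1" using qr(4) g(2) by auto
    ultimately have "degree (r\<^sup>2) \<le> 2 * degree g - 2" using g(2) by linarith
    then show ?thesis using degree_smult_le order_trans by blast
  qed
  ultimately show ?case using vh(4) unfolding v'_def by (blast intro: degree_add_le)
qed

text \<open>
  The descent of Artin and Schreier. In an identity $1 + \sum_i k_i s_i^2 = g h$ the $s_i$ can
  be reduced modulo $g$, and then $\deg h < \deg g$. The left-hand side is positive at $a$ and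
  at $b$, so $h$ changes sign between them as $g$ does, and the same identity contradicts the
  statement for $h$.
\<close>

lemma sign_change_no_identity:
  assumes "g \<in> polys_over K" "a \<in> K" "b \<in> K" "pos (- (poly g a * poly g b))"
    "u \<in> weighted_sos" "h \<in> polys_over K"
  shows "u + 1 \<noteq> g * h"
  using assms(1,4-)
proof (induction "degree g" arbitrary: g u h rule: less_induct)
  case (less g u h)
  show ?case
  proof
    assume eq: "u + 1 = g * h"
    have deg: "degree g \<ge> 1"
    proof (rule ccontr)
      assume "\<not> ?thesis"
      then obtain c where "g = [:c:]" by (metis degree_0_id One_nat_def less_one not_le of_nat_eq_of_nat_power_cancel_iff degree_eq_zeroE)
      then have "poly g a * poly g b = c * c" "c \<in> K" using less.prems(1) polys_overD[of g _ 0] by auto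
      then show False using less.prems(2) T_closed(7)[of c] diffs_eq_K pos_asym[of "c*c"]
        by (auto simp: power2_eq_square pos_def)
    qed
    obtain v h0 where v: "v \<in> weighted_sos" "h0 \<in> polys_over K" "u = v + g * h0" "degree v \<le> 2 * degree g - 2"
      using weighted_sos_reduce[OF less.prems(3,1) deg] by blast
    define h2 where "h2 = h - h0"
    have h2: "h2 \<in> polys_over K" unfolding h2_def using less.prems v by (intro K_polys)
    have eq2: "v + 1 = g * h2" using eq by (simp add: v(3) h2_def algebra_simps)
    have val: "pos (poly g c * poly h2 c)" if "c \<in> K" for c
    proof -
      have "poly g c * poly h2 c = 1 + poly v c" by (metis add.commute eq2 poly_1 poly_add poly_mult)
      then show ?thesis using pos_add_T[OF pos_one weighted_sos_poly[OF v(1) that]] by simp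
    qed
    have vK: "poly g a \<in> K" "poly g b \<in> K" "poly h2 a \<in> K" "poly h2 b \<in> K"
      using less.prems(1) h2 assms(2,3) K_polys(12) by blast+
    have "sg (poly g a) * sg (poly h2 a) = 1" "sg (poly g b) * sg (poly h2 b) = 1"
      using val assms(2,3) sg_mult vK sg_pos pos_K by metis+
    moreover have "sg (poly g a) * sg (poly g b) = - 1"
      using less.prems(2) sg_mult sg_neg vK K_closed(6) by metis
    ultimately have "sg (poly h2 a) * sg (poly h2 b) = - 1"
      using sg_cases[of "poly g a"] sg_cases[of "poly g b"] sg_cases[of "poly h2 a"] sg_cases[of "poly h2 b"]
      by auto
    then have ch: "pos (- (poly h2 a * poly h2 b))"
      using sg_mult sg_neg vK K_closed(6) by metis
    have "h2 \<noteq> 0" using val[OF assms(2)] by auto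
    then have "degree g + degree h2 = degree (g * h2)" using deg by (subst degree_mult_eq) auto
    also have "\<dots> \<le> 2 * degree g - 2"
      unfolding eq2[symmetric] by (rule degree_add_le) (use v(4) in auto)
    finally have "degree h2 < degree g" using deg by linarith
    then have "v + 1 \<noteq> h2 * g" using less.hyps[OF _ h2 ch v(1) less.prems(1)] by blast
    then show False using eq2 by (simp add: mult.commute)
  qed
qed

end

context maximal_preorder begin

text \<open>
  If $g$ is the minimal polynomial of $z$ and $-1$ is not a weighted sum of squares modulo $g$,
  then the values at $z$ of weighted sums of squares form a field preorder of $K(z)$ that
  contains \<open>T\<close>. By maximality it is \<open>T\<close>.
\<close>

lemma adjoin_root:
  assumes g: "g \<in> polys_over K" "degree g \<ge> 1" and z: "poly g z = 0"
    and min: "\<And>s. s \<in> polys_over K \<Longrightarrow> poly s z = 0 \<Longrightarrow> degree s < degree g \<Longrightarrow> s = 0"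
    and no: "\<And>u h. u \<in> weighted_sos \<Longrightarrow> h \<in> polys_over K \<Longrightarrow> u + 1 \<noteq> g * h"
  shows "z \<in> K"
proof -
  define E where "E = {poly s z |s. s \<in> polys_over K}"
  define T' where "T' = {poly u z |u. u \<in> weighted_sos}"
  have red: "\<exists>r\<in>polys_over K. poly r z = poly s z \<and> degree r < degree g \<and> (\<exists>q\<in>polys_over K. s = g * q + r)" if s: "s \<in> polys_over K" for s
  proof -
    obtain q r where qr: "q \<in> polys_over K" "r \<in> polys_over K" "s = g * q + r" "r = 0 \<or> degree r < degree g"
      using K_division[OF g(1) _ s] g(2) by (metis degree_0 not_one_le_zero)
    then show ?thesis using z g(2) by (intro bexI[of _ r]) auto
  qed
  have inv: "\<exists>v\<in>polys_over K. poly s z * poly v z = 1" if "s \<in> polys_over K" "s \<noteq> 0" "degree s < degree g" for s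
    using that
  proof (induction "degree s" arbitrary: s rule: less_induct)
    case (less s)
    show ?case
    proof (cases "degree s = 0")
      case True
      then obtain c where c: "s = [:c:]" by (metis degree_eq_zeroE)
      then have "c \<in> K" "c \<noteq> 0" using less.prems polys_overD[of s _ 0] by auto
      then show ?thesis using c K_polys(3) K_inverse by (intro bexI[of _ "[:inverse c:]"]) auto
    next
      case False
      obtain q r where qr: "q \<in> polys_over K" "r \<in> polys_over K" "g = s * q + r" "r = 0 \<or> degree r < degree s"
        using K_division[OF less.prems(1,2) g(1)] by metis
      have sz: "poly s z \<noteq> 0" using less.prems min by blast
      have "r \<noteq> 0"
      proof
        assume r0: "r = 0"
        then have "q \<noteq> 0" using qr(3) g(2) by auto
        moreover have "poly q z = 0" using qr(3) r0 z sz by simp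
        moreover have "degree g = degree s + degree q" using qr(3) r0 \<open>q \<noteq> 0\<close> less.prems(2)
          by (simp add: degree_mult_eq)
        ultimately show False using min[OF qr(1)] False by auto
      qed
      then obtain v where v: "v \<in> polys_over K" "poly r z * poly v z = 1"
        using less.hyps[of r] qr less.prems(3) by auto
      have "poly r z = - (poly s z * poly q z)" using qr(3) z by (metis add.commute add_eq_0_iff2 poly_add poly_mult)
      then have "poly s z * poly (- q * v) z = 1" using v(2) by (simp add: mult.assoc)
      moreover have "- q * v \<in> polys_over K" using qr v by (intro K_polys)
      ultimately show ?thesis by blast
    qed
  qed
  have E_inv: "inverse x \<in> E" if xE: "x \<in> E" for x
  proof (cases "x = 0")
    case True
    then show ?thesis using that by simp
  next
    case False
    obtain s where s: "x = poly s z" "s \<in> polys_over K" using xE unfolding E_def by blast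
    obtain r where r: "r \<in> polys_over K" "poly r z = poly s z" "degree r < degree g" using red[OF s(2)] by blast
    then obtain v where "v \<in> polys_over K" "x * poly v z = 1" using inv[of r] False s by fastforce
    then show ?thesis unfolding E_def using False by (metis (mono_tags, lifting) inverse_unique mem_Collect_eq)
  qed
  have T'E: "T' \<subseteq> E" unfolding T'_def E_def using weighted_sos_polys by blast
  have sqE: "x\<^sup>2 \<in> T'" if "x \<in> E" for x
    using that weighted_sos_square unfolding E_def T'_def by (auto simp flip: poly_power)
  have mult: "x * y \<in> T'" if "x \<in> T'" "y \<in> T'" for x y
    using that weighted_sos_mult unfolding T'_def by (auto simp flip: poly_mult)
  have T_sub: "T \<subseteq> T'"
  proof
    fix k assume "k \<in> T"
    then have "0 + smult k (1\<^sup>2) \<in> weighted_sos" by (intro weighted_sos.intros K_polys)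
    then show "k \<in> T'" unfolding T'_def by force
  qed
  have "field_preorder T'"
    unfolding field_preorder_def
  proof (intro conjI ballI)
    show "1 \<in> T'" using T_sub T_closed by blast
    show "- 1 \<notin> T'"
    proof
      assume "- 1 \<in> T'"
      then obtain u where u0: "u \<in> weighted_sos" "- 1 = poly u z" unfolding T'_def by blast
      then have u: "u \<in> weighted_sos" "poly (u + 1) z = 0" by (simp_all flip: u0(2))
      have "u + 1 \<in> polys_over K" using weighted_sos_polys u K_polys by blast
      then obtain r q where "r \<in> polys_over K" "poly r z = 0" "degree r < degree g" "q \<in> polys_over K"
        "u + 1 = g * q + r" using red[of "u + 1"] u by auto
      then show False using min[of r] no[OF u(1)] by auto
    qed
    fix x assume x: "x \<in> T'"
    show "inverse x \<in> T'"
    proof -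
      have "x * (inverse x)\<^sup>2 \<in> T'" using mult[OF x] sqE E_inv T'E x by blast
      moreover have "x * (inverse x)\<^sup>2 = inverse x" by (cases "x = 0") (auto simp: power2_eq_square)
      ultimately show ?thesis by simp
    qed
    fix y assume y: "y \<in> T'"
    show "x * y \<in> T'" using mult x y .
    show "x + y \<in> T'" using x y weighted_sos_add unfolding T'_def by (auto simp flip: poly_add)
    obtain p q where "x = poly p z" "y = poly q z" "p \<in> polys_over K" "q \<in> polys_over K"
      using x y T'E unfolding E_def by blast
    then have "x - y \<in> E" using K_polys(7)[of p q] unfolding E_def
      by (metis (mono_tags, lifting) mem_Collect_eq poly_diff)
    then show "(x - y)\<^sup>2 \<in> T'" by (rule sqE)
  qed
  then have "T' = T" using maximal T_sub by blast
  moreover have "((z + 1) / 2)\<^sup>2 \<in> T'" "((z - 1) / 2)\<^sup>2 \<in> T'"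
  proof -
    have half: "1 / 2 \<in> K" using K_divide K_closed(4)[OF K_closed(2) K_closed(2)] K_closed(2) by simp
    have "(z + 1) / 2 = poly [:1/2, 1/2:] z" "(z - 1) / 2 = poly [:- (1/2), 1/2:] z"
      by (auto simp: field_simps)
    moreover have "[:1/2, 1/2:] \<in> polys_over K" "[:- (1/2), 1/2:] \<in> polys_over K"
      using half K_closed by (intro K_polys; auto)+
    ultimately show "((z + 1) / 2)\<^sup>2 \<in> T'" "((z - 1) / 2)\<^sup>2 \<in> T'" using sqE unfolding E_def by blast+
  qed
  ultimately have "((z + 1) / 2)\<^sup>2 - ((z - 1) / 2)\<^sup>2 \<in> K" using K_diff by blast
  moreover have "((z + 1) / 2)\<^sup>2 - ((z - 1) / 2)\<^sup>2 = z" by (simp add: field_simps power2_eq_square)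
  ultimately show ?thesis by simp
qed

text \<open>
  Let $m$ be the minimal polynomial over $K$ of a complex root $z$ of $g$. If $m$ is a proper
  factor of $g$, then $m$ or the cofactor changes sign and has lower degree. Otherwise $g$
  itself is minimal, the sign change makes $K(z)$ orderable, maximality puts $z$ into $K$, and
  therefore $g$ is linear.
\<close>

lemma intermediate_value:
  assumes "g \<in> polys_over K" "a \<in> K" "b \<in> K" "pos (b - a)" "pos (- (poly g a * poly g b))"
  shows "\<exists>c\<in>K. pos (c - a) \<and> pos (b - c) \<and> poly g c = 0"
  using assms(1,5)
proof (induction "degree g" arbitrary: g rule: less_induct)
  case (less g)
  have g0: "g \<noteq> 0" using less.prems by auto
  have deg: "degree g \<ge> 1"
  proof (rule ccontr)
    assume "\<not> ?thesis"
    then obtain c where "g = [:c:]" by (metis One_nat_def less_one not_le degree_eq_zeroE)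
    then have "poly g a * poly g b = c * c" "c \<in> K" using less.prems(1) polys_overD[of g _ 0] by auto
    then show False using less.prems(2) T_closed(7)[of c] diffs_eq_K pos_asym[of "c*c"]
      by (auto simp: power2_eq_square pos_def)
  qed
  then obtain z where z: "poly g z = 0"
    using fundamental_theorem_of_algebra[of g] by (metis constant_degree One_nat_def not_one_le_zero)
  define P where "P = (\<lambda>m. m \<in> polys_over K \<and> m \<noteq> 0 \<and> poly m z = 0)"
  define m where "m = arg_min degree P"
  have Pm: "P m" and mmin: "\<And>s. P s \<Longrightarrow> degree m \<le> degree s"
    using arg_min_nat_lemma[of P g degree] g0 z less.prems(1) unfolding m_def P_def by blast+
  have m: "m \<in> polys_over K" "m \<noteq> 0" "poly m z = 0" using Pm by (auto simp: P_def)
  have degm: "degree m \<ge> 1"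
    using m by (metis One_nat_def Suc_leI degree_eq_zeroE neq0_conv mult_zero_right pCons_0_0 poly_0 poly_pCons add_0_right)
  obtain h r where hr: "h \<in> polys_over K" "r \<in> polys_over K" "g = m * h + r" "r = 0 \<or> degree r < degree m"
    using K_division[OF m(1,2) less.prems(1)] by metis
  have "r = 0"
  proof (rule ccontr)
    assume "r \<noteq> 0"
    then have "P r" unfolding P_def using hr m z by auto
    then show False using mmin[of r] hr(4) \<open>r \<noteq> 0\<close> by auto
  qed
  then have g_mh: "g = m * h" using hr by simp
  then have h0: "h \<noteq> 0" using g0 by auto
  have dg: "degree g = degree m + degree h" using g_mh m(2) h0 by (simp add: degree_mult_eq)
  show ?case
  proof (cases "degree m < degree g")
    case True
    have vK: "poly m a \<in> K" "poly m b \<in> K" "poly h a \<in> K" "poly h b \<in> K"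
      using m hr assms(2,3) K_polys(12) by auto
    have "sg (poly g a * poly g b) = - 1"
      using less.prems sg_neg assms K_polys(12) K_closed(6) by auto
    then have "(sg (poly m a) * sg (poly m b)) * (sg (poly h a) * sg (poly h b)) = - 1"
      using vK by (simp add: g_mh sg_mult K_closed algebra_simps)
    then have "sg (poly m a) * sg (poly m b) = - 1 \<or> sg (poly h a) * sg (poly h b) = - 1"
      using sg_cases[of "poly m a"] sg_cases[of "poly m b"] sg_cases[of "poly h a"] sg_cases[of "poly h b"]
      by auto
    then have "pos (- (poly m a * poly m b)) \<or> pos (- (poly h a * poly h b))"
      using sg_mult sg_neg vK K_closed(6) by metis
    then show ?thesis
    proof
      assume "pos (- (poly m a * poly m b))"
      then show ?thesis using less.hyps[OF True m(1)] by (auto simp: g_mh)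
    next
      assume "pos (- (poly h a * poly h b))"
      moreover have "degree h < degree g" using dg degm by simp
      ultimately show ?thesis using less.hyps[OF _ hr(1)] by (auto simp: g_mh)
    qed
  next
    case False
    then have "s = 0" if "s \<in> polys_over K" "poly s z = 0" "degree s < degree g" for s
      using mmin[of s] that by (auto simp: P_def)
    then have zK: "z \<in> K"
      using adjoin_root[OF less.prems(1) deg z] sign_change_no_identity[OF less.prems(1) assms(2,3) less.prems(2)]
      by blast
    then have "[:- z, 1:] \<in> polys_over K" using K_closed by (intro K_polys) auto
    then have "P [:- z, 1:]" by (simp add: P_def)
    then have "degree m \<le> 1" using mmin by fastforce
    then have "degree g = 1" using False deg by auto
    then obtain c0 c1 where c: "g = [:c0, c1:]" "c1 \<noteq> 0"
      by (metis degree1_coeffs pCons_0_0 One_nat_def)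
    then have c0: "c0 = - (z * c1)" using z by (simp add: eq_neg_iff_add_eq_0)
    have c1K: "c1 \<in> K" using polys_overD[OF less.prems(1), of 1] c by simp
    have zab: "z - a \<in> K" "b - z \<in> K" "c1 * c1 \<in> K" using zK assms c1K K_closed by auto
    have "- (poly g a * poly g b) = (c1 * c1) * ((z - a) * (b - z))"
      by (simp add: c(1) c0 algebra_simps)
    then have "sg ((c1 * c1) * ((z - a) * (b - z))) = 1" using less.prems pos_K sg_pos by metis
    then have "(sg c1 * sg c1) * (sg (z - a) * sg (b - z)) = 1" using zab c1K K_closed by (simp add: sg_mult)
    then have "sg (z - a) * sg (b - z) = 1"
      using sg_cases[of c1] by auto
    moreover have "sg (z - a) \<noteq> - 1 \<or> sg (b - z) \<noteq> - 1"
    proof (rule ccontr)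
      assume "\<not> ?thesis"
      then have "pos (- (z - a))" "pos (- (b - z))" using zab sg_neg by auto
      then have "pos (- (b - a))" using pos_add by fastforce
      then show False using pos_asym assms(4) by blast
    qed
    ultimately have "sg (z - a) = 1" "sg (b - z) = 1"
      using sg_cases[of "z - a"] sg_cases[of "b - z"] by auto
    then show ?thesis using zab sg_pos z zK by blast
  qed
qed

sublocale real_closed_subfield T
  by standard (rule intermediate_value)

end

section \<open>Signs of a polynomial between neighbouring points\<close>

context real_closed_subfield
begin

lemma K_half: "x \<in> K \<Longrightarrow> y \<in> K \<Longrightarrow> (x + y) / 2 \<in> K"
proof -
  have "(1::'a) + 1 \<in> K" by (intro K_closed)
  then have "(2::'a) \<in> K" by simp
  then show "x \<in> K \<Longrightarrow> y \<in> K \<Longrightarrow> (x + y) / 2 \<in> K" by (intro K_divide K_closed)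
qed

lemma pos_half: "pos x \<Longrightarrow> pos (x / 2)"
proof -
  have "pos ((1::'a) + 1)" using pos_add pos_one by blast
  then show "pos x \<Longrightarrow> pos (x / 2)" using pos_divide by simp
qed

lemma pos_trans: "pos (y - x) \<Longrightarrow> pos (z - y) \<Longrightarrow> pos (z - x)"
  using pos_add[of "y - x" "z - y"] by simp

lemma pos_mult_cancel: "pos x \<Longrightarrow> pos (x * y) \<Longrightarrow> pos y"
  using pos_mult[OF pos_inverse[of x], of "x * y"] by (cases "x = 0") (auto simp flip: mult.assoc)

lemma root_factor:
  assumes "p \<in> polys_over K" "a \<in> K" "poly p a = 0"
  obtains q where "q \<in> polys_over K" "p = [:- a, 1:] * q"
proof -
  have g: "[:- a, 1:] \<in> polys_over K" "[:- a, 1:] \<noteq> 0" using assms K_closed by (auto intro!: K_polys)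
  obtain q r where qr: "q \<in> polys_over K" "p = [:- a, 1:] * q + r" "r = 0 \<or> degree r < degree [:- a, 1:]"
    using K_division[OF g assms(1)] by metis
  have "degree r = 0" using qr(3) by auto
  then obtain c where "r = [:c:]" by (metis degree_eq_zeroE)
  moreover have "poly r a = 0" using qr(2) assms(3) by simp
  ultimately show ?thesis using that qr by auto
qed

lemma least_exists:
  assumes "finite S" "S \<noteq> {}" "S \<subseteq> K"
  shows "\<exists>m\<in>S. \<forall>s\<in>S. \<not> pos (m - s)"
  using assms
proof (induction S rule: finite_ne_induct)
  case (insert x F)
  then obtain m where m: "m \<in> F" "\<forall>s\<in>F. \<not> pos (m - s)" by auto
  show ?case
  proof (cases "pos (m - x)")
    case True
    then have "\<not> pos (x - s)" if "s \<in> F" for s using m that pos_trans by blast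
    then show ?thesis by auto
  next
    case False
    then show ?thesis using m by auto
  qed
qed simp

text \<open>
  Suppose $h(b) \le h(a)$. Write $h - h(a) = (X - a) Q$ with $Q(a) = h'(a) > 0$, and let $c$ be
  the first root of $Q$ after $a$. Between $a$ and $c$ the values of $h$ exceed $h(a) = h(c)$,
  whereas $h'(c) > 0$ forces values below $h(c)$ just before $c$: by the intermediate value
  property the second cofactor $R$ in $h - h(a) = (X - c) R$ has a root between $a$ and $c$, and
  there $Q$ vanishes as well.
\<close>

lemma strictly_increasing:
  assumes h: "h \<in> polys_over K" and C: "C \<subseteq> K"
    and convex: "\<And>x y z. x \<in> C \<Longrightarrow> y \<in> C \<Longrightarrow> z \<in> K \<Longrightarrow> pos (z - x) \<Longrightarrow> pos (y - z) \<Longrightarrow> z \<in> C"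
    and deriv: "\<And>x. x \<in> C \<Longrightarrow> pos (poly (pderiv h) x)"
    and ab: "a \<in> C" "b \<in> C" "pos (b - a)"
  shows "pos (poly h b - poly h a)"
proof (rule ccontr)
  assume neg: "\<not> ?thesis"
  have aK: "a \<in> K" and bK: "b \<in> K" using ab C by auto
  have d_factor: "poly Q c = poly (pderiv h) c" if "h - [:poly h a:] = [:- c, 1:] * Q" for Q c
  proof -
    have "pderiv h = pderiv (h - [:poly h a:])" by (simp add: pderiv_diff pderiv_pCons)
    also have "\<dots> = [:- c, 1:] * pderiv Q + Q * pderiv [:- c, 1:]" unfolding that by (rule pderiv_mult)
    finally show ?thesis by (simp add: pderiv_pCons)
  qed
  have hK: "h - [:poly h a:] \<in> polys_over K" using h aK by (intro K_polys)
  obtain Q where Q: "Q \<in> polys_over K" "h - [:poly h a:] = [:- a, 1:] * Q"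
    using root_factor[OF hK aK] by auto
  have Qval: "poly h x - poly h a = (x - a) * poly Q x" for x
    using arg_cong[OF Q(2), of "\<lambda>p. poly p x"] by (simp add: algebra_simps)
  have Qa: "pos (poly Q a)" using d_factor[OF Q(2)] deriv ab by simp
  have QK: "poly Q x \<in> K" if "x \<in> K" for x using K_polys(12) Q(1) that by blast
  define S where "S = {c\<in>K. pos (c - a) \<and> (c = b \<or> pos (b - c)) \<and> poly Q c = 0}"
  have finS: "finite S"
  proof (rule finite_subset)
    show "S \<subseteq> {c. poly Q c = 0}" by (auto simp: S_def)
    show "finite {c. poly Q c = 0}" using Qa by (intro poly_roots_finite) auto
  qed
  have "S \<noteq> {}"
  proof (cases "poly Q b = 0")
    case True
    then show ?thesis using bK ab by (auto simp: S_def)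
  next
    case False
    have "\<not> pos (poly Q b)" using neg Qval[of b] pos_mult ab(3) by auto
    then have "pos (- poly Q b)" using False pos_cases QK bK by blast
    then have "pos (- (poly Q a * poly Q b))" using neg_prod_cases Qa QK aK bK by blast
    then show ?thesis using IVT[OF Q(1) aK bK ab(3)] by (auto simp: S_def)
  qed
  then obtain c where c: "c \<in> S" "\<forall>s\<in>S. \<not> pos (c - s)"
    using least_exists[OF finS] by (auto simp: S_def)
  have cK: "c \<in> K" and ca: "pos (c - a)" and Qc: "poly Q c = 0" and cb: "c = b \<or> pos (b - c)"
    using c by (auto simp: S_def)
  have least: "poly Q y \<noteq> 0" if "y \<in> K" "pos (y - a)" "pos (c - y)" for y
  proof
    assume "poly Q y = 0"
    then have "y \<in> S" using that cb pos_trans unfolding S_def by blast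
    then show False using c(2) that by blast
  qed
  have cC: "c \<in> C" using cb convex[OF ab(1,2) cK ca] ab by blast
  have "poly (h - [:poly h a:]) c = 0" using Qval[of c] Qc by simp
  then obtain R where R: "R \<in> polys_over K" "h - [:poly h a:] = [:- c, 1:] * R"
    using root_factor[OF hK cK] by blast
  have Rval: "(x - a) * poly Q x = (x - c) * poly R x" for x
    using arg_cong[OF R(2), of "\<lambda>p. poly p x"] Qval[of x] by (simp add: algebra_simps)
  have Rc: "pos (poly R c)" using d_factor[OF R(2)] deriv cC by simp
  have RK: "poly R x \<in> K" if "x \<in> K" for x using K_polys(12) R(1) that by blast
  define x where "x = (a + c) / 2"
  have xK: "x \<in> K" unfolding x_def using aK cK K_half by blast
  have x: "pos (x - a)" "pos (c - x)"
    using pos_half[OF ca] by (simp_all add: x_def field_simps)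
  have "pos (poly Q x)"
  proof (rule ccontr)
    assume "\<not> ?thesis"
    then have "pos (- poly Q x)" using least[OF xK x] pos_cases QK xK by blast
    then have "pos (- (poly Q a * poly Q x))" using neg_prod_cases Qa QK aK xK by blast
    then obtain y where "y \<in> K" "pos (y - a)" "pos (x - y)" "poly Q y = 0"
      using IVT[OF Q(1) aK xK x(1)] by blast
    then show False using least pos_trans x(2) by blast
  qed
  then have "pos ((x - a) * poly Q x)" using x pos_mult by blast
  then have "pos ((c - x) * - poly R x)" unfolding Rval by (simp add: algebra_simps)
  then have "pos (- poly R x)" using pos_mult_cancel x(2) by blast
  then have "pos (- (poly R x * poly R c))" using neg_prod_cases Rc RK xK cK by blast
  then obtain y where y: "y \<in> K" "pos (y - x)" "pos (c - y)" "poly R y = 0"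
    using IVT[OF R(1) xK cK x(2)] by blast
  have ya: "pos (y - a)" using pos_trans[OF x(1) y(2)] .
  then have "y \<noteq> a" by auto
  then have "poly Q y = 0" using Rval[of y] y(4) by simp
  then show False using least[OF y(1) ya y(3)] by blast
qed

text \<open>
  For $\sigma = 1$ this is the sign near $\infty$, for $\sigma = -1$ the sign near $-\infty$.
\<close>

lemma sign_at_infinity:
  assumes p: "p \<in> polys_over K" "p \<noteq> 0" and \<sigma>: "\<sigma> = 1 \<or> \<sigma> = - 1"
  shows "\<exists>M. pos M \<and> (\<forall>x. pos (x - M) \<longrightarrow> pos (lead_coeff p * \<sigma> ^ degree p * poly p (\<sigma> * x)))"
proof -
  have \<sigma>K: "\<sigma> \<in> K" using \<sigma> K_closed by auto
  \<comment> \<open>The positive lower bound \<open>e\<close> is what the induction on the coefficients needs.\<close>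
  have "\<exists>M e. pos M \<and> pos e \<and> (\<forall>x. pos (x - M) \<longrightarrow>
      pos (lead_coeff p * \<sigma> ^ degree p * poly p (\<sigma> * x) - e))"
    using p
  proof (induction p)
    case (pCons a q)
    show ?case
    proof (cases "q = 0")
      case True
      then have "a \<noteq> 0" "a \<in> K" using pCons.prems polys_overD[of "pCons a q" K 0] by auto
      then have "pos (a * a)" using pos_mult pos_cases by fastforce
      then have "pos (a * a / 2)" by (rule pos_half)
      moreover have "a * a - a * a / 2 = a * a / 2" by (simp add: field_simps)
      ultimately show ?thesis using True pos_one by (intro exI[of _ 1] exI[of _ "a * a / 2"]) auto
    next
      case False
      have qK: "q \<in> polys_over K" using pCons.prems
        by (intro polys_overI) (metis coeff_pCons_Suc polys_overD)
      have aK: "a \<in> K" using polys_overD[of "pCons a q" K 0] pCons.prems by simp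
      obtain M e where IH: "pos M" "pos e"
        "\<And>x. pos (x - M) \<Longrightarrow> pos (lead_coeff q * \<sigma> ^ degree q * poly q (\<sigma> * x) - e)"
        using pCons.IH[OF qK False] by blast
      define D where "D = lead_coeff q * \<sigma> ^ Suc (degree q) * a"
      have DK: "D \<in> K" unfolding D_def by (intro K_closed K_power polys_overD[OF qK] \<sigma>K aK)
      define w where "w = (if pos (e - D) then (e - D) / e else 0)"
      have wT: "w \<in> T" unfolding w_def using pos_divide IH zero_mem by (auto simp: pos_def)
      have "w * e + D - e \<in> T"
      proof (cases "pos (e - D)")
        case True
        then show ?thesis using IH(2) zero_mem by (simp add: w_def pos_def)
      next
        case False
        moreover have "e - D \<in> K" by (intro K_closed DK pos_K IH(2))
        ultimately have "e - D = 0 \<or> pos (- (e - D))" using pos_cases by blast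
        then show ?thesis using False zero_mem by (auto simp: w_def pos_def)
      qed
      then have k1: "pos (M * e + (w * e + D - e))" using pos_add_T pos_mult IH by blast
      have "pos (lead_coeff (pCons a q) * \<sigma> ^ degree (pCons a q) * poly (pCons a q) (\<sigma> * x) - e)"
        if x: "pos (x - (M + w))" for x
      proof -
        have xM: "pos (x - M)" using pos_add_T[OF x wT] by (simp add: algebra_simps)
        have xp: "pos x" using pos_add[OF xM IH(1)] by simp
        define v where "v = lead_coeff q * \<sigma> ^ degree q * poly q (\<sigma> * x)"
        have "pos (x * (v - e))" using IH(3)[OF xM] xp pos_mult unfolding v_def by blast
        moreover have "pos ((x - (M + w)) * e)" using x IH pos_mult by blast
        ultimately have "pos (x * (v - e) + ((x - (M + w)) * e + (M * e + (w * e + D - e))))"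
          using k1 pos_add by blast
        also have "x * (v - e) + ((x - (M + w)) * e + (M * e + (w * e + D - e))) = D + x * v - e"
          by (simp add: algebra_simps)
        also have "D + x * v = lead_coeff q * \<sigma> ^ Suc (degree q) * (a + (\<sigma> * x) * poly q (\<sigma> * x))"
          using \<sigma> by (auto simp: D_def v_def algebra_simps)
        finally show ?thesis using False by simp
      qed
      then show ?thesis using IH pos_add_T[OF IH(1) wT] by blast
    qed
  qed simp
  then obtain M e where Me: "pos M" "pos e"
    "\<And>x. pos (x - M) \<Longrightarrow> pos (lead_coeff p * \<sigma> ^ degree p * poly p (\<sigma> * x) - e)" by blast
  have "pos (lead_coeff p * \<sigma> ^ degree p * poly p (\<sigma> * x))" if "pos (x - M)" for x
    using pos_add[OF Me(3)[OF that] Me(2)] by simp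
  then show ?thesis using Me by blast
qed

text \<open>
  For \<open>x\<close> outside of a finite set \<open>D\<close> this is the open interval around
  \<open>x\<close> between two neighbouring points of \<open>D\<close>.
\<close>

definition cell :: "'a set \<Rightarrow> 'a \<Rightarrow> 'a set" where
  "cell D x = {y\<in>K. \<forall>\<delta>\<in>D. sg (y - \<delta>) = sg (x - \<delta>)}"

lemma sg_eq_pos: "u \<in> K \<Longrightarrow> s = 1 \<or> s = - 1 \<Longrightarrow> sg u = s \<longleftrightarrow> pos (of_int s * u)"
  using sg_pos sg_neg by auto

lemma cell_convex:
  assumes "D \<subseteq> K" "y \<in> cell D x" "y' \<in> cell D x" "z \<in> K" "pos (z - y)" "pos (y' - z)"
  shows "z \<in> cell D x"
proof -
  have "sg (z - \<delta>) = sg (x - \<delta>)" if d: "\<delta> \<in> D" for \<delta>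
  proof -
    have K: "\<delta> \<in> K" "y \<in> K" "y' \<in> K" using assms d by (auto simp: cell_def)
    have e: "sg (y - \<delta>) = sg (x - \<delta>)" "sg (y' - \<delta>) = sg (x - \<delta>)" using assms d by (auto simp: cell_def)
    have "sg (x - \<delta>) \<noteq> 0"
    proof
      assume "sg (x - \<delta>) = 0"
      then have "y = \<delta>" "y' = \<delta>" using e sg_zero[of "y - \<delta>"] sg_zero[of "y' - \<delta>"] by simp_all
      then show False using assms(5,6) pos_asym[of "z - \<delta>"] by simp
    qed
    then consider "sg (x - \<delta>) = 1" | "sg (x - \<delta>) = - 1" using sg_cases by blast
    then show ?thesis
    proof cases
      case 1
      then have "pos (y - \<delta>)" using e sg_pos K K_closed by simp
      then show ?thesis using 1 pos_trans[OF _ assms(5)] sg_pos K assms(4) K_closed by simp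
    next
      case 2
      then have "pos (\<delta> - y')" using e sg_neg[of "y' - \<delta>"] K K_closed by simp
      then have "pos (- (z - \<delta>))" using pos_trans[OF assms(6)] by simp
      then show ?thesis using 2 sg_neg[of "z - \<delta>"] K assms(4) K_closed by simp
    qed
  qed
  then show ?thesis using assms(4) by (simp add: cell_def)
qed

text \<open>
  An increasing polynomial is positive on an interval if and only if it is nonnegative at the
  left end point; on an interval without left end point it is eventually negative. The sign
  \<open>s\<close> treats this statement together with its mirror image. The right-hand side
  speaks only of finitely many signs at points of \<open>D\<close>, which is why it carries over
  to another real closed field.
\<close>

lemma cell_sign:
  assumes D: "finite D" "D \<subseteq> K" and x: "x \<in> K" "x \<notin> D" and s: "s = 1 \<or> s = - 1"
    and h: "h \<in> polys_over K" "degree h \<ge> 1"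
    and deriv: "\<And>y. y \<in> cell D x \<Longrightarrow> pos (poly (pderiv h) y)"
  shows "(\<forall>y\<in>cell D x. sg (poly h y) = s) \<longleftrightarrow>
    (\<exists>\<alpha>\<in>D. sg (x - \<alpha>) = s \<and> (\<forall>\<delta>\<in>D. sg (x - \<delta>) = s \<longrightarrow> sg (\<delta> - \<alpha>) \<noteq> s) \<and> sg (poly h \<alpha>) \<noteq> - s)"
    (is "?L \<longleftrightarrow> ?R")
proof -
  define c :: 'a where "c = of_int s"
  have c: "c = 1 \<or> c = - 1" using s by (auto simp: c_def)
  have cK: "c \<in> K" using c K_closed by auto
  have sgc: "sg u = s \<longleftrightarrow> pos (c * u)" if "u \<in> K" for u using sg_eq_pos[OF that s] by (simp add: c_def)
  have sgmc: "sg u = - s \<longleftrightarrow> pos (- (c * u))" if "u \<in> K" for u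
    using sg_eq_pos[OF that, of "- s"] s by (auto simp: c_def)
  have hK: "poly h y \<in> K" if "y \<in> K" for y using h K_polys(12) that by blast
  have xd: "x - \<delta> \<in> K" if "\<delta> \<in> D" for \<delta> using x D that K_closed(5) by blast
  have dd: "\<delta> - \<alpha> \<in> K" if "\<delta> \<in> D" "\<alpha> \<in> D" for \<delta> \<alpha> using D that K_closed(5) by blast
  have cellK: "cell D x \<subseteq> K" by (auto simp: cell_def)
  have inc: "pos (poly h b - poly h a)" if "a \<in> cell D x" "b \<in> cell D x" "pos (b - a)" for a b
    by (rule strictly_increasing[OF h(1) cellK _ deriv that]) (rule cell_convex[OF D(2)])
  have mono: "pos (c * (poly h y' - poly h y))" if "y \<in> cell D x" "y' \<in> cell D x" "pos (c * (y' - y))" for y y'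
    using c inc[of y y'] inc[of y' y] that by auto
  have ivt: "\<exists>z\<in>K. pos (c * (z - a)) \<and> pos (c * (b - z)) \<and> poly p z = 0"
    if "p \<in> polys_over K" "a \<in> K" "b \<in> K" "pos (c * (b - a))" "pos (- (poly p a * poly p b))" for p a b
    using c IVT[OF that(1,2,3) _ that(5)] IVT[OF that(1,3,2)] that(4,5) by (fastforce simp: mult.commute)
  have between: "z \<in> cell D x"
    if a: "\<alpha> \<in> D" "pos (c * (x - \<alpha>))" "\<forall>\<delta>\<in>D. pos (c * (x - \<delta>)) \<longrightarrow> \<not> pos (c * (\<delta> - \<alpha>))"
      and y: "y \<in> cell D x" and z: "z \<in> K" "pos (c * (z - \<alpha>))" "pos (c * (y - z))" for \<alpha> y z
  proof -
    have "sg (z - \<delta>) = sg (x - \<delta>)" if d: "\<delta> \<in> D" for \<delta>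
    proof -
      have K: "\<delta> \<in> K" "\<alpha> \<in> K" "y \<in> K" using d a D y by (auto simp: cell_def)
      have ne: "sg (x - \<delta>) \<noteq> 0" using x d by (auto simp: sg_zero)
      have ey: "sg (y - \<delta>) = sg (x - \<delta>)" using y d by (simp add: cell_def)
      show ?thesis
      proof (cases "sg (x - \<delta>) = s")
        case True
        then have "\<not> pos (c * (\<delta> - \<alpha>))" using a(3) d sgc[OF xd[OF d]] by blast
        then have "c * (\<delta> - \<alpha>) = 0 \<or> pos (- (c * (\<delta> - \<alpha>)))"
          using pos_cases[OF K_closed(6)[OF cK dd[OF d a(1)]]] by blast
        then have "pos (c * (z - \<alpha>) + - (c * (\<delta> - \<alpha>)))"
          using z(2) pos_add[OF z(2), of "- (c * (\<delta> - \<alpha>))"]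
          by (elim disjE) (simp_all only: minus_zero add_0_right)
        then have "pos (c * (z - \<delta>))" by (simp add: algebra_simps)
        then show ?thesis using True sgc[OF K_closed(5)[OF z(1) K(1)]] by simp
      next
        case False
        then have ms: "sg (x - \<delta>) = - s" using ne s sg_cases[of "x - \<delta>"] by auto
        then have "pos (- (c * (y - \<delta>)))" using ey sgmc[OF K_closed(5)[OF K(3,1)]] by simp
        then have "pos (- (c * (y - \<delta>)) + c * (y - z))" using pos_add z by blast
        then have "pos (- (c * (z - \<delta>)))" by (simp add: algebra_simps)
        then show ?thesis using ms sgmc[OF K_closed(5)[OF z(1) K(1)]] by simp
      qed
    qed
    then show ?thesis using z by (simp add: cell_def)
  qed
  show ?thesis
  proof
    assume L: ?L
    define S where "S = {\<delta>\<in>D. pos (c * (x - \<delta>))}"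
    have xcell: "x \<in> cell D x" using x by (simp add: cell_def)
    show ?R
    proof (cases "S = {}")
      case True
      define m where "m = - c"
      have m: "m = 1 \<or> m = - 1" using c by (auto simp: m_def)
      have h0: "h \<noteq> 0" and h'0: "pderiv h \<noteq> 0" using h(2) by (auto simp: pderiv_eq_0_iff)
      have h'K: "pderiv h \<in> polys_over K" using h(1) polys_over_pderiv subring_K by blast
      obtain M1 where M1: "pos M1" "\<And>t. pos (t - M1) \<Longrightarrow> pos (lead_coeff h * m ^ degree h * poly h (m * t))"
        using sign_at_infinity[OF h(1) h0 m] by blast
      obtain M2 where M2: "pos M2" "\<And>t. pos (t - M2) \<Longrightarrow>
          pos (lead_coeff (pderiv h) * m ^ degree (pderiv h) * poly (pderiv h) (m * t))"
        using sign_at_infinity[OF h'K h'0 m] by blast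
      define w where "w = (if pos (- (c * x)) then - (c * x) else 0)"
      have wT: "w \<in> T" using zero_mem by (auto simp: w_def pos_def)
      define t where "t = M1 + M2 + w"
      have t1: "pos (t - M1)" "pos (t - M2)"
        using pos_add_T[OF M2(1) wT] pos_add_T[OF M1(1) wT] by (simp_all add: t_def algebra_simps)
      have tx: "pos (t + c * x)"
      proof (cases "pos (- (c * x))")
        case True
        then show ?thesis using pos_add M1 M2 by (simp add: t_def w_def)
      next
        case False
        then have "c * x = 0 \<or> pos (c * x)" using pos_cases[OF K_closed(6)[OF cK x(1)]] by blast
        then have "c * x \<in> T" using zero_mem by (auto simp: pos_def)
        then show ?thesis using False pos_add_T pos_add M1 M2 by (simp add: t_def w_def)
      qed
      define y where "y = m * t"
      have tK: "t \<in> K" unfolding t_def by (intro K_closed pos_K M1 M2 T_K wT)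
      have yK: "y \<in> K" unfolding y_def m_def by (intro K_closed tK cK)
      have cxy: "c * (x - y) = t + c * x" using c by (auto simp: y_def m_def algebra_simps)
      have ycell: "y \<in> cell D x"
      proof -
        have "sg (y - \<delta>) = sg (x - \<delta>)" if d: "\<delta> \<in> D" for \<delta>
        proof -
          have dK: "\<delta> \<in> K" using d D by auto
          have "sg (x - \<delta>) \<noteq> s" using True d sgc[OF xd[OF d]] by (auto simp: S_def)
          moreover have "sg (x - \<delta>) \<noteq> 0" using x d by (auto simp: sg_zero)
          ultimately have ms: "sg (x - \<delta>) = - s" using s sg_cases[of "x - \<delta>"] by auto
          then have "pos (- (c * (x - \<delta>)))" using sgmc[OF xd[OF d]] by simp
          then have "pos (- (c * (x - \<delta>)) + c * (x - y))" unfolding cxy using pos_add tx by blast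
          then have "pos (- (c * (y - \<delta>)))" by (simp add: algebra_simps)
          then show ?thesis using ms sgmc[OF K_closed(5)[OF yK dK]] by simp
        qed
        then show ?thesis using yK by (simp add: cell_def)
      qed
      obtain k where k: "degree h = Suc k" using h(2) by (metis Suc_le_D One_nat_def)
      have ld: "coeff (pderiv h) k = of_nat (Suc k) * lead_coeff h" and dd: "degree (pderiv h) = k"
        using k by (simp_all add: degree_pderiv coeff_pderiv)
      have "pos (poly (pderiv h) y * (lead_coeff (pderiv h) * m ^ degree (pderiv h)))"
        using M2(2)[OF t1(2)] by (simp add: y_def mult.commute)
      then have "pos (of_nat (Suc k) * (lead_coeff h * m ^ k))"
        unfolding dd ld using pos_mult_cancel[OF deriv[OF ycell]] by (simp only: mult.assoc)
      then have lk: "pos (lead_coeff h * m ^ k)" using pos_mult_cancel pos_of_nat by blast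
      have "pos ((lead_coeff h * m ^ k) * (m * poly h y))"
        using M1(2)[OF t1(1)] unfolding k by (simp add: y_def mult.commute mult.left_commute)
      then have "pos (m * poly h y)" using lk pos_mult_cancel by blast
      then have "pos (- (c * poly h y))" by (simp add: m_def)
      moreover have "pos (c * poly h y)" using L ycell sgc hK yK by blast
      ultimately show ?thesis using pos_asym[of "c * poly h y"] by simp
    next
      case False
      have "finite ((\<lambda>\<delta>. - (c * \<delta>)) ` S)" "(\<lambda>\<delta>. - (c * \<delta>)) ` S \<noteq> {}" "(\<lambda>\<delta>. - (c * \<delta>)) ` S \<subseteq> K"
        using D False cK K_closed by (auto simp: S_def)
      from least_exists[OF this]
      obtain \<alpha> where al: "\<alpha> \<in> S" "\<forall>\<delta>\<in>S. \<not> pos (- (c * \<alpha>) - - (c * \<delta>))"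
        by blast
      have a: "\<alpha> \<in> D" "pos (c * (x - \<alpha>))" using al by (auto simp: S_def)
      have a3: "\<forall>\<delta>\<in>D. pos (c * (x - \<delta>)) \<longrightarrow> \<not> pos (c * (\<delta> - \<alpha>))"
        using al(2) by (auto simp: S_def algebra_simps)
      have aK: "\<alpha> \<in> K" using a D by auto
      have "\<not> pos (- (c * poly h \<alpha>))"
      proof
        assume n: "pos (- (c * poly h \<alpha>))"
        have p: "pos (c * poly h x)" using L xcell sgc hK x by blast
        have "pos (- (poly h \<alpha> * poly h x))"
          using pos_mult[OF n p] c by auto
        then obtain z where z: "z \<in> K" "pos (c * (z - \<alpha>))" "pos (c * (x - z))" "poly h z = 0"
          using ivt[OF h(1) aK x(1) a(2)] by blast
        then have "z \<in> cell D x" using between[OF a a3 xcell] by blast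
        then have "sg (poly h z) = s" using L by blast
        then show False using z(4) s by auto
      qed
      then show ?thesis using a a3 by (intro bexI[of _ \<alpha>]) (auto simp: sgc sgmc hK aK xd dd)
    qed
  next
    assume ?R
    then obtain \<alpha> where al: "\<alpha> \<in> D" "sg (x - \<alpha>) = s" "\<forall>\<delta>\<in>D. sg (x - \<delta>) = s \<longrightarrow> sg (\<delta> - \<alpha>) \<noteq> s"
      "sg (poly h \<alpha>) \<noteq> - s" by blast
    have aK: "\<alpha> \<in> K" using al D by auto
    have a: "pos (c * (x - \<alpha>))" "\<forall>\<delta>\<in>D. pos (c * (x - \<delta>)) \<longrightarrow> \<not> pos (c * (\<delta> - \<alpha>))"
      "\<not> pos (- (c * poly h \<alpha>))"
      using al by (auto simp: sgc sgmc hK aK xd dd)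
    show ?L
    proof
      fix y assume y: "y \<in> cell D x"
      have yK: "y \<in> K" using y by (simp add: cell_def)
      have ya: "pos (c * (y - \<alpha>))" using y al(1,2) sgc[OF K_closed(5)[OF yK aK]] by (simp add: cell_def)
      show "sg (poly h y) = s"
      proof (rule ccontr)
        assume "sg (poly h y) \<noteq> s"
        then have ny: "\<not> pos (c * poly h y)" using sgc hK yK by blast
        define y' where "y' = (\<alpha> + y) / 2"
        have y'K: "y' \<in> K" unfolding y'_def using aK yK K_half by blast
        have y'1: "pos (c * (y' - \<alpha>))" "pos (c * (y - y'))"
          using pos_half[OF ya] by (simp_all add: y'_def field_simps)
        have y'c: "y' \<in> cell D x" using between[OF al(1) a(1,2) y y'K y'1] .
        have inc: "pos (c * (poly h y - poly h y'))" using mono[OF y'c y y'1(2)] .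
        have "c * poly h y = 0 \<or> pos (- (c * poly h y))" using ny pos_cases[OF K_closed(6)[OF cK hK[OF yK]]] by blast
        then have "pos (c * (poly h y - poly h y') + - (c * poly h y))"
          using inc pos_add[OF inc, of "- (c * poly h y)"]
          by (elim disjE) (simp_all only: minus_zero add_0_right)
        then have neg: "pos (- (c * poly h y'))" by (simp add: algebra_simps)
        \<comment> \<open>A value strictly between $h(y')$ and $h(\alpha)$, also when $h(\alpha) = 0$.\<close>
        define p where "p = h - [:poly h y' / 2:]"
        have half: "poly h y' / 2 \<in> K" using K_half[OF hK[OF y'K] K_closed(1)] by simp
        have pK: "p \<in> polys_over K" unfolding p_def using h half by (intro K_polys)
        have "c * poly h \<alpha> = 0 \<or> pos (c * poly h \<alpha>)" using a(3) pos_cases[OF K_closed(6)[OF cK hK[OF aK]]] by blast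
        then have "pos (- (c * poly h y') / 2 + c * poly h \<alpha>)"
          using pos_half[OF neg] pos_add[OF pos_half[OF neg], of "c * poly h \<alpha>"]
          by (elim disjE) (simp_all only: add_0_right)
        then have "pos (c * poly p \<alpha>)" by (simp add: p_def algebra_simps)
        moreover have "pos (- (c * poly p y'))" using pos_half[OF neg] by (simp add: p_def field_simps)
        ultimately have "pos (- (poly p \<alpha> * poly p y'))" using pos_mult c by fastforce
        then obtain z where z: "z \<in> K" "pos (c * (z - \<alpha>))" "pos (c * (y' - z))" "poly p z = 0"
          using ivt[OF pK aK y'K y'1(1)] by blast
        have "z \<in> cell D x" using between[OF al(1) a(1,2) y'c z(1,2,3)] .
        then have "pos (c * (poly h y' - poly h z))" using mono y'c z(3) by blast
        moreover have "poly h z = poly h y' / 2" using z(4) by (simp add: p_def)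
        ultimately have "pos (c * poly h y' / 2)" by (simp add: field_simps)
        then show False using pos_half[OF neg] pos_asym by fastforce
      qed
    qed
  qed
qed

end

context real_closed_subfield
begin

lemma sg_increasing:
  assumes D: "D \<subseteq> K" and h: "h \<in> polys_over K"
    and deriv: "\<And>y. y \<in> cell D x \<Longrightarrow> pos (poly (pderiv h) y)"
    and y: "y \<in> cell D x" "\<rho> \<in> cell D x" "poly h \<rho> = 0"
  shows "sg (poly h y) = sg (y - \<rho>)"
proof -
  have cellK: "cell D x \<subseteq> K" by (auto simp: cell_def)
  have inc: "pos (poly h b - poly h a)" if "a \<in> cell D x" "b \<in> cell D x" "pos (b - a)" for a b
    by (rule strictly_increasing[OF h cellK _ deriv that]) (rule cell_convex[OF D])
  have K: "y \<in> K" "\<rho> \<in> K" "poly h y \<in> K" "y - \<rho> \<in> K"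
    using y h K_polys(12) K_closed(5) by (auto simp: cell_def)
  from pos_cases[OF K(4)] show ?thesis
  proof (elim disjE)
    assume "pos (y - \<rho>)"
    then show ?thesis using inc[OF y(2,1)] y(3) sg_pos[OF K(3)] sg_pos[OF K(4)] by simp
  next
    assume "pos (- (y - \<rho>))"
    then have "pos (- poly h y)" using inc[OF y(1,2)] y(3) by simp
    then show ?thesis using \<open>pos (- (y - \<rho>))\<close> sg_neg[OF K(3)] sg_neg[OF K(4)] by simp
  qed (use y in simp)
qed

lemma root_in_cell:
  assumes D: "D \<subseteq> K" and h: "h \<in> polys_over K"
    and u: "u \<in> cell D x" "sg (poly h u) \<noteq> 1" and v: "v \<in> cell D x" "sg (poly h v) \<noteq> - 1"
  shows "\<exists>\<rho>\<in>cell D x. poly h \<rho> = 0"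
proof (cases "poly h u = 0 \<or> poly h v = 0")
  case True
  then show ?thesis using u v by blast
next
  case False
  have K: "u \<in> K" "v \<in> K" "poly h u \<in> K" "poly h v \<in> K"
    using u v h K_polys(12) by (auto simp: cell_def)
  have "sg (poly h u) = - 1" "sg (poly h v) = 1"
    using False u(2) v(2) sg_cases[of "poly h u"] sg_cases[of "poly h v"] sg_zero by auto
  then have s: "pos (- poly h u)" "pos (poly h v)" using sg_pos sg_neg K by auto
  then have p: "pos (- (poly h u * poly h v))" "pos (- (poly h v * poly h u))"
    using neg_prod_cases K by auto
  have "u - v \<noteq> 0" using s pos_asym by auto
  then consider "pos (v - u)" | "pos (u - v)" using pos_cases[OF K_closed(5)[OF K(1,2)]] by auto
  then show ?thesis
  proof cases
    case 1
    then obtain z where "z \<in> K" "pos (z - u)" "pos (v - z)" "poly h z = 0" using IVT[OF h K(1,2) 1 p(1)] by blast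
    then show ?thesis using cell_convex[OF D u(1) v(1)] by blast
  next
    case 2
    then obtain z where "z \<in> K" "pos (z - v)" "pos (u - z)" "poly h z = 0" using IVT[OF h K(2,1) 2 p(2)] by blast
    then show ?thesis using cell_convex[OF D v(1) u(1)] by blast
  qed
qed

lemma sg_diff_opposite:
  assumes "u \<in> K" "v \<in> K" "sg u = s" "sg v = - s" "s \<noteq> 0"
  shows "sg (u - v) = s"
proof -
  consider "s = 1" | "s = - 1" using sg_cases[of u] assms by auto
  then show ?thesis
  proof cases
    case 1
    then have "pos u" "pos (- v)" using assms sg_pos sg_neg by auto
    then have "pos (u + - v)" using pos_add by blast
    then show ?thesis using 1 sg_pos[OF K_closed(5)[OF assms(1,2)]] by simp
  next
    case 2
    then have "pos (- u)" "pos v" using assms sg_pos sg_neg by auto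
    then have "pos (- u + v)" using pos_add by blast
    then show ?thesis using 2 sg_neg[OF K_closed(5)[OF assms(1,2)]] by simp
  qed
qed

lemma sg_swap: "x \<in> K \<Longrightarrow> y \<in> K \<Longrightarrow> sg (x - y) = - sg (y - x)"
  using sg_minus[of "y - x"] K_closed(5) by simp

end

section \<open>Sign tables over two real closed fields\<close>

locale two_real_closed = A: real_closed_subfield T1 + B: real_closed_subfield T2
  for T1 :: "'a::field_char_0 set" and T2 :: "'b::field_char_0 set"
begin

text \<open>
  \<open>R\<close> pairs points of the first field with points of the second one.
\<close>

definition same_position :: "('a \<times> 'b) set \<Rightarrow> 'a \<Rightarrow> 'b \<Rightarrow> bool" where
  "same_position R x y \<longleftrightarrow> (\<forall>(\<xi>, \<eta>)\<in>R. A.sg (x - \<xi>) = B.sg (y - \<eta>))"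

text \<open>
  Two points that are paired are in the same position, so \<open>R\<close> is an order
  isomorphism between two finite sets.
\<close>

definition grid :: "('a \<times> 'b) set \<Rightarrow> bool" where
  "grid R \<longleftrightarrow> finite R \<and> (\<forall>(\<xi>, \<eta>)\<in>R. \<xi> \<in> A.K \<and> \<eta> \<in> B.K \<and> same_position R \<xi> \<eta>)"

lemma gridD:
  assumes "grid R"
  shows "finite R" "(\<xi>, \<eta>) \<in> R \<Longrightarrow> \<xi> \<in> A.K" "(\<xi>, \<eta>) \<in> R \<Longrightarrow> \<eta> \<in> B.K"
    "(\<xi>, \<eta>) \<in> R \<Longrightarrow> (\<xi>', \<eta>') \<in> R \<Longrightarrow> A.sg (\<xi> - \<xi>') = B.sg (\<eta> - \<eta>')"
    "fst ` R \<subseteq> A.K" "snd ` R \<subseteq> B.K" "finite (fst ` R)" "finite (snd ` R)"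
  using assms by (auto simp: grid_def same_position_def)

lemma same_positionD: "same_position R x y \<Longrightarrow> (\<xi>, \<eta>) \<in> R \<Longrightarrow> A.sg (x - \<xi>) = B.sg (y - \<eta>)"
  by (auto simp: same_position_def)

lemma same_position_exists:
  assumes R: "grid R" and x: "x \<in> A.K"
  shows "\<exists>y\<in>B.K. same_position R x y"
proof (cases "x \<in> fst ` R")
  case True
  then obtain y where "(x, y) \<in> R" by auto
  then show ?thesis using R by (auto simp: grid_def)
next
  case False
  note g = gridD[OF R]
  define L where "L = {\<eta>. \<exists>\<xi>. (\<xi>, \<eta>) \<in> R \<and> A.sg (x - \<xi>) = 1}"
  define U where "U = {\<eta>. \<exists>\<xi>. (\<xi>, \<eta>) \<in> R \<and> A.sg (x - \<xi>) = - 1}"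
  have LU: "\<eta> \<in> L \<and> A.sg (x - \<xi>) = 1 \<or> \<eta> \<in> U \<and> A.sg (x - \<xi>) = - 1" if "(\<xi>, \<eta>) \<in> R" for \<xi> \<eta>
  proof -
    have "x \<noteq> \<xi>" using False that by force
    then have "A.sg (x - \<xi>) \<noteq> 0" using A.sg_zero[of "x - \<xi>"] by simp
    then show ?thesis using A.sg_cases[of "x - \<xi>"] that unfolding L_def U_def by blast
  qed
  have LK: "L \<subseteq> B.K" "U \<subseteq> B.K" using g(3) by (auto simp: L_def U_def)
  have "L \<subseteq> snd ` R" "U \<subseteq> snd ` R" by (force simp: L_def U_def)+
  then have fin: "finite L" "finite U" using g(8) finite_subset by blast+
  have less: "B.pos (u - l)" if lu: "l \<in> L" "u \<in> U" for l u
  proof -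
    obtain \<xi> \<xi>' where r: "(\<xi>, l) \<in> R" "A.sg (x - \<xi>) = 1" "(\<xi>', u) \<in> R" "A.sg (x - \<xi>') = - 1"
      using lu by (auto simp: L_def U_def)
    then have "A.sg ((x - \<xi>) - (x - \<xi>')) = 1"
      using A.sg_diff_opposite[of "x - \<xi>" "x - \<xi>'" 1] A.K_closed(5) x g(2) by simp
    then have "A.sg (\<xi>' - \<xi>) = 1" by simp
    then have "B.sg (u - l) = 1" using g(4)[OF r(3,1)] by simp
    then show ?thesis using B.sg_pos B.K_closed(5) that LK by blast
  qed
  have "\<exists>y\<in>B.K. (\<forall>l\<in>L. B.pos (y - l)) \<and> (\<forall>u\<in>U. B.pos (u - y))"
  proof -
    have top: "\<exists>m\<in>L. \<forall>s\<in>L. m = s \<or> B.pos (m - s)" if "L \<noteq> {}"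
    proof -
      have "finite (uminus ` L)" "uminus ` L \<noteq> {}" "uminus ` L \<subseteq> B.K"
        using fin that LK B.K_closed(3) by auto
      from B.least_exists[OF this] obtain m where m: "m \<in> L" "\<forall>s\<in>L. \<not> B.pos (- m - - s)" by blast
      have "m = s \<or> B.pos (m - s)" if "s \<in> L" for s
      proof -
        have "- m - - s \<in> B.K" using LK m(1) that B.K_closed(3,5) by blast
        then show ?thesis using B.pos_cases[of "- m - - s"] m(2) that by auto
      qed
      then show ?thesis using m(1) by blast
    qed
    have bot: "\<exists>m\<in>U. \<forall>s\<in>U. m = s \<or> B.pos (s - m)" if "U \<noteq> {}"
    proof -
      from B.least_exists[OF fin(2) that LK(2)] obtain m where m: "m \<in> U" "\<forall>s\<in>U. \<not> B.pos (m - s)" by blast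
      have "m = s \<or> B.pos (s - m)" if "s \<in> U" for s
      proof -
        have "m - s \<in> B.K" using LK m(1) that B.K_closed(5) by blast
        then show ?thesis using B.pos_cases[of "m - s"] m(2) that by auto
      qed
      then show ?thesis using m(1) by blast
    qed
    consider "L = {}" "U = {}" | m where "L = {}" "m \<in> U" "\<forall>s\<in>U. m = s \<or> B.pos (s - m)"
      | m where "U = {}" "m \<in> L" "\<forall>s\<in>L. m = s \<or> B.pos (m - s)"
      | l u where "l \<in> L" "\<forall>s\<in>L. l = s \<or> B.pos (l - s)" "u \<in> U" "\<forall>s\<in>U. u = s \<or> B.pos (s - u)"
    proof (cases "L = {}")
      case L: True
      show ?thesis
      proof (cases "U = {}")
        case True
        then show ?thesis using that(1) L by simp
      next
        case False
        from bot[OF False] obtain m where "m \<in> U" "\<forall>s\<in>U. m = s \<or> B.pos (s - m)" by (rule bexE)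
        then show ?thesis by (rule that(2)[OF L])
      qed
    next
      case L: False
      from top[OF L] obtain l where l: "l \<in> L" "\<forall>s\<in>L. l = s \<or> B.pos (l - s)" by (rule bexE)
      show ?thesis
      proof (cases "U = {}")
        case True
        then show ?thesis using l by (rule that(3))
      next
        case False
        from bot[OF False] obtain m where "m \<in> U" "\<forall>s\<in>U. m = s \<or> B.pos (s - m)" by (rule bexE)
        then show ?thesis by (rule that(4)[OF l])
      qed
    qed
    then show ?thesis
    proof cases
      case 1
      then show ?thesis using B.K_closed(1) by blast
    next
      case (2 m)
      have "B.pos (u - (m - 1))" if "u \<in> U" for u
        using 2(3) that B.pos_one B.pos_add[of "u - m" 1] by (auto simp: algebra_simps)
      moreover have "m - 1 \<in> B.K" using 2 LK B.K_closed(2,5) by blast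
      ultimately show ?thesis using 2 by blast
    next
      case (3 m)
      have "B.pos ((m + 1) - l)" if "l \<in> L" for l
        using 3(3) that B.pos_one B.pos_add[of "m - l" 1] by (auto simp: algebra_simps)
      moreover have "m + 1 \<in> B.K" using 3 LK B.K_closed(2,4) by blast
      ultimately show ?thesis using 3 by blast
    next
      case (4 l u)
      define y where "y = (l + u) / 2"
      have "y \<in> B.K" unfolding y_def using B.K_half 4 LK by blast
      have y1: "B.pos (y - l)" "B.pos (u - y)"
        using B.pos_half[OF less[OF 4(1,3)]] by (simp_all add: y_def field_simps)
      have "B.pos (y - s)" if "s \<in> L" for s using 4(2) that y1(1) B.pos_trans[of l s y] by auto
      moreover have "B.pos (s - y)" if "s \<in> U" for s using 4(4) that y1(2) B.pos_trans[of u y s] by auto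
      ultimately show ?thesis using \<open>y \<in> B.K\<close> by blast
    qed
  qed
  then obtain y where y: "y \<in> B.K" "\<And>l. l \<in> L \<Longrightarrow> B.pos (y - l)" "\<And>u. u \<in> U \<Longrightarrow> B.pos (u - y)" by blast
  have "A.sg (x - \<xi>) = B.sg (y - \<eta>)" if r: "(\<xi>, \<eta>) \<in> R" for \<xi> \<eta>
  proof -
    have yK: "y - \<eta> \<in> B.K" using y(1) g(3)[OF r] B.K_closed(5) by blast
    from LU[OF r] show ?thesis
    proof (elim disjE conjE)
      assume "\<eta> \<in> L" "A.sg (x - \<xi>) = 1"
      then show ?thesis using y(2) B.sg_pos[OF yK] by simp
    next
      assume "\<eta> \<in> U" "A.sg (x - \<xi>) = - 1"
      then show ?thesis using y(3) B.sg_neg[OF yK] by simp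
    qed
  qed
  then show ?thesis using y(1) by (auto simp: same_position_def)
qed

text \<open>
  On two corresponding intervals, either both polynomials have the same nonzero constant sign,
  or each of them has exactly one root and changes sign there in the same direction.
\<close>

definition same_root_pattern :: "'a poly \<Rightarrow> 'b poly \<Rightarrow> 'a set \<Rightarrow> 'b set \<Rightarrow> bool" where
  "same_root_pattern h1 h2 C1 C2 \<longleftrightarrow>
    (\<exists>s. s \<noteq> 0 \<and> (\<forall>x\<in>C1. A.sg (poly h1 x) = s) \<and> (\<forall>y\<in>C2. B.sg (poly h2 y) = s)) \<or>
    (\<exists>s. s \<noteq> 0 \<and> (\<exists>\<rho>1\<in>C1. \<exists>\<rho>2\<in>C2. poly h1 \<rho>1 = 0 \<and> poly h2 \<rho>2 = 0 \<and>
        (\<forall>x\<in>C1. A.sg (poly h1 x) = s * A.sg (x - \<rho>1)) \<and>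
        (\<forall>y\<in>C2. B.sg (poly h2 y) = s * B.sg (y - \<rho>2))))"

lemma same_root_pattern_minus:
  assumes al: "same_root_pattern (- h1) (- h2) C1 C2"
    and n1: "\<And>u. u \<in> C1 \<Longrightarrow> A.sg (poly (- h1) u) = - A.sg (poly h1 u)"
    and n2: "\<And>v. v \<in> C2 \<Longrightarrow> B.sg (poly (- h2) v) = - B.sg (poly h2 v)"
  shows "same_root_pattern h1 h2 C1 C2"
  using al unfolding same_root_pattern_def[of "- h1" "- h2"]
proof (elim disjE exE bexE conjE)
  fix s assume s: "s \<noteq> 0" "\<forall>x\<in>C1. A.sg (poly (- h1) x) = s" "\<forall>y\<in>C2. B.sg (poly (- h2) y) = s"
  have "A.sg (poly h1 x) = - s" if "x \<in> C1" for x using n1[OF that] s(2) that by simp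
  moreover have "B.sg (poly h2 x) = - s" if "x \<in> C2" for x using n2[OF that] s(3) that by simp
  ultimately show ?thesis unfolding same_root_pattern_def using s(1) by (intro disjI1 exI[of _ "- s"]) simp
next
  fix s \<rho>1 \<rho>2 assume a: "s \<noteq> 0" "\<rho>1 \<in> C1" "\<rho>2 \<in> C2" "poly (- h1) \<rho>1 = 0" "poly (- h2) \<rho>2 = 0"
    "\<forall>x\<in>C1. A.sg (poly (- h1) x) = s * A.sg (x - \<rho>1)" "\<forall>y\<in>C2. B.sg (poly (- h2) y) = s * B.sg (y - \<rho>2)"
  have "A.sg (poly h1 x) = - s * A.sg (x - \<rho>1)" if "x \<in> C1" for x using n1[OF that] a(6) that by simp
  moreover have "B.sg (poly h2 x) = - s * B.sg (x - \<rho>2)" if "x \<in> C2" for x using n2[OF that] a(7) that by simp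
  ultimately show ?thesis unfolding same_root_pattern_def using a(1-5)
    by (intro disjI2 exI[of _ "- s"] conjI bexI[of _ \<rho>1] bexI[of _ \<rho>2]) simp_all
qed

text \<open>
  By \<open>cell_sign\<close>, whether an increasing polynomial has constant sign on the
  interval is decided by signs at paired points; if it has none, it has a root in the interval.
\<close>

lemma same_root_pattern_increasing:
  assumes R: "grid R" and x: "x \<in> A.K" "x \<notin> fst ` R" and y: "y \<in> B.K" and xy: "same_position R x y"
    and h1: "h1 \<in> polys_over A.K" "degree h1 \<ge> 1" and h2: "h2 \<in> polys_over B.K" "degree h2 \<ge> 1"
    and d1: "\<And>u. u \<in> A.cell (fst ` R) x \<Longrightarrow> A.pos (poly (pderiv h1) u)"
    and d2: "\<And>u. u \<in> B.cell (snd ` R) y \<Longrightarrow> B.pos (poly (pderiv h2) u)"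
    and pts: "\<And>\<xi> \<eta>. (\<xi>, \<eta>) \<in> R \<Longrightarrow> A.sg (poly h1 \<xi>) = B.sg (poly h2 \<eta>)"
  shows "same_root_pattern h1 h2 (A.cell (fst ` R) x) (B.cell (snd ` R) y)"
proof -
  note g = gridD[OF R]
  have yR: "y \<notin> snd ` R"
  proof
    assume "y \<in> snd ` R"
    then obtain \<xi> where "(\<xi>, y) \<in> R" by auto
    then have "A.sg (x - \<xi>) = 0" using same_positionD[OF xy, of \<xi> y] by simp
    then have "(x, y) \<in> R" using \<open>(\<xi>, y) \<in> R\<close> A.sg_zero[of "x - \<xi>"] by simp
    then show False using x(2) by force
  qed
  have iff: "(\<forall>u\<in>A.cell (fst ` R) x. A.sg (poly h1 u) = s) \<longleftrightarrow> (\<forall>u\<in>B.cell (snd ` R) y. B.sg (poly h2 u) = s)"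
    if s: "s = 1 \<or> s = - 1" for s
  proof -
    let ?P = "\<lambda>\<alpha>. A.sg (x - \<alpha>) = s \<and> (\<forall>\<delta>\<in>fst ` R. A.sg (x - \<delta>) = s \<longrightarrow> A.sg (\<delta> - \<alpha>) \<noteq> s) \<and> A.sg (poly h1 \<alpha>) \<noteq> - s"
    let ?Q = "\<lambda>\<alpha>. B.sg (y - \<alpha>) = s \<and> (\<forall>\<delta>\<in>snd ` R. B.sg (y - \<delta>) = s \<longrightarrow> B.sg (\<delta> - \<alpha>) \<noteq> s) \<and> B.sg (poly h2 \<alpha>) \<noteq> - s"
    have "?P (fst r) \<longleftrightarrow> ?Q (snd r)" if r: "r \<in> R" for r
    proof -
      have r': "(fst r, snd r) \<in> R" using r by simp
      have "A.sg (x - fst t) = B.sg (y - snd t) \<and> A.sg (fst t - fst r) = B.sg (snd t - snd r)" if "t \<in> R" for t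
        using same_positionD[OF xy, of "fst t" "snd t"] g(4)[OF _ r', of "fst t" "snd t"] that by simp
      then have "(\<forall>t\<in>R. A.sg (x - fst t) = s \<longrightarrow> A.sg (fst t - fst r) \<noteq> s) \<longleftrightarrow>
          (\<forall>t\<in>R. B.sg (y - snd t) = s \<longrightarrow> B.sg (snd t - snd r) \<noteq> s)"
        by (intro ball_cong) simp_all
      then show ?thesis using same_positionD[OF xy r'] pts[OF r'] by simp
    qed
    then have "(\<exists>r\<in>R. ?P (fst r)) \<longleftrightarrow> (\<exists>r\<in>R. ?Q (snd r))" by (intro bex_cong) simp_all
    then have "(\<exists>\<alpha>\<in>fst ` R. ?P \<alpha>) \<longleftrightarrow> (\<exists>\<alpha>\<in>snd ` R. ?Q \<alpha>)" by (simp only: bex_simps)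
    moreover have "(\<forall>u\<in>A.cell (fst ` R) x. A.sg (poly h1 u) = s) \<longleftrightarrow> (\<exists>\<alpha>\<in>fst ` R. ?P \<alpha>)"
      by (rule A.cell_sign[OF g(7,5) x s h1 d1])
    moreover have "(\<forall>u\<in>B.cell (snd ` R) y. B.sg (poly h2 u) = s) \<longleftrightarrow> (\<exists>\<alpha>\<in>snd ` R. ?Q \<alpha>)"
      by (rule B.cell_sign[OF g(8,6) y yR s h2 d2])
    ultimately show ?thesis by argo
  qed
  have xc: "x \<in> A.cell (fst ` R) x" "y \<in> B.cell (snd ` R) y" using x y by (auto simp: A.cell_def B.cell_def)
  show ?thesis
  proof (cases "(\<forall>u\<in>A.cell (fst ` R) x. A.sg (poly h1 u) = 1) \<or> (\<forall>u\<in>A.cell (fst ` R) x. A.sg (poly h1 u) = - 1)")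
    case True
    then obtain s :: int where s: "s = 1 \<or> s = - 1" "\<forall>u\<in>A.cell (fst ` R) x. A.sg (poly h1 u) = s" by blast
    then have "\<forall>u\<in>B.cell (snd ` R) y. B.sg (poly h2 u) = s" using iff by blast
    then show ?thesis unfolding same_root_pattern_def using s by (intro disjI1 exI[of _ s]) auto
  next
    case False
    then have n1: "\<not> (\<forall>u\<in>A.cell (fst ` R) x. A.sg (poly h1 u) = 1)" and n2: "\<not> (\<forall>u\<in>A.cell (fst ` R) x. A.sg (poly h1 u) = - 1)"
      by blast+
    obtain u v where "u \<in> A.cell (fst ` R) x" "A.sg (poly h1 u) \<noteq> 1"
      "v \<in> A.cell (fst ` R) x" "A.sg (poly h1 v) \<noteq> - 1" using n1 n2 by blast
    moreover obtain u' v' where "u' \<in> B.cell (snd ` R) y" "B.sg (poly h2 u') \<noteq> 1"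
      "v' \<in> B.cell (snd ` R) y" "B.sg (poly h2 v') \<noteq> - 1"
      using n1[unfolded iff[OF disjI1[OF refl]]] n2[unfolded iff[OF disjI2[OF refl]]] by blast
    ultimately
    obtain \<rho>1 \<rho>2 where r: "\<rho>1 \<in> A.cell (fst ` R) x" "poly h1 \<rho>1 = 0"
      "\<rho>2 \<in> B.cell (snd ` R) y" "poly h2 \<rho>2 = 0"
      using A.root_in_cell[OF g(5) h1(1)] B.root_in_cell[OF g(6) h2(1)] by metis
    have "A.sg (poly h1 u) = 1 * A.sg (u - \<rho>1)" if "u \<in> A.cell (fst ` R) x" for u
      using A.sg_increasing[OF g(5) h1(1) d1 that r(1,2)] by simp
    moreover have "B.sg (poly h2 u) = 1 * B.sg (u - \<rho>2)" if "u \<in> B.cell (snd ` R) y" for u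
      using B.sg_increasing[OF g(6) h2(1) d2 that r(3,4)] by simp
    ultimately show ?thesis unfolding same_root_pattern_def using r
      by (intro disjI2 exI[of _ 1] conjI bexI[of _ \<rho>1] bexI[of _ \<rho>2] ballI) auto
  qed
qed

text \<open>
  A sign table for a finite family of pairs of polynomials, one over each field: the points of
  the grid are the roots of the family, and position with respect to the grid determines all
  signs.
\<close>

definition table :: "('a \<times> 'b) set \<Rightarrow> ('a poly \<times> 'b poly) set \<Rightarrow> bool" where
  "table R F \<longleftrightarrow> grid R \<and>
    (\<forall>\<xi> \<eta>. (\<xi>, \<eta>) \<in> R \<longrightarrow> (\<exists>p q. (p, q) \<in> F \<and> p \<noteq> 0 \<and> q \<noteq> 0 \<and> poly p \<xi> = 0 \<and> poly q \<eta> = 0)) \<and>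
    (\<forall>x y p q. x \<in> A.K \<longrightarrow> y \<in> B.K \<longrightarrow> same_position R x y \<longrightarrow> (p, q) \<in> F \<longrightarrow> A.sg (poly p x) = B.sg (poly q y)) \<and>
    (\<forall>p q x. (p, q) \<in> F \<longrightarrow> p \<noteq> 0 \<longrightarrow> x \<in> A.K \<longrightarrow> poly p x = 0 \<longrightarrow> x \<in> fst ` R)"

lemma tableD:
  assumes "table R F"
  shows "grid R"
    "(\<xi>, \<eta>) \<in> R \<Longrightarrow> \<exists>p q. (p, q) \<in> F \<and> p \<noteq> 0 \<and> q \<noteq> 0 \<and> poly p \<xi> = 0 \<and> poly q \<eta> = 0"
    "x \<in> A.K \<Longrightarrow> y \<in> B.K \<Longrightarrow> same_position R x y \<Longrightarrow> (p, q) \<in> F \<Longrightarrow> A.sg (poly p x) = B.sg (poly q y)"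
    "(p, q) \<in> F \<Longrightarrow> p \<noteq> 0 \<Longrightarrow> x \<in> A.K \<Longrightarrow> poly p x = 0 \<Longrightarrow> x \<in> fst ` R"
proof -
  note h = assms[unfolded table_def]
  note 2 = conjunct2[OF h]
  note 3 = conjunct2[OF 2]
  show "grid R" by (rule conjunct1[OF h])
  show "(\<xi>, \<eta>) \<in> R \<Longrightarrow> \<exists>p q. (p, q) \<in> F \<and> p \<noteq> 0 \<and> q \<noteq> 0 \<and> poly p \<xi> = 0 \<and> poly q \<eta> = 0"
    using conjunct1[OF 2] by blast
  show "x \<in> A.K \<Longrightarrow> y \<in> B.K \<Longrightarrow> same_position R x y \<Longrightarrow> (p, q) \<in> F \<Longrightarrow> A.sg (poly p x) = B.sg (poly q y)"
    using conjunct1[OF 3] by blast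
  show "(p, q) \<in> F \<Longrightarrow> p \<noteq> 0 \<Longrightarrow> x \<in> A.K \<Longrightarrow> poly p x = 0 \<Longrightarrow> x \<in> fst ` R"
    using conjunct2[OF 3] by blast
qed

text \<open>
  The step of the method of Cohen and Hoermander. At a point of the grid some \<open>p\<close>
  of the family vanishes, so \<open>h1\<close> has the sign of its remainder modulo
  \<open>p\<close>, which the table already contains. On an interval between points of the grid
  the derivative, which is in the family, has constant sign; so \<open>h1\<close> is monotone
  there and has at most one root. All this happens in the same way for \<open>h2\<close>, and
  the new roots can be paired.
\<close>

lemma table_insert:
  assumes tab: "table R F"
    and h1: "h1 \<in> polys_over A.K" "degree h1 \<ge> 1" and h2: "h2 \<in> polys_over B.K" "degree h2 \<ge> 1"
    and der: "(pderiv h1, pderiv h2) \<in> F"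
    and rem: "\<And>p q. (p, q) \<in> F \<Longrightarrow> p \<noteq> 0 \<Longrightarrow> q \<noteq> 0 \<Longrightarrow> degree p \<ge> 1 \<Longrightarrow>
      \<exists>r1 r2 c1 c2. (r1, r2) \<in> F \<and> A.pos c1 \<and> B.pos c2 \<and>
        (\<forall>x. poly p x = 0 \<longrightarrow> c1 * poly h1 x = poly r1 x) \<and> (\<forall>y. poly q y = 0 \<longrightarrow> c2 * poly h2 y = poly r2 y)"
  shows "\<exists>R'. table R' (insert (h1, h2) F)"
proof -
  have R: "grid R" by (rule tableD(1)[OF tab])
  note g = gridD[OF R]
  note signs = tableD(3)[OF tab] and roots = tableD(4)[OF tab]
  have nonz: "h1 \<noteq> 0" "h2 \<noteq> 0" "pderiv h1 \<noteq> 0" "pderiv h2 \<noteq> 0"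
    using h1 h2 by (auto simp: pderiv_eq_0_iff)
  have hK: "poly h1 x \<in> A.K" if "x \<in> A.K" for x using A.K_polys(12) h1 that by blast
  have hK': "poly h2 x \<in> B.K" if "x \<in> B.K" for x using B.K_polys(12) h2 that by blast
  have pts: "A.sg (poly h1 \<xi>) = B.sg (poly h2 \<eta>)" if r: "(\<xi>, \<eta>) \<in> R" for \<xi> \<eta>
  proof -
    have K: "\<xi> \<in> A.K" "\<eta> \<in> B.K" and sp: "same_position R \<xi> \<eta>" using R r by (auto simp: grid_def)
    obtain p q where pq: "(p, q) \<in> F" "p \<noteq> 0" "q \<noteq> 0" "poly p \<xi> = 0" "poly q \<eta> = 0"
      using tableD(2)[OF tab r] by blast
    have "degree p \<ge> 1"
    proof (rule ccontr)
      assume "\<not> ?thesis"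
      then obtain c where "p = [:c:]" by (metis One_nat_def less_one not_le degree_eq_zeroE)
      then show False using pq by simp
    qed
    then obtain r1 r2 c1 c2 where r: "(r1, r2) \<in> F" "A.pos c1" "B.pos c2"
      "c1 * poly h1 \<xi> = poly r1 \<xi>" "c2 * poly h2 \<eta> = poly r2 \<eta>"
      using rem[OF pq(1,2,3)] pq(4,5) by blast
    have "A.sg (c1 * poly h1 \<xi>) = B.sg (c2 * poly h2 \<eta>)" using signs[OF K sp r(1)] r(4,5) by simp
    moreover have "A.sg (c1 * poly h1 \<xi>) = A.sg (poly h1 \<xi>)"
      using A.sg_mult[OF A.pos_K[OF r(2)] hK[OF K(1)]] A.sg_pos[OF A.pos_K[OF r(2)]] r(2) by simp
    moreover have "B.sg (c2 * poly h2 \<eta>) = B.sg (poly h2 \<eta>)"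
      using B.sg_mult[OF B.pos_K[OF r(3)] hK'[OF K(2)]] B.sg_pos[OF B.pos_K[OF r(3)]] r(3) by simp
    ultimately show ?thesis by simp
  qed
  have cellI: "same_position R u v" if "same_position R x y" "u \<in> A.cell (fst ` R) x" "v \<in> B.cell (snd ` R) y" for x y u v
    unfolding same_position_def
  proof safe
    fix \<xi> \<eta> assume r: "(\<xi>, \<eta>) \<in> R"
    have "A.sg (u - \<xi>) = A.sg (x - \<xi>)" using that r by (force simp: A.cell_def)
    moreover have "B.sg (v - \<eta>) = B.sg (y - \<eta>)" using that r by (force simp: B.cell_def)
    ultimately show "A.sg (u - \<xi>) = B.sg (v - \<eta>)" using same_positionD[OF that(1) r] by simp
  qed
  have same_root_pattern: "same_root_pattern h1 h2 (A.cell (fst ` R) x) (B.cell (snd ` R) y)"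
    if x: "x \<in> A.K" "x \<notin> fst ` R" and y: "y \<in> B.K" and xy: "same_position R x y" for x y
  proof -
    let ?C1 = "A.cell (fst ` R) x" and ?C2 = "B.cell (snd ` R) y"
    define s where "s = A.sg (poly (pderiv h1) x)"
    have xc: "x \<in> ?C1" "y \<in> ?C2" using x y by (auto simp: A.cell_def B.cell_def)
    have "s \<noteq> 0" unfolding s_def A.sg_zero using roots[OF der nonz(3) x(1)] x(2) by blast
    then have s: "s = 1 \<or> s = - 1" using A.sg_cases unfolding s_def by blast
    have dsg: "A.sg (poly (pderiv h1) u) = B.sg (poly (pderiv h2) v)" if "u \<in> ?C1" "v \<in> ?C2" for u v
      using signs[OF _ _ cellI[OF xy that] der] that by (auto simp: A.cell_def B.cell_def)
    have s1: "A.sg (poly (pderiv h1) u) = s" if "u \<in> ?C1" for u using dsg[OF that xc(2)] dsg[OF xc] s_def by simp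
    have s2: "B.sg (poly (pderiv h2) v) = s" if "v \<in> ?C2" for v using dsg[OF xc(1) that] s_def by simp
    have dK: "poly (pderiv h1) u \<in> A.K" if "u \<in> ?C1" for u
      using that A.K_polys(12) polys_over_pderiv[OF A.subring_K h1(1)] by (auto simp: A.cell_def)
    have dK': "poly (pderiv h2) u \<in> B.K" if "u \<in> ?C2" for u
      using that B.K_polys(12) polys_over_pderiv[OF B.subring_K h2(1)] by (auto simp: B.cell_def)
    show ?thesis
    proof (cases "s = 1")
      case True
      show ?thesis
        by (rule same_root_pattern_increasing[OF R x y xy h1 h2 _ _ pts])
          (use s1 s2 True A.sg_pos[OF dK] B.sg_pos[OF dK'] in auto)
    next
      case False
      then have m: "s = - 1" using s by simp
      have "same_root_pattern (- h1) (- h2) ?C1 ?C2"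
      proof (rule same_root_pattern_increasing[OF R x y xy])
        show "- h1 \<in> polys_over A.K" "- h2 \<in> polys_over B.K" using h1 h2 A.K_polys(5) B.K_polys(5) by auto
        show "A.pos (poly (pderiv (- h1)) u)" if "u \<in> ?C1" for u
          using s1[OF that] m A.sg_neg[OF dK[OF that]] by (simp add: pderiv_minus)
        show "B.pos (poly (pderiv (- h2)) u)" if "u \<in> ?C2" for u
          using s2[OF that] m B.sg_neg[OF dK'[OF that]] by (simp add: pderiv_minus)
        show "A.sg (poly (- h1) \<xi>) = B.sg (poly (- h2) \<eta>)" if "(\<xi>, \<eta>) \<in> R" for \<xi> \<eta>
          using pts[OF that] A.sg_minus[OF hK[OF g(2)[OF that]]] B.sg_minus[OF hK'[OF g(3)[OF that]]] by simp
      qed (use h1 h2 in simp_all)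
      moreover have "A.sg (poly (- h1) u) = - A.sg (poly h1 u)" if "u \<in> ?C1" for u
        using A.sg_minus[OF hK] that by (simp add: A.cell_def)
      moreover have "B.sg (poly (- h2) u) = - B.sg (poly h2 u)" if "u \<in> ?C2" for u
        using B.sg_minus[OF hK'] that by (simp add: B.cell_def)
      ultimately show ?thesis by (rule same_root_pattern_minus)
    qed
  qed
  have fstR: "x \<in> fst ` R \<longleftrightarrow> (\<exists>\<eta>. (x, \<eta>) \<in> R)" for x by force
  have partner: "y = \<eta>" if "(\<xi>, \<eta>) \<in> R" "same_position R \<xi> y" for \<xi> \<eta> y
    using same_positionD[OF that(2,1)] B.sg_zero[of "y - \<eta>"] by simp
  \<comment> \<open>The pairs of new roots; a root that already is in the grid is paired with its old partner.\<close>
  define N where "N = {(\<xi>, \<eta>). \<xi> \<in> A.K \<and> \<eta> \<in> B.K \<and> poly h1 \<xi> = 0 \<and> poly h2 \<eta> = 0 \<and> same_position R \<xi> \<eta>}"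
  define R' where "R' = R \<union> N"
  have finR': "finite R'"
  proof -
    have "N \<subseteq> {x. poly h1 x = 0} \<times> {y. poly h2 y = 0}" by (auto simp: N_def)
    moreover have "finite ({x. poly h1 x = 0} \<times> {y. poly h2 y = 0})"
      by (intro finite_cartesian_product poly_roots_finite nonz)
    ultimately have "finite N" by (rule finite_subset)
    then show ?thesis using g(1) by (simp add: R'_def)
  qed
  have NN: "A.sg (\<xi> - \<xi>') = B.sg (\<eta> - \<eta>')" if n: "(\<xi>, \<eta>) \<in> N" "(\<xi>', \<eta>') \<in> N" for \<xi> \<eta> \<xi>' \<eta>'
  proof -
    have K: "\<xi> \<in> A.K" "\<eta> \<in> B.K" "\<xi>' \<in> A.K" "\<eta>' \<in> B.K" and z: "poly h1 \<xi> = 0" "poly h2 \<eta> = 0" "poly h1 \<xi>' = 0" "poly h2 \<eta>' = 0"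
      and sp: "same_position R \<xi> \<eta>" "same_position R \<xi>' \<eta>'" using n by (auto simp: N_def)
    have "\<xi>' \<in> A.cell (fst ` R) \<xi> \<or> (\<exists>r\<in>R. A.sg (\<xi>' - fst r) \<noteq> A.sg (\<xi> - fst r))"
      using K(3) by (auto simp: A.cell_def)
    then consider "\<xi> \<in> fst ` R" | "\<xi>' \<in> fst ` R"
      | "\<xi> \<notin> fst ` R" "\<xi>' \<notin> fst ` R" "\<xi>' \<in> A.cell (fst ` R) \<xi>"
      | \<delta> \<epsilon> where "\<xi> \<notin> fst ` R" "\<xi>' \<notin> fst ` R" "(\<delta>, \<epsilon>) \<in> R" "A.sg (\<xi>' - \<delta>) \<noteq> A.sg (\<xi> - \<delta>)"
      by (metis prod.collapse)
    then show ?thesis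
    proof cases
      case 1
      then have "(\<xi>, \<eta>) \<in> R" using partner[OF _ sp(1)] by (auto simp: fstR)
      then have "A.sg (\<xi>' - \<xi>) = B.sg (\<eta>' - \<eta>)" using same_positionD[OF sp(2)] by blast
      then show ?thesis using A.sg_swap[OF K(1,3)] B.sg_swap[OF K(2,4)] by simp
    next
      case 2
      then have "(\<xi>', \<eta>') \<in> R" using partner[OF _ sp(2)] by (auto simp: fstR)
      then show ?thesis using same_positionD[OF sp(1)] by blast
    next
      case 3
      have e: "\<xi> \<in> A.cell (fst ` R) \<xi>" "\<eta> \<in> B.cell (snd ` R) \<eta>" using K by (auto simp: A.cell_def B.cell_def)
      have e': "\<eta>' \<in> B.cell (snd ` R) \<eta>"
      proof -
        have "B.sg (\<eta>' - \<epsilon>) = B.sg (\<eta> - \<epsilon>)" if r: "(\<delta>, \<epsilon>) \<in> R" for \<delta> \<epsilon>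
        proof -
          have "A.sg (\<xi>' - \<delta>) = A.sg (\<xi> - \<delta>)" using 3(3) r by (force simp: A.cell_def)
          then show ?thesis using same_positionD[OF sp(1) r] same_positionD[OF sp(2) r] by simp
        qed
        then show ?thesis using K by (auto simp: B.cell_def)
      qed
      from same_root_pattern[OF K(1) 3(1) K(2) sp(1)] have "\<xi> = \<xi>' \<and> \<eta> = \<eta>'" unfolding same_root_pattern_def
      proof (elim disjE exE bexE conjE)
        fix s :: int assume "s \<noteq> 0" "\<forall>x\<in>A.cell (fst ` R) \<xi>. A.sg (poly h1 x) = s"
        then show ?thesis using e(1) z(1) by auto
      next
        fix s \<rho>1 \<rho>2 assume "s \<noteq> 0"
          and a: "\<forall>x\<in>A.cell (fst ` R) \<xi>. A.sg (poly h1 x) = s * A.sg (x - \<rho>1)"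
          "\<forall>y\<in>B.cell (snd ` R) \<eta>. B.sg (poly h2 y) = s * B.sg (y - \<rho>2)"
        then have "A.sg (\<xi> - \<rho>1) = 0" "A.sg (\<xi>' - \<rho>1) = 0" "B.sg (\<eta> - \<rho>2) = 0" "B.sg (\<eta>' - \<rho>2) = 0"
          using e e' 3(3) z by fastforce+
        then show ?thesis by (simp add: A.sg_zero B.sg_zero)
      qed
      then show ?thesis by simp
    next
      case (4 \<delta> \<epsilon>)
      have dK: "\<delta> \<in> A.K" "\<epsilon> \<in> B.K" using g(2,3) 4(3) by auto
      have ne: "A.sg (\<xi> - \<delta>) \<noteq> 0" "A.sg (\<xi>' - \<delta>) \<noteq> 0" using 4(1,2,3) A.sg_zero[of "\<xi> - \<delta>"] A.sg_zero[of "\<xi>' - \<delta>"] by force+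
      then have opp: "A.sg (\<xi>' - \<delta>) = - A.sg (\<xi> - \<delta>)"
        using 4(4) A.sg_cases[of "\<xi> - \<delta>"] A.sg_cases[of "\<xi>' - \<delta>"] by auto
      have "A.sg ((\<xi> - \<delta>) - (\<xi>' - \<delta>)) = A.sg (\<xi> - \<delta>)"
        by (rule A.sg_diff_opposite) (use K dK A.K_closed(5) opp ne in auto)
      moreover have "B.sg ((\<eta> - \<epsilon>) - (\<eta>' - \<epsilon>)) = A.sg (\<xi> - \<delta>)"
        by (rule B.sg_diff_opposite)
          (use K dK B.K_closed(5) opp ne same_positionD[OF sp(1) 4(3)] same_positionD[OF sp(2) 4(3)] in auto)
      ultimately show ?thesis by simp
    qed
  qed
  have R'K: "\<xi> \<in> A.K" "\<eta> \<in> B.K" if "(\<xi>, \<eta>) \<in> R'" for \<xi> \<eta>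
    using that g(2,3) by (auto simp: R'_def N_def)
  have gridR': "grid R'"
    unfolding grid_def same_position_def
  proof (intro conjI ballI, rule finR', safe)
    fix \<xi> \<eta> \<xi>' \<eta>' assume r: "(\<xi>, \<eta>) \<in> R'" "(\<xi>', \<eta>') \<in> R'"
    consider "(\<xi>, \<eta>) \<in> R" "(\<xi>', \<eta>') \<in> R" | "(\<xi>, \<eta>) \<in> N" "(\<xi>', \<eta>') \<in> N"
      | "(\<xi>, \<eta>) \<in> N" "(\<xi>', \<eta>') \<in> R" | "(\<xi>, \<eta>) \<in> R" "(\<xi>', \<eta>') \<in> N"
      using r by (auto simp: R'_def)
    then show "A.sg (\<xi> - \<xi>') = B.sg (\<eta> - \<eta>')"
    proof cases
      case 1 then show ?thesis by (rule g(4))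
    next
      case 2 then show ?thesis by (rule NN)
    next
      case 3
      then have "same_position R \<xi> \<eta>" by (simp add: N_def)
      then show ?thesis using 3(2) by (rule same_positionD)
    next
      case 4
      then have "same_position R \<xi>' \<eta>'" by (simp add: N_def)
      then have "A.sg (\<xi>' - \<xi>) = B.sg (\<eta>' - \<eta>)" using 4(1) by (rule same_positionD)
      then show ?thesis using A.sg_swap[of \<xi> \<xi>'] B.sg_swap[of \<eta> \<eta>'] R'K r by simp
    qed
  qed (use R'K in auto)
  have sub: "same_position R x y" if "same_position R' x y" for x y
    using that by (auto simp: same_position_def R'_def)
  have newroot: "(\<rho>1, \<rho>2) \<in> N" if "same_position R x y" "\<rho>1 \<in> A.cell (fst ` R) x" "\<rho>2 \<in> B.cell (snd ` R) y"
      "poly h1 \<rho>1 = 0" "poly h2 \<rho>2 = 0" for x y \<rho>1 \<rho>2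
    using cellI[OF that(1,2,3)] that by (auto simp: N_def A.cell_def B.cell_def)
  have hs: "A.sg (poly h1 x) = B.sg (poly h2 y)" if K: "x \<in> A.K" "y \<in> B.K" and sp: "same_position R' x y" for x y
  proof (cases "x \<in> fst ` R")
    case True
    then show ?thesis using partner[OF _ sub[OF sp]] pts by (auto simp: fstR)
  next
    case False
    have e: "x \<in> A.cell (fst ` R) x" "y \<in> B.cell (snd ` R) y" using K by (auto simp: A.cell_def B.cell_def)
    from same_root_pattern[OF K(1) False K(2) sub[OF sp]] show ?thesis unfolding same_root_pattern_def
    proof (elim disjE exE bexE conjE)
      fix s \<rho>1 \<rho>2 assume r: "\<rho>1 \<in> A.cell (fst ` R) x" "\<rho>2 \<in> B.cell (snd ` R) y" "poly h1 \<rho>1 = 0" "poly h2 \<rho>2 = 0"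
        and a: "\<forall>u\<in>A.cell (fst ` R) x. A.sg (poly h1 u) = s * A.sg (u - \<rho>1)"
          "\<forall>v\<in>B.cell (snd ` R) y. B.sg (poly h2 v) = s * B.sg (v - \<rho>2)"
      have "(\<rho>1, \<rho>2) \<in> R'" using newroot[OF sub[OF sp] r] by (simp add: R'_def)
      then show ?thesis using a e same_positionD[OF sp] by simp
    qed (use e in auto)
  qed
  have hroots: "x \<in> fst ` R'" if xr: "x \<in> A.K" "poly h1 x = 0" for x
  proof (cases "x \<in> fst ` R")
    case True
    then show ?thesis by (auto simp: R'_def)
  next
    case False
    obtain y where y: "y \<in> B.K" "same_position R x y" using same_position_exists[OF R xr(1)] by blast
    have e: "x \<in> A.cell (fst ` R) x" using xr by (auto simp: A.cell_def)
    from same_root_pattern[OF xr(1) False y] show ?thesis unfolding same_root_pattern_def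
    proof (elim disjE exE bexE conjE)
      fix s :: int assume "s \<noteq> 0" "\<forall>u\<in>A.cell (fst ` R) x. A.sg (poly h1 u) = s"
      then show ?thesis using e xr(2) by auto
    next
      fix s \<rho>1 \<rho>2 assume r: "s \<noteq> 0" "\<rho>1 \<in> A.cell (fst ` R) x" "\<rho>2 \<in> B.cell (snd ` R) y" "poly h1 \<rho>1 = 0" "poly h2 \<rho>2 = 0"
        and a: "\<forall>u\<in>A.cell (fst ` R) x. A.sg (poly h1 u) = s * A.sg (u - \<rho>1)"
      have "A.sg (x - \<rho>1) = 0" using bspec[OF a e] xr(2) r(1) by simp
      then have "x = \<rho>1" by (simp add: A.sg_zero)
      then show ?thesis using newroot[OF y(2) r(2,3,4,5)] by (force simp: R'_def)
    qed
  qed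
  have "table R' (insert (h1, h2) F)"
    unfolding table_def
  proof (intro conjI allI impI)
    fix \<xi> \<eta> assume "(\<xi>, \<eta>) \<in> R'"
    then consider "(\<xi>, \<eta>) \<in> R" | "(\<xi>, \<eta>) \<in> N" by (auto simp: R'_def)
    then show "\<exists>p q. (p, q) \<in> insert (h1, h2) F \<and> p \<noteq> 0 \<and> q \<noteq> 0 \<and> poly p \<xi> = 0 \<and> poly q \<eta> = 0"
    proof cases
      case 1
      then show ?thesis using tableD(2)[OF tab 1] by blast
    next
      case 2
      then show ?thesis using nonz by (intro exI[of _ h1] exI[of _ h2]) (simp add: N_def)
    qed
  next
    fix x y p q assume a: "x \<in> A.K" "y \<in> B.K" "same_position R' x y" "(p, q) \<in> insert (h1, h2) F"
    show "A.sg (poly p x) = B.sg (poly q y)"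
    proof (cases "(p, q) \<in> F")
      case True
      then show ?thesis by (rule signs[OF a(1,2) sub[OF a(3)]])
    next
      case False
      then show ?thesis using a hs by simp
    qed
  next
    fix p q x assume a: "(p, q) \<in> insert (h1, h2) F" "p \<noteq> 0" "x \<in> A.K" "poly p x = 0"
    show "x \<in> fst ` R'"
    proof (cases "(p, q) \<in> F")
      case True
      then show ?thesis using roots[OF True a(2,3,4)] by (auto simp: R'_def)
    next
      case False
      then show ?thesis using a hroots by simp
    qed
  qed (rule gridR')
  then show ?thesis by blast
qed

text \<open>
  The constants \<open>c1\<close> and \<open>c2\<close> absorb the powers of leading
  coefficients in divisions with remainder.
\<close>

definition closed_family :: "('a poly \<times> 'b poly) set \<Rightarrow> bool" where
  "closed_family F \<longleftrightarrow> finite F \<and>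
    (\<forall>h1 h2. (h1, h2) \<in> F \<longrightarrow> h1 \<in> polys_over A.K \<and> h2 \<in> polys_over B.K \<and> degree h1 = degree h2 \<and>
       A.sg (lead_coeff h1) = B.sg (lead_coeff h2)) \<and>
    (\<forall>h1 h2. (h1, h2) \<in> F \<longrightarrow> degree h1 \<ge> 1 \<longrightarrow> (pderiv h1, pderiv h2) \<in> F) \<and>
    (\<forall>h1 h2 p q. (h1, h2) \<in> F \<longrightarrow> (p, q) \<in> F \<longrightarrow> degree p \<ge> 1 \<longrightarrow> degree p \<le> degree h1 \<longrightarrow>
       (\<exists>r1 r2 c1 c2. (r1, r2) \<in> F \<and> degree r1 < degree p \<and> A.pos c1 \<and> B.pos c2 \<and>
         (\<forall>x. poly p x = 0 \<longrightarrow> c1 * poly h1 x = poly r1 x) \<and>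
         (\<forall>y. poly q y = 0 \<longrightarrow> c2 * poly h2 y = poly r2 y)))"

lemma closed_familyD:
  assumes "closed_family F"
  shows "finite F" "(h1, h2) \<in> F \<Longrightarrow> h1 \<in> polys_over A.K" "(h1, h2) \<in> F \<Longrightarrow> h2 \<in> polys_over B.K"
    "(h1, h2) \<in> F \<Longrightarrow> degree h2 = degree h1" "(h1, h2) \<in> F \<Longrightarrow> A.sg (lead_coeff h1) = B.sg (lead_coeff h2)"
    "(h1, h2) \<in> F \<Longrightarrow> degree h1 \<ge> 1 \<Longrightarrow> (pderiv h1, pderiv h2) \<in> F"
    "(h1, h2) \<in> F \<Longrightarrow> (p, q) \<in> F \<Longrightarrow> degree p \<ge> 1 \<Longrightarrow> degree p \<le> degree h1 \<Longrightarrow>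
       \<exists>r1 r2 c1 c2. (r1, r2) \<in> F \<and> degree r1 < degree p \<and> A.pos c1 \<and> B.pos c2 \<and>
         (\<forall>x. poly p x = 0 \<longrightarrow> c1 * poly h1 x = poly r1 x) \<and>
         (\<forall>y. poly q y = 0 \<longrightarrow> c2 * poly h2 y = poly r2 y)"
proof -
  note h = assms[unfolded closed_family_def]
  note 2 = conjunct2[OF h]
  note 3 = conjunct2[OF 2]
  show "finite F" by (rule conjunct1[OF h])
  show "(h1, h2) \<in> F \<Longrightarrow> h1 \<in> polys_over A.K" "(h1, h2) \<in> F \<Longrightarrow> h2 \<in> polys_over B.K"
    "(h1, h2) \<in> F \<Longrightarrow> A.sg (lead_coeff h1) = B.sg (lead_coeff h2)"
    using conjunct1[OF 2] by blast+
  show "(h1, h2) \<in> F \<Longrightarrow> degree h2 = degree h1"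
    using conjunct1[OF 2] by simp
  show "(h1, h2) \<in> F \<Longrightarrow> degree h1 \<ge> 1 \<Longrightarrow> (pderiv h1, pderiv h2) \<in> F"
    using conjunct1[OF 3] by blast
qed (rule conjunct2[OF conjunct2[OF conjunct2[OF assms[unfolded closed_family_def]]], rule_format])

text \<open>
  Members are added in the order of their degrees: derivatives and remainders have smaller
  degree, so they are in the table when they are needed.
\<close>

lemma table_exists:
  assumes F: "closed_family F"
  shows "\<exists>R. table R F"
proof -
  have fin: "finite F" using F by (simp add: closed_family_def)
  define Fn where "Fn = (\<lambda>n. {(p, q)\<in>F. degree p < n})"
  have "\<exists>R. table R (Fn (Suc n))" for n
  proof (induction n)
    case 0
    have const: "\<exists>a b. p = [:a:] \<and> q = [:b:] \<and> A.sg a = B.sg b" if "(p, q) \<in> Fn (Suc 0)" for p q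
    proof -
      have pq: "(p, q) \<in> F" "degree p = 0" using that by (auto simp: Fn_def)
      then have "degree q = 0" using closed_familyD(4)[OF F] by simp
      then obtain a b where ab: "p = [:a:]" "q = [:b:]" using pq(2) by (metis degree_eq_zeroE)
      then show ?thesis using closed_familyD(5)[OF F pq(1)] by simp
    qed
    have "table {} (Fn (Suc 0))"
      unfolding table_def
    proof (intro conjI allI impI)
      show "grid {}" by (simp add: grid_def)
    next
      fix x y p q assume "(p, q) \<in> Fn (Suc 0)"
      then show "A.sg (poly p x) = B.sg (poly q y)" using const[of p q] by auto
    next
      fix p q x assume "(p, q) \<in> Fn (Suc 0)" "p \<noteq> 0" "poly p x = 0"
      then show "x \<in> fst ` {}" using const[of p q] by auto
    qed simp
    then show ?case by blast
  next
    case (Suc n)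
    define H where "H = {(p, q)\<in>F. degree p = Suc n}"
    have "finite H" using fin by (rule rev_finite_subset) (auto simp: H_def)
    have "\<exists>R. table R (Fn (Suc n) \<union> S)" if "finite S" "S \<subseteq> H" for S
      using that
    proof (induction S rule: finite_induct)
      case empty
      then show ?case using Suc.IH by simp
    next
      case (insert h S)
      obtain h1 h2 where h: "h = (h1, h2)" by fastforce
      have hF: "(h1, h2) \<in> F" and dh: "degree h1 = Suc n" using insert.prems h by (auto simp: H_def)
      have dn: "degree p \<le> Suc n \<and> (p, q) \<in> F" if "(p, q) \<in> Fn (Suc n) \<union> S" for p q
        using that insert.prems by (auto simp: Fn_def H_def)
      obtain R where R: "table R (Fn (Suc n) \<union> S)" using insert by auto
      have "\<exists>R'. table R' (insert (h1, h2) (Fn (Suc n) \<union> S))"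
      proof (rule table_insert[OF R])
        show "h1 \<in> polys_over A.K" "h2 \<in> polys_over B.K" "degree h1 \<ge> 1" "degree h2 \<ge> 1"
          using closed_familyD(2,3,4)[OF F hF] dh by simp_all
        have "(pderiv h1, pderiv h2) \<in> F" by (rule closed_familyD(6)[OF F hF]) (simp add: dh)
        then show "(pderiv h1, pderiv h2) \<in> Fn (Suc n) \<union> S" using dh by (simp add: Fn_def degree_pderiv)
        fix p q assume pq: "(p, q) \<in> Fn (Suc n) \<union> S" "degree p \<ge> 1"
        then have d: "(p, q) \<in> F" "degree p \<le> degree h1" using dn dh by auto
        obtain r1 r2 c1 c2 where r: "(r1, r2) \<in> F" "degree r1 < degree p" "A.pos c1" "B.pos c2"
          "\<forall>x. poly p x = 0 \<longrightarrow> c1 * poly h1 x = poly r1 x" "\<forall>y. poly q y = 0 \<longrightarrow> c2 * poly h2 y = poly r2 y"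
          using closed_familyD(7)[OF F hF d(1) pq(2) d(2)] by blast
        have "(r1, r2) \<in> Fn (Suc n) \<union> S" using r(1,2) d dh by (simp add: Fn_def)
        then show "\<exists>r1 r2 c1 c2. (r1, r2) \<in> Fn (Suc n) \<union> S \<and> A.pos c1 \<and> B.pos c2 \<and>
             (\<forall>x. poly p x = 0 \<longrightarrow> c1 * poly h1 x = poly r1 x) \<and>
             (\<forall>y. poly q y = 0 \<longrightarrow> c2 * poly h2 y = poly r2 y)" using r by blast
      qed
      then show ?case by (simp add: h)
    qed
    from this[OF \<open>finite H\<close> order_refl] obtain R where "table R (Fn (Suc n) \<union> H)" by blast
    moreover have "Fn (Suc n) \<union> H = Fn (Suc (Suc n))" by (auto simp: Fn_def H_def)
    ultimately show ?case by auto
  qed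
  then obtain R where "table R (Fn (Suc (Max (insert 0 (degree ` fst ` F)))))" by blast
  moreover have "degree p \<le> Max (insert 0 (degree ` fst ` F))" if "(p, q) \<in> F" for p q
    using fin that by (intro Max_ge) force+
  then have "Fn (Suc (Max (insert 0 (degree ` fst ` F)))) = F" by (auto simp: Fn_def less_Suc_eq_le)
  ultimately show ?thesis by auto
qed

theorem realize_sign_vector:
  assumes "closed_family F" "x \<in> A.K"
  shows "\<exists>y\<in>B.K. \<forall>p q. (p, q) \<in> F \<longrightarrow> A.sg (poly p x) = B.sg (poly q y)"
proof -
  obtain R where R: "table R F" using table_exists[OF assms(1)] by blast
  obtain y where y: "y \<in> B.K" "same_position R x y" using same_position_exists[OF tableD(1)[OF R] assms(2)] by blast
  then show ?thesis using tableD(3)[OF R assms(2) y] by blast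
qed

end

section \<open>Images of polynomials under ring homomorphisms\<close>

definition is_hom :: "('r::comm_ring_1 \<Rightarrow> 's::comm_ring_1) \<Rightarrow> bool" where
  "is_hom \<phi> \<longleftrightarrow> \<phi> 1 = 1 \<and> (\<forall>x y. \<phi> (x + y) = \<phi> x + \<phi> y \<and> \<phi> (x * y) = \<phi> x * \<phi> y)"

lemma is_homD:
  assumes "is_hom \<phi>"
  shows "\<phi> 1 = 1" "\<phi> 0 = 0" "\<phi> (x + y) = \<phi> x + \<phi> y" "\<phi> (x * y) = \<phi> x * \<phi> y" "\<phi> (- x) = - \<phi> x"
    "\<phi> (x - y) = \<phi> x - \<phi> y" "\<phi> (x ^ n) = \<phi> x ^ n" "\<phi> (of_nat n) = of_nat n" "\<phi> (sum g I) = (\<Sum>i\<in>I. \<phi> (g i))"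
proof -
  note h = assms[unfolded is_hom_def]
  show 1: "\<phi> 1 = 1" using h by blast
  have add: "\<phi> (x + y) = \<phi> x + \<phi> y" for x y using h by blast
  have mult: "\<phi> (x * y) = \<phi> x * \<phi> y" for x y using h by blast
  show "\<phi> (x + y) = \<phi> x + \<phi> y" "\<phi> (x * y) = \<phi> x * \<phi> y" by (rule add, rule mult)
  have "\<phi> 0 + \<phi> 0 = \<phi> 0 + 0" using add[of 0 0] by simp
  then show 0: "\<phi> 0 = 0" by (simp only: add_left_cancel)
  have neg: "\<phi> (- x) = - \<phi> x" for x
    using add[of x "- x"] 0 by (simp add: eq_neg_iff_add_eq_0 add.commute)
  show "\<phi> (- x) = - \<phi> x" by (rule neg)
  show "\<phi> (x - y) = \<phi> x - \<phi> y" using add[of x "- y"] neg[of y] by simp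
  show "\<phi> (x ^ n) = \<phi> x ^ n" by (induction n) (simp_all add: 1 mult)
  show "\<phi> (of_nat n) = of_nat n" by (induction n) (simp_all add: 0 1 add)
  show "\<phi> (sum g I) = (\<Sum>i\<in>I. \<phi> (g i))"
    by (induction I rule: infinite_finite_induct) (simp_all add: 0 add)
qed

lemma map_poly_hom:
  assumes "is_hom \<phi>"
  shows "coeff (map_poly \<phi> p) i = \<phi> (coeff p i)"
    "map_poly \<phi> (p + q) = map_poly \<phi> p + map_poly \<phi> q"
    "map_poly \<phi> (p * q) = map_poly \<phi> p * map_poly \<phi> q"
    "map_poly \<phi> (smult c p) = smult (\<phi> c) (map_poly \<phi> p)"
    "\<phi> (poly p x) = poly (map_poly \<phi> p) (\<phi> x)"
proof -
  note h = is_homD[OF assms]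
  show c: "coeff (map_poly \<phi> p) i = \<phi> (coeff p i)" for p i by (simp add: coeff_map_poly h)
  show "map_poly \<phi> (p + q) = map_poly \<phi> p + map_poly \<phi> q"
    by (rule poly_eqI) (simp add: c h)
  show "map_poly \<phi> (p * q) = map_poly \<phi> p * map_poly \<phi> q"
    by (rule poly_eqI) (simp add: c h coeff_mult)
  show "map_poly \<phi> (smult c p) = smult (\<phi> c) (map_poly \<phi> p)"
    by (rule poly_eqI) (simp add: c h)
  show "\<phi> (poly p x) = poly (map_poly \<phi> p) (\<phi> x)"
    by (induction p) (simp_all add: h map_poly_pCons)
qed

lemma degree_map_poly_hom:
  assumes "is_hom \<phi>" shows "degree (map_poly \<phi> p) \<le> degree p"
  by (rule degree_le) (simp add: map_poly_hom(1)[OF assms] is_homD(2)[OF assms] coeff_eq_0)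

lemma map_poly_polys_over:
  assumes "is_hom \<phi>" "p \<in> polys_over B" "\<And>b. b \<in> B \<Longrightarrow> \<phi> b \<in> C"
  shows "map_poly \<phi> p \<in> polys_over C"
  using assms by (auto simp: polys_over_def map_poly_hom)

text \<open>
  The operation \<open>pderiv\<close> asks for a coefficient ring without zero divisors, whereas
  the coefficients below are multivariate polynomials over an arbitrary finite type of
  variables.
\<close>

definition formal_deriv :: "'r::comm_ring_1 poly \<Rightarrow> 'r poly" where
  "formal_deriv q = (\<Sum>i<degree q. monom (of_nat (Suc i) * coeff q (Suc i)) i)"

lemma coeff_formal_deriv: "coeff (formal_deriv q) n = of_nat (Suc n) * coeff q (Suc n)"
proof -
  have "coeff (formal_deriv q) n = (\<Sum>i<degree q. if i = n then of_nat (Suc i) * coeff q (Suc i) else 0)"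
    unfolding formal_deriv_def coeff_sum by (intro sum.cong) (simp_all add: coeff_monom)
  also have "\<dots> = of_nat (Suc n) * coeff q (Suc n)"
    by (auto simp: coeff_eq_0 not_less)
  finally show ?thesis .
qed

lemma map_poly_formal_deriv:
  fixes \<phi> :: "'r::comm_ring_1 \<Rightarrow> 's::idom"
  shows "is_hom \<phi> \<Longrightarrow> map_poly \<phi> (formal_deriv q) = pderiv (map_poly \<phi> q)"
  by (rule poly_eqI) (simp add: map_poly_hom(1) coeff_formal_deriv coeff_pderiv is_homD(4,8) del: of_nat_Suc)

text \<open>
  Leading coefficients may be in the kernel of \<open>\<phi>\<close>. Cutting them off makes the
  degree agree with that of the image.
\<close>

definition truncate :: "('r::comm_ring_1 \<Rightarrow> 's::comm_ring_1) \<Rightarrow> 'r poly \<Rightarrow> 'r poly" where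
  "truncate \<phi> q = (\<Sum>i\<le>degree (map_poly \<phi> q). monom (coeff q i) i)"

lemma coeff_truncate: "coeff (truncate \<phi> q) n = (if n \<le> degree (map_poly \<phi> q) then coeff q n else 0)"
proof -
  have "coeff (truncate \<phi> q) n = (\<Sum>i\<le>degree (map_poly \<phi> q). if i = n then coeff q i else 0)"
    unfolding truncate_def coeff_sum by (intro sum.cong) (simp_all add: coeff_monom)
  also have "\<dots> = (if n \<le> degree (map_poly \<phi> q) then coeff q n else 0)"
    by (subst sum.delta) auto
  finally show ?thesis .
qed

lemma truncate_properties:
  assumes "is_hom \<phi>"
  shows "map_poly \<phi> (truncate \<phi> q) = map_poly \<phi> q"
    "degree (truncate \<phi> q) = degree (map_poly \<phi> q)"
    "subring_set B \<Longrightarrow> q \<in> polys_over B \<Longrightarrow> truncate \<phi> q \<in> polys_over B"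
    "degree (map_poly \<phi> (truncate \<phi> q)) = degree (truncate \<phi> q)"
proof -
  show m: "map_poly \<phi> (truncate \<phi> q) = map_poly \<phi> q"
  proof (rule poly_eqI)
    fix n
    have "\<phi> (coeff q n) = 0" if "n > degree (map_poly \<phi> q)"
      using coeff_eq_0[OF that] by (simp add: map_poly_hom(1)[OF assms])
    then show "coeff (map_poly \<phi> (truncate \<phi> q)) n = coeff (map_poly \<phi> q) n"
      by (simp add: map_poly_hom(1)[OF assms] coeff_truncate is_homD(2)[OF assms])
  qed
  have le: "degree (truncate \<phi> q) \<le> degree (map_poly \<phi> q)"
    by (rule degree_le) (simp add: coeff_truncate)
  moreover have "degree (map_poly \<phi> (truncate \<phi> q)) \<le> degree (truncate \<phi> q)" by (rule degree_map_poly_hom[OF assms])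
  ultimately show d: "degree (truncate \<phi> q) = degree (map_poly \<phi> q)" using m by simp
  then show "degree (map_poly \<phi> (truncate \<phi> q)) = degree (truncate \<phi> q)" using m by simp
  show "truncate \<phi> q \<in> polys_over B" if "subring_set B" "q \<in> polys_over B"
    using that subring_setD(1)[OF that(1)] by (auto simp: polys_over_def coeff_truncate)
qed

text \<open>
  With an even power the factor of \<open>h\<close> is a square, so it does not change signs.
\<close>

lemma even_pseudo_remainder:
  fixes h p :: "'r::comm_ring_1 poly"
  assumes B: "subring_set B" and h: "h \<in> polys_over B" and p: "p \<in> polys_over B" "degree p \<ge> 1"
  shows "\<exists>r\<in>polys_over B. degree r < degree p \<and> (\<exists>N u. smult ((lead_coeff p ^ N)\<^sup>2) h = p * u + r)"
proof -
  have p0: "p \<noteq> 0" using p(2) by auto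
  obtain N q r where r: "q \<in> polys_over B" "r \<in> polys_over B" "smult (lead_coeff p ^ N) h = p * q + r"
    "r = 0 \<or> degree r < degree p" using pseudo_division[OF B p(1) p0 h] by blast
  let ?c = "lead_coeff p ^ N"
  have cB: "?c \<in> B" by (intro subring_setD(7)[OF B] polys_overD[OF p(1)])
  have "smult (?c\<^sup>2) h = smult ?c (smult ?c h)" by (simp add: power2_eq_square)
  also have "\<dots> = p * smult ?c q + smult ?c r" unfolding r(3) by (simp add: smult_add_right)
  finally have "smult (?c\<^sup>2) h = p * smult ?c q + smult ?c r" .
  moreover have "degree (smult ?c r) < degree p"
    using r(4) p(2) degree_smult_le[of ?c r] by auto
  ultimately show ?thesis using polys_over_closed(10)[OF B cB r(2)] by blast
qed

section \<open>Families closed under derivatives and remainders\<close>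

inductive_set deriv_rem_closure :: "('q \<Rightarrow> nat) \<Rightarrow> ('q \<Rightarrow> 'q) \<Rightarrow> ('q \<Rightarrow> 'q \<Rightarrow> 'q) \<Rightarrow> 'q set \<Rightarrow> 'q set"
  for deg D rem H where
  base: "q \<in> H \<Longrightarrow> q \<in> deriv_rem_closure deg D rem H"
| deriv: "q \<in> deriv_rem_closure deg D rem H \<Longrightarrow> deg q \<ge> 1 \<Longrightarrow> D q \<in> deriv_rem_closure deg D rem H"
| rem: "h \<in> deriv_rem_closure deg D rem H \<Longrightarrow> p \<in> deriv_rem_closure deg D rem H \<Longrightarrow> deg p \<ge> 1 \<Longrightarrow>
    deg p \<le> deg h \<Longrightarrow> rem h p \<in> deriv_rem_closure deg D rem H"

text \<open>
  A member of degree $n$ is in \<open>H\<close> or arises from members of degree greater than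
  $n$. Hence the members of degree at least $n$ are finite in number, by downward induction on
  $n$.
\<close>

lemma finite_deriv_rem_closure:
  fixes deg :: "'q \<Rightarrow> nat"
  assumes H: "finite H"
    and D: "\<And>q. q \<in> deriv_rem_closure deg D rem H \<Longrightarrow> deg q \<ge> 1 \<Longrightarrow> deg (D q) < deg q"
    and rem: "\<And>h p. h \<in> deriv_rem_closure deg D rem H \<Longrightarrow> p \<in> deriv_rem_closure deg D rem H \<Longrightarrow>
      deg p \<ge> 1 \<Longrightarrow> deg p \<le> deg h \<Longrightarrow> deg (rem h p) < deg p"
  shows "finite (deriv_rem_closure deg D rem H)"
proof -
  let ?C = "deriv_rem_closure deg D rem H"
  define N where "N = Max (insert 0 (deg ` H))"
  define Fn where "Fn = (\<lambda>n. {q\<in>?C. n \<le> deg q})"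
  have le: "deg q \<le> N" if "q \<in> ?C" for q
    using that
  proof induction
    case (base q)
    then show ?case unfolding N_def using H by (intro Max_ge) auto
  next
    case (deriv q)
    then show ?case using D[OF deriv.hyps] by simp
  next
    case (rem h p)
    then show ?case using assms(3)[OF rem.hyps] by simp
  qed
  have "finite (Fn (Suc N - k))" if "k \<le> Suc N" for k
    using that
  proof (induction k)
    case 0
    have "Fn (Suc N) = {}" using le by (fastforce simp: Fn_def)
    then show ?case by simp
  next
    case (Suc k)
    define n where "n = Suc N - Suc k"
    have fin: "finite (Fn (Suc n))" using Suc by (simp add: n_def Suc_diff_le)
    have "Fn n \<subseteq> H \<union> D ` Fn (Suc n) \<union> case_prod rem ` (Fn (Suc n) \<times> Fn (Suc n))"
    proof
      fix q assume "q \<in> Fn n"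
      then have "q \<in> ?C" "n \<le> deg q" by (auto simp: Fn_def)
      then show "q \<in> H \<union> D ` Fn (Suc n) \<union> case_prod rem ` (Fn (Suc n) \<times> Fn (Suc n))"
      proof (cases rule: deriv_rem_closure.cases)
        case base
        then show ?thesis by blast
      next
        case (deriv q')
        then have "q' \<in> Fn (Suc n)" using D[OF deriv(2,3)] \<open>n \<le> deg q\<close> by (simp add: Fn_def)
        then show ?thesis using deriv(1) by blast
      next
        case (rem h p)
        then have "p \<in> Fn (Suc n)" "h \<in> Fn (Suc n)" using assms(3)[OF rem(2-5)] \<open>n \<le> deg q\<close> by (auto simp: Fn_def)
        then show ?thesis using rem(1) by force
      qed
    qed
    then show ?case using H fin unfolding n_def[symmetric] by (meson finite_SigmaI finite_UnI finite_imageI finite_subset)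
  qed
  from this[of "Suc N"] show ?thesis by (simp add: Fn_def)
qed

lemma (in ordered_subfield) pos_square: "x \<in> K \<Longrightarrow> x \<noteq> 0 \<Longrightarrow> pos (x\<^sup>2)"
  using pos_cases[of x] pos_mult[of x x] pos_mult[of "- x" "- x"] by (auto simp: power2_eq_square)

context two_real_closed
begin

lemma closed_familyI:
  assumes "finite F"
    and "\<And>h1 h2. (h1, h2) \<in> F \<Longrightarrow> h1 \<in> polys_over A.K \<and> h2 \<in> polys_over B.K \<and> degree h1 = degree h2 \<and>
      A.sg (lead_coeff h1) = B.sg (lead_coeff h2)"
    and "\<And>h1 h2. (h1, h2) \<in> F \<Longrightarrow> degree h1 \<ge> 1 \<Longrightarrow> (pderiv h1, pderiv h2) \<in> F"
    and "\<And>h1 h2 p q. (h1, h2) \<in> F \<Longrightarrow> (p, q) \<in> F \<Longrightarrow> degree p \<ge> 1 \<Longrightarrow> degree p \<le> degree h1 \<Longrightarrow>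
      \<exists>r1 r2 c1 c2. (r1, r2) \<in> F \<and> degree r1 < degree p \<and> A.pos c1 \<and> B.pos c2 \<and>
        (\<forall>x. poly p x = 0 \<longrightarrow> c1 * poly h1 x = poly r1 x) \<and>
        (\<forall>y. poly q y = 0 \<longrightarrow> c2 * poly h2 y = poly r2 y)"
  shows "closed_family F"
  unfolding closed_family_def
  by (rule conjI[OF assms(1)], rule conjI, (intro allI impI, rule assms(2), assumption), rule conjI,
      (intro allI impI, rule assms(3); assumption), (intro allI impI, rule assms(4); assumption))

text \<open>
  The signs of finitely many coefficients control the sign vectors of a finite family in one
  variable: \<open>G\<close> collects the coefficients of the closure of \<open>H\<close> under
  derivatives and remainders. If two homomorphisms into real closed fields agree in the signs on
  \<open>G\<close>, then the images of the closure form a closed family, and sign tables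
  transport a point.
\<close>

lemma sign_family:
  fixes \<phi> :: "'r::comm_ring_1 \<Rightarrow> 'a"
  assumes B: "subring_set B" and \<phi>: "is_hom \<phi>" "\<And>b. b \<in> B \<Longrightarrow> \<phi> b \<in> A.K"
    and H: "finite H" "H \<subseteq> polys_over B"
  shows "\<exists>G\<subseteq>B. finite G \<and> (\<forall>\<psi>. is_hom \<psi> \<longrightarrow> (\<forall>b\<in>B. \<psi> b \<in> B.K) \<longrightarrow> (\<forall>g\<in>G. A.sg (\<phi> g) = B.sg (\<psi> g)) \<longrightarrow>
    (\<forall>x\<in>A.K. \<exists>y\<in>B.K. \<forall>q\<in>H. A.sg (poly (map_poly \<phi> q) x) = B.sg (poly (map_poly \<psi> q) y)))"
proof -
  have "\<forall>h p. \<exists>r. h \<in> polys_over B \<longrightarrow> p \<in> polys_over B \<longrightarrow> degree p \<ge> 1 \<longrightarrow>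
      r \<in> polys_over B \<and> degree r < degree p \<and> (\<exists>N u. smult ((lead_coeff p ^ N)\<^sup>2) h = p * u + r)"
    using even_pseudo_remainder[OF B] by meson
  then obtain rm where rm: "\<And>h p. h \<in> polys_over B \<Longrightarrow> p \<in> polys_over B \<Longrightarrow> degree p \<ge> 1 \<Longrightarrow>
      rm h p \<in> polys_over B \<and> degree (rm h p) < degree p \<and> (\<exists>N u. smult ((lead_coeff p ^ N)\<^sup>2) h = p * u + rm h p)"
    by metis
  define D where "D = (\<lambda>q. truncate \<phi> (formal_deriv q))"
  define rem where "rem = (\<lambda>h p. truncate \<phi> (rm h p))"
  define C where "C = deriv_rem_closure degree D rem (truncate \<phi> ` H)"
  note tr = truncate_properties[OF \<phi>(1)]
  have fd: "formal_deriv q \<in> polys_over B" if "q \<in> polys_over B" for q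
    using that subring_setD(6,10)[OF B] by (auto simp: polys_over_def coeff_formal_deriv simp del: of_nat_Suc)
  have CB: "q \<in> polys_over B \<and> degree (map_poly \<phi> q) = degree q" if "q \<in> C" for q
    using that unfolding C_def
  proof induction
    case (base q)
    then show ?case using H tr B by auto
  next
    case (deriv q)
    then show ?case unfolding D_def using tr B fd by simp
  next
    case (rem h p)
    then show ?case unfolding rem_def using tr B rm[of h p] by simp
  qed
  have degtr: "degree (truncate \<phi> q) \<le> degree q" for q
    using tr(2) degree_map_poly_hom[OF \<phi>(1), of q] by simp
  have degD: "degree (D q) < degree q" if "degree q \<ge> 1" for q
  proof -
    have "degree (formal_deriv q) \<le> degree q - 1"
      by (rule degree_le) (auto simp: coeff_formal_deriv coeff_eq_0)
    then show ?thesis using degtr[of "formal_deriv q"] that by (simp add: D_def)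
  qed
  have degrem: "degree (rem h p) < degree p" if "h \<in> C" "p \<in> C" "degree p \<ge> 1" for h p
    using rm[of h p] CB that degtr[of "rm h p"] by (fastforce simp: rem_def)
  have finC: "finite C" unfolding C_def
    by (rule finite_deriv_rem_closure) (use H degD degrem in \<open>auto simp: C_def\<close>)
  \<comment> \<open>Besides the closure, \<open>E\<close> contains what is cut off by truncation: those coefficients have to vanish under \<open>\<psi>\<close> too.\<close>
  define E where "E = C \<union> H \<union> (\<lambda>(h, p). rm h p) ` {(h, p) \<in> C \<times> C. degree p \<ge> 1}"
  have C_E: "q \<in> E" if "q \<in> C" for q using that by (simp add: E_def)
  define G where "G = (\<Union>q\<in>E. coeff q ` {..degree q})"
  have "E \<subseteq> polys_over B" using CB H rm by (auto simp: E_def)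
  then have "G \<subseteq> B" by (auto simp: G_def polys_over_def)
  moreover have "finite E" unfolding E_def using finC H(1)
    by (intro finite_UnI finite_imageI) (auto intro: finite_subset[of _ "C \<times> C"])
  then have "finite G" by (simp add: G_def)
  ultimately have G: "G \<subseteq> B" "finite G" by auto
  have "\<exists>y\<in>B.K. \<forall>q\<in>H. A.sg (poly (map_poly \<phi> q) x) = B.sg (poly (map_poly \<psi> q) y)"
    if \<psi>: "is_hom \<psi>" "\<forall>b\<in>B. \<psi> b \<in> B.K" and sgn: "\<forall>g\<in>G. A.sg (\<phi> g) = B.sg (\<psi> g)" and x: "x \<in> A.K" for \<psi> :: "'r \<Rightarrow> 'b" and x
  proof -
    note mp = map_poly_hom[OF \<phi>(1)] and mp' = map_poly_hom[OF \<psi>(1)]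
    have cs: "A.sg (\<phi> (coeff q i)) = B.sg (\<psi> (coeff q i))" if "q \<in> E" for q i
    proof (cases "i \<le> degree q")
      case True
      then show ?thesis using sgn that by (auto simp: G_def)
    next
      case False
      then show ?thesis by (simp add: coeff_eq_0 is_homD(2) \<phi>(1) \<psi>(1))
    qed
    have cs0: "\<psi> (coeff q i) = 0" if "q \<in> E" "\<phi> (coeff q i) = 0" for q i
      using cs[OF that(1), of i] that(2) B.sg_zero[of "\<psi> (coeff q i)"] by simp
    have deg: "degree (map_poly \<psi> q) = degree q" if "q \<in> C" for q
    proof (cases "degree q = 0")
      case True
      then show ?thesis using degree_map_poly_hom[OF \<psi>(1), of q] by simp
    next
      case False
      have "degree (map_poly \<phi> q) = degree q" using CB that by blast
      then have "coeff (map_poly \<phi> q) (degree q) \<noteq> 0" using False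
        by (metis degree_0 leading_coeff_0_iff)
      then have "\<psi> (coeff q (degree q)) \<noteq> 0" using cs[OF C_E[OF that], of "degree q"]
          A.sg_zero[of "\<phi> (coeff q (degree q))"] B.sg_zero[of "\<psi> (coeff q (degree q))"] by (auto simp: mp(1))
      then have "coeff (map_poly \<psi> q) (degree q) \<noteq> 0" by (simp add: mp'(1))
      then show ?thesis using degree_map_poly_hom[OF \<psi>(1), of q] le_degree by (metis le_antisym)
    qed
    have tr\<psi>: "map_poly \<psi> (truncate \<phi> q) = map_poly \<psi> q" if "\<And>i. \<phi> (coeff q i) = 0 \<Longrightarrow> \<psi> (coeff q i) = 0" for q
    proof (rule poly_eqI)
      fix i
      have "\<phi> (coeff q i) = 0" if "i > degree (map_poly \<phi> q)"
        using coeff_eq_0[OF that] by (simp add: mp(1))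
      then show "coeff (map_poly \<psi> (truncate \<phi> q)) i = coeff (map_poly \<psi> q) i"
        using that[of i] by (auto simp: mp'(1) coeff_truncate is_homD(2)[OF \<psi>(1)])
    qed
    define F where "F = (\<lambda>q. (map_poly \<phi> q, map_poly \<psi> q)) ` C"
    have FI: "(map_poly \<phi> q, map_poly \<psi> q) \<in> F" if "q \<in> C" for q
      unfolding F_def by (rule image_eqI[OF refl that])
    have "closed_family F"
    proof (rule closed_familyI)
      show "finite F" using finC by (simp add: F_def)
    next
      fix h1 h2 assume "(h1, h2) \<in> F"
      then obtain h where h: "h \<in> C" and e: "h1 = map_poly \<phi> h" "h2 = map_poly \<psi> h" by (auto simp: F_def)
      have hB: "h \<in> polys_over B" and dh: "degree (map_poly \<phi> h) = degree h" using CB h by auto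
      have "h1 \<in> polys_over A.K"
        unfolding e by (rule map_poly_polys_over[OF \<phi>(1) hB]) (rule \<phi>(2))
      moreover have "h2 \<in> polys_over B.K"
        unfolding e by (rule map_poly_polys_over[OF \<psi>(1) hB]) (use \<psi>(2) in blast)
      moreover have "degree h1 = degree h2" using deg[OF h] dh e by simp
      moreover have "A.sg (lead_coeff h1) = B.sg (lead_coeff h2)"
        unfolding e deg[OF h] dh using cs[OF C_E[OF h]] by (simp add: mp(1) mp'(1))
      ultimately show "h1 \<in> polys_over A.K \<and> h2 \<in> polys_over B.K \<and> degree h1 = degree h2 \<and>
        A.sg (lead_coeff h1) = B.sg (lead_coeff h2)" by blast
      assume "degree h1 \<ge> 1"
      then have dh1: "degree h \<ge> 1" using dh e by simp
      have "D h \<in> C" unfolding C_def by (rule deriv_rem_closure.deriv) (use h dh1 in \<open>auto simp: C_def\<close>)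
      moreover have "map_poly \<phi> (D h) = pderiv h1"
        by (simp add: D_def tr map_poly_formal_deriv \<phi>(1) e)
      moreover have "map_poly \<psi> (D h) = pderiv h2"
      proof -
        have "\<psi> (coeff (formal_deriv h) i) = 0" if z: "\<phi> (coeff (formal_deriv h) i) = 0" for i
        proof -
          have "of_nat (Suc i) * \<phi> (coeff h (Suc i)) = 0"
            using z unfolding coeff_formal_deriv by (simp only: is_homD[OF \<phi>(1)])
          then have "\<phi> (coeff h (Suc i)) = 0" unfolding mult_eq_0_iff of_nat_eq_0_iff by simp
          then have "\<psi> (coeff h (Suc i)) = 0" by (rule cs0[OF C_E[OF h]])
          then show ?thesis unfolding coeff_formal_deriv by (simp only: is_homD[OF \<psi>(1)] mult_zero_right)
        qed
        then show ?thesis unfolding D_def by (simp add: tr\<psi> map_poly_formal_deriv \<psi>(1) e)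
      qed
      ultimately show "(pderiv h1, pderiv h2) \<in> F" using FI[of "D h"] by simp
    next
      fix h1 h2 p' q' assume "(h1, h2) \<in> F" "(p', q') \<in> F" and dp: "degree p' \<ge> 1" "degree p' \<le> degree h1"
      then obtain h p where h: "h \<in> C" "h1 = map_poly \<phi> h" "h2 = map_poly \<psi> h"
        and p: "p \<in> C" "p' = map_poly \<phi> p" "q' = map_poly \<psi> p" by (auto simp: F_def)
      have hB: "h \<in> polys_over B" and dh: "degree h1 = degree h" using CB h by auto
      have pB: "p \<in> polys_over B" and dpp: "degree p' = degree p" using CB p by auto
      have dp1: "degree p \<ge> 1" "degree p \<le> degree h" using dp dpp dh by auto
      obtain N u where r: "rm h p \<in> polys_over B" "degree (rm h p) < degree p"
        "smult ((lead_coeff p ^ N)\<^sup>2) h = p * u + rm h p" using rm[OF hB pB dp1(1)] by blast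
      have remC: "rem h p \<in> C" unfolding C_def
        by (rule deriv_rem_closure.rem) (use h p dp1 in \<open>auto simp: C_def\<close>)
      have lcK: "\<phi> (lead_coeff p) \<in> A.K" "\<psi> (lead_coeff p) \<in> B.K"
        using \<phi>(2) \<psi>(2) polys_overD[OF pB] by auto
      have "coeff p' (degree p) \<noteq> 0"
        using dpp dp1(1) by (metis degree_0 leading_coeff_0_iff not_one_le_zero)
      then have lc0: "\<phi> (lead_coeff p) \<noteq> 0" by (simp add: p(2) mp(1))
      then have lc0': "\<psi> (lead_coeff p) \<noteq> 0"
        using cs[OF C_E[OF p(1)], of "degree p"] A.sg_zero[of "\<phi> (lead_coeff p)"] B.sg_zero[of "\<psi> (lead_coeff p)"] by auto
      define c1 where "c1 = (\<phi> (lead_coeff p) ^ N)\<^sup>2"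
      define c2 where "c2 = (\<psi> (lead_coeff p) ^ N)\<^sup>2"
      have c1: "A.pos c1" unfolding c1_def by (rule A.pos_square[OF A.K_power[OF lcK(1)]]) (simp add: lc0)
      have c2: "B.pos c2" unfolding c2_def by (rule B.pos_square[OF B.K_power[OF lcK(2)]]) (simp add: lc0')
      have rE: "rm h p \<in> E" using h p dp1 by (force simp: E_def)
      have e1: "c1 * poly h1 x = poly (map_poly \<phi> (rem h p)) x" if "poly p' x = 0" for x
      proof -
        have "map_poly \<phi> (smult ((lead_coeff p ^ N)\<^sup>2) h) = map_poly \<phi> (p * u + rm h p)" using r(3) by simp
        then have "smult c1 h1 = p' * map_poly \<phi> u + map_poly \<phi> (rm h p)"
          by (simp add: mp is_homD[OF \<phi>(1)] c1_def p(2) h(2))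
        then have "poly (smult c1 h1) x = poly (p' * map_poly \<phi> u + map_poly \<phi> (rm h p)) x" by simp
        then show ?thesis using that by (simp add: rem_def tr)
      qed
      have e2: "c2 * poly h2 y = poly (map_poly \<psi> (rem h p)) y" if "poly q' y = 0" for y
      proof -
        have "map_poly \<psi> (smult ((lead_coeff p ^ N)\<^sup>2) h) = map_poly \<psi> (p * u + rm h p)" using r(3) by simp
        then have "smult c2 h2 = q' * map_poly \<psi> u + map_poly \<psi> (rm h p)"
          by (simp add: mp' is_homD[OF \<psi>(1)] c2_def p(3) h(3))
        then have "poly (smult c2 h2) y = poly (q' * map_poly \<psi> u + map_poly \<psi> (rm h p)) y" by simp
        moreover have "map_poly \<psi> (rem h p) = map_poly \<psi> (rm h p)"
          unfolding rem_def by (rule tr\<psi>) (rule cs0[OF rE])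
        ultimately show ?thesis using that by simp
      qed
      have "degree (map_poly \<phi> (rem h p)) < degree p'"
        using degrem[OF h(1) p(1) dp1(1)] CB[OF remC] dpp by simp
      moreover have "(map_poly \<phi> (rem h p), map_poly \<psi> (rem h p)) \<in> F" by (rule FI[OF remC])
      ultimately show "\<exists>r1 r2 c1 c2. (r1, r2) \<in> F \<and> degree r1 < degree p' \<and> A.pos c1 \<and> B.pos c2 \<and>
             (\<forall>x. poly p' x = 0 \<longrightarrow> c1 * poly h1 x = poly r1 x) \<and>
             (\<forall>y. poly q' y = 0 \<longrightarrow> c2 * poly h2 y = poly r2 y)"
        using c1 c2 e1 e2 by blast
    qed
    then obtain y where y: "y \<in> B.K" "\<forall>p q. (p, q) \<in> F \<longrightarrow> A.sg (poly p x) = B.sg (poly q y)"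
      using realize_sign_vector x by blast
    have "A.sg (poly (map_poly \<phi> q) x) = B.sg (poly (map_poly \<psi> q) y)" if q: "q \<in> H" for q
    proof -
      have "truncate \<phi> q \<in> C" unfolding C_def by (rule deriv_rem_closure.base) (use q in blast)
      then have "(map_poly \<phi> (truncate \<phi> q), map_poly \<psi> (truncate \<phi> q)) \<in> F" by (rule FI)
      moreover have "map_poly \<psi> (truncate \<phi> q) = map_poly \<psi> q"
        by (rule tr\<psi>) (rule cs0, use q in \<open>auto simp: E_def\<close>)
      ultimately show ?thesis using y(2) by (simp add: tr(1))
    qed
    then show ?thesis using y(1) by blast
  qed
  then show ?thesis using G by (intro exI[of _ G] conjI allI impI ballI) assumption+
qed

end

section \<open>Evaluation of polynomials\<close>

text \<open>
  Evaluation at a point and pairing with a moment sequence are linear extensions of functions on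
  monomials.
\<close>

definition linext :: "('a \<Rightarrow> 'f) \<Rightarrow> ('a \<Rightarrow>\<^sub>0 real) \<Rightarrow> 'f::real_algebra_1" where
  "linext \<phi> p = (\<Sum>\<alpha>\<in>Poly_Mapping.keys p. of_real (Poly_Mapping.lookup p \<alpha>) * \<phi> \<alpha>)"

lemma linext_superset:
  assumes "finite A" "Poly_Mapping.keys p \<subseteq> A"
  shows "linext \<phi> p = (\<Sum>\<alpha>\<in>A. of_real (Poly_Mapping.lookup p \<alpha>) * \<phi> \<alpha>)"
  unfolding linext_def by (rule sum.mono_neutral_left) (use assms in \<open>auto simp: in_keys_iff\<close>)

lemma linext_add: "linext \<phi> (p + q) = linext \<phi> p + linext \<phi> q"
proof -
  let ?A = "Poly_Mapping.keys p \<union> Poly_Mapping.keys q"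
  have "linext \<phi> (p + q) = (\<Sum>\<alpha>\<in>?A. of_real (Poly_Mapping.lookup (p + q) \<alpha>) * \<phi> \<alpha>)"
    by (rule linext_superset) (use keys_add[of p q] in auto)
  also have "\<dots> = linext \<phi> p + linext \<phi> q"
    by (simp add: linext_superset[of ?A] lookup_add distrib_right sum.distrib)
  finally show ?thesis .
qed

lemma linext_zero [simp]: "linext \<phi> 0 = 0" by (simp add: linext_def)

lemma linext_single: "linext \<phi> (Poly_Mapping.single \<alpha> c) = of_real c * \<phi> \<alpha>"
  by (cases "c = 0") (simp_all add: linext_def)

lemma linext_sum: "linext \<phi> (sum g I) = (\<Sum>i\<in>I. linext \<phi> (g i))"
  by (induction I rule: infinite_finite_induct) (simp_all add: linext_add)

lemma sum_of_monomials: "p = (\<Sum>\<alpha>\<in>Poly_Mapping.keys p. Poly_Mapping.single \<alpha> (Poly_Mapping.lookup p \<alpha>))"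
  by (rule poly_mapping_eqI) (simp add: lookup_sum lookup_single when_def in_keys_iff)

lemma times_expand:
  "p * q = (\<Sum>\<alpha>\<in>Poly_Mapping.keys p. \<Sum>\<beta>\<in>Poly_Mapping.keys q.
     Poly_Mapping.single (\<alpha> + \<beta>) (Poly_Mapping.lookup p \<alpha> * Poly_Mapping.lookup q \<beta>))"
  by (subst sum_of_monomials[of p], subst sum_of_monomials[of q])
    (simp only: sum_product mult_single)

lemma linext_mult:
  "linext \<phi> (p * q) = (\<Sum>\<alpha>\<in>Poly_Mapping.keys p. \<Sum>\<beta>\<in>Poly_Mapping.keys q.
     of_real (Poly_Mapping.lookup p \<alpha> * Poly_Mapping.lookup q \<beta>) * \<phi> (\<alpha> + \<beta>))"
  by (subst times_expand) (simp add: linext_sum linext_single)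

definition ev :: "'n::finite rpoly \<Rightarrow> ('n \<Rightarrow> 'f) \<Rightarrow> 'f::real_field" where
  "ev p z = linext (\<lambda>\<alpha>. \<Prod>i\<in>UNIV. z i ^ Poly_Mapping.lookup \<alpha> i) p"

lemma ev_single: "ev (Poly_Mapping.single \<alpha> c) z = of_real c * (\<Prod>i\<in>UNIV. z i ^ Poly_Mapping.lookup \<alpha> i)"
  by (simp add: ev_def linext_single)

lemma ev_hom: "is_hom (\<lambda>p. ev p z)"
  unfolding is_hom_def
proof (intro conjI allI)
  show "ev 1 z = 1"
    by (simp add: ev_single flip: single_one)
  show "ev (p + q) z = ev p z + ev q z" for p q by (simp add: ev_def linext_add)
  show "ev (p * q) z = ev p z * ev q z" for p q
    unfolding ev_def linext_mult unfolding linext_def sum_product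
    by (intro sum.cong refl) (simp add: lookup_add power_add prod.distrib)
qed

lemma ev_real: "peval p x = ev p (\<lambda>i. x $ i)"
  by (simp add: peval_def ev_def linext_def)

definition pvar :: "'n \<Rightarrow> 'n::finite rpoly" where
  "pvar v = Poly_Mapping.single (Poly_Mapping.single v 1) 1"

lemma ev_pconst: "ev (pconst c) z = of_real c"
  by (simp add: pconst_def ev_single)

lemma ev_pvar: "ev (pvar v) z = z v"
proof -
  have "(\<Prod>i\<in>UNIV. z i ^ Poly_Mapping.lookup (Poly_Mapping.single v 1) i) = (\<Prod>i\<in>UNIV. if i = v then z v else 1)"
    by (intro prod.cong) (auto simp: lookup_single when_def)
  then show ?thesis by (simp add: pvar_def ev_single)
qed

lemma pconst_simps: "pconst (a + b) = pconst a + pconst b" "pconst (a - b) = pconst a - pconst b"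
  "pconst (a * b) = pconst a * pconst b" "pconst 1 = 1" "pconst 0 = 0"
  by (simp_all add: pconst_def single_add single_diff mult_single)

lemma pvar_power: "pvar v ^ n = Poly_Mapping.single (Poly_Mapping.single v n) 1"
  by (induction n) (simp_all add: pvar_def mult_single flip: single_add)

lemma monomial_as_product:
  "Poly_Mapping.single \<alpha> c = pconst c * (\<Prod>v\<in>UNIV. pvar v ^ Poly_Mapping.lookup \<alpha> v)"
proof -
  have *: "(\<Prod>v\<in>I. Poly_Mapping.single (g v) (1::real)) = Poly_Mapping.single (sum g I) 1"
    for I and g :: "'a \<Rightarrow> 'a mexp"
    by (induction I rule: infinite_finite_induct) (simp_all add: mult_single)
  have "(\<Sum>v\<in>UNIV. Poly_Mapping.single v (Poly_Mapping.lookup \<alpha> v)) = \<alpha>"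
    by (rule poly_mapping_eqI) (simp add: lookup_sum lookup_single when_def)
  then show ?thesis by (simp add: pvar_power * pconst_def mult_single)
qed

section \<open>Polynomials in some of the variables with coefficients in a ring\<close>

text \<open>
  Adding one variable at a time presents a polynomial in several variables as a polynomial in
  the last variable, and thereby makes the statements on univariate polynomials applicable.
\<close>

primrec poly_subring :: "real set \<Rightarrow> 'n list \<Rightarrow> 'n::finite rpoly set" where
  "poly_subring k [] = pconst ` k"
| "poly_subring k (v # l) = {poly q (pvar v) |q. q \<in> polys_over (poly_subring k l)}"

lemma subring_poly_subring:
  assumes k: "subring_set k"
  shows "subring_set (poly_subring k l)"
proof (induction l)
  case Nil
  have "pconst 1 \<in> poly_subring k []" using subring_setD(2)[OF k] by simp
  moreover have "pconst a - pconst b \<in> poly_subring k [] \<and> pconst a * pconst b \<in> poly_subring k []"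
    if "a \<in> k" "b \<in> k" for a b
    using subring_setD(5,6)[OF k that] by (simp flip: pconst_simps)
  ultimately show ?case by (auto simp: subring_set_def pconst_simps(4))
next
  case (Cons v l)
  note c = polys_over_closed[OF Cons]
  show ?case unfolding subring_set_def
  proof (intro conjI ballI)
    have "1 = poly 1 (pvar v)" by simp
    then show "1 \<in> poly_subring k (v # l)" using c(2) unfolding poly_subring.simps by blast
    fix x y assume "x \<in> poly_subring k (v # l)" "y \<in> poly_subring k (v # l)"
    then obtain p q where pq: "x = poly p (pvar v)" "p \<in> polys_over (poly_subring k l)"
      "y = poly q (pvar v)" "q \<in> polys_over (poly_subring k l)" by auto
    have "x - y = poly (p - q) (pvar v)" "x * y = poly (p * q) (pvar v)" by (simp_all add: pq)
    then show "x - y \<in> poly_subring k (v # l)" "x * y \<in> poly_subring k (v # l)"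
      using c(7,8)[OF pq(2,4)] unfolding poly_subring.simps by blast+
  qed
qed

lemma poly_subring_Cons:
  assumes k: "subring_set k"
  shows "poly_subring k l \<subseteq> poly_subring k (v # l)" "pvar v \<in> poly_subring k (v # l)"
proof -
  note B = subring_poly_subring[OF k, of l]
  show "poly_subring k l \<subseteq> poly_subring k (v # l)"
  proof
    fix x assume "x \<in> poly_subring k l"
    then have "[:x:] \<in> polys_over (poly_subring k l)" by (rule polys_over_closed(3)[OF B])
    moreover have "x = poly [:x:] (pvar v)" by simp
    ultimately show "x \<in> poly_subring k (v # l)" unfolding poly_subring.simps by blast
  qed
  have "[:0, 1:] \<in> polys_over (poly_subring k l)"
    using polys_over_closed(4)[OF B subring_setD(1)[OF B] polys_over_closed(3)[OF B subring_setD(2)[OF B]]] by simp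
  moreover have "pvar v = poly [:0, 1:] (pvar v)" by simp
  ultimately show "pvar v \<in> poly_subring k (v # l)" unfolding poly_subring.simps by blast
qed

lemma poly_subring_generators:
  assumes k: "subring_set k"
  shows "c \<in> k \<Longrightarrow> pconst c \<in> poly_subring k l" "v \<in> set l \<Longrightarrow> pvar v \<in> poly_subring k l"
  by (induction l) (use poly_subring_Cons[OF k] in \<open>auto simp del: poly_subring.simps(2)\<close>)

lemma poly_subring_all:
  assumes k: "subring_set k" and l: "set l = UNIV" and p: "\<And>\<alpha>. Poly_Mapping.lookup p \<alpha> \<in> k"
  shows "p \<in> poly_subring k l"
proof -
  note B = subring_poly_subring[OF k, of l]
  have "(\<Sum>\<alpha>\<in>Poly_Mapping.keys p. Poly_Mapping.single \<alpha> (Poly_Mapping.lookup p \<alpha>)) \<in> poly_subring k l"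
    unfolding monomial_as_product
    by (intro subring_setD(8,6,9,7)[OF B] poly_subring_generators[OF k] p) (simp add: l)
  then show ?thesis using sum_of_monomials[of p] by simp
qed

lemma ev_poly: "ev (poly q x) z = poly (map_poly (\<lambda>c. ev c z) q) (ev x z)"
  by (rule map_poly_hom(5)[OF ev_hom])

lemma map_poly_cong_over:
  assumes "q \<in> polys_over B" "\<And>b. b \<in> B \<Longrightarrow> f b = g b"
  shows "map_poly f q = map_poly g q"
proof (rule map_poly_cong)
  fix c assume "c \<in> set (coeffs q)"
  then have "c \<in> range (coeff q)" by (simp add: range_coeff)
  then show "f c = g c" using assms by (auto simp: polys_over_def)
qed

lemma ev_poly_subring_cong:
  assumes "b \<in> poly_subring k l" "\<And>v. v \<in> set l \<Longrightarrow> z v = z' v"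
  shows "ev b z = ev b z'"
  using assms
proof (induction l arbitrary: b)
  case Nil
  then show ?case by (auto simp: ev_pconst)
next
  case (Cons v l)
  then obtain q where q: "b = poly q (pvar v)" "q \<in> polys_over (poly_subring k l)" by auto
  have "map_poly (\<lambda>c. ev c z) q = map_poly (\<lambda>c. ev c z') q"
    by (rule map_poly_cong_over[OF q(2)]) (use Cons in auto)
  then show ?case using Cons.prems(2) by (simp add: q(1) ev_poly ev_pvar)
qed

lemma countable_polys_over: "countable B \<Longrightarrow> countable (polys_over B)"
proof -
  assume B: "countable B"
  have "polys_over B \<subseteq> Poly ` lists B"
  proof
    fix q assume "q \<in> polys_over B"
    then have "range (coeff q) \<subseteq> B" by (auto simp: polys_over_def)
    then have "coeffs q \<in> lists B" by (auto simp: range_coeff)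
    moreover have "q = Poly (coeffs q)" by simp
    ultimately show "q \<in> Poly ` lists B" by blast
  qed
  then show ?thesis using B by (meson countable_image countable_lists countable_subset)
qed

lemma countable_poly_subring: "countable k \<Longrightarrow> countable (poly_subring k l)"
proof (induction l)
  case (Cons v l)
  have "poly_subring k (v # l) = (\<lambda>q. poly q (pvar v)) ` polys_over (poly_subring k l)" by auto
  then show ?case using Cons countable_polys_over by (metis countable_image)
qed simp

section \<open>Generic points\<close>

definition ideal_set :: "'r::comm_ring_1 set \<Rightarrow> bool" where
  "ideal_set J \<longleftrightarrow> 0 \<in> J \<and> (\<forall>x\<in>J. \<forall>y\<in>J. x + y \<in> J) \<and> (\<forall>x\<in>J. \<forall>r. r * x \<in> J)"

lemma ideal_setD:
  assumes "ideal_set J"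
  shows "0 \<in> J" "x \<in> J \<Longrightarrow> y \<in> J \<Longrightarrow> x + y \<in> J" "x \<in> J \<Longrightarrow> r * x \<in> J" "x \<in> J \<Longrightarrow> x * r \<in> J"
    "x \<in> J \<Longrightarrow> y \<in> J \<Longrightarrow> x - y \<in> J" "(\<And>i. i \<in> I \<Longrightarrow> g i \<in> J) \<Longrightarrow> sum g I \<in> J"
proof -
  note h = assms[unfolded ideal_set_def]
  show z: "0 \<in> J" and a: "x \<in> J \<Longrightarrow> y \<in> J \<Longrightarrow> x + y \<in> J" and "x \<in> J \<Longrightarrow> r * x \<in> J" for x y using h by auto
  show "x \<in> J \<Longrightarrow> x * r \<in> J" using h by (metis mult.commute)
  show "x - y \<in> J" if "x \<in> J" "y \<in> J"
  proof -
    have "- 1 * y \<in> J" using h that by blast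
    then have "x + - 1 * y \<in> J" using h that by blast
    then show ?thesis by simp
  qed
  show "(\<And>i. i \<in> I \<Longrightarrow> g i \<in> J) \<Longrightarrow> sum g I \<in> J"
    by (induction I rule: infinite_finite_induct) (use h in auto)
qed

lemma poly_in_ideal:
  assumes "ideal_set J" "\<And>i. coeff q i \<in> J"
  shows "poly q x \<in> J"
  unfolding poly_altdef by (rule ideal_setD(6)[OF assms(1)], rule ideal_setD(4)[OF assms(1)], rule assms(2))

text \<open>
  Sending $x$ to $\zeta$ is to extend \<open>\<phi>\<close> in such a way that the kernel still
  is given by \<open>J\<close>. If every polynomial relation of \<open>x\<close> modulo
  \<open>J\<close> is trivial, then $\zeta$ has to be transcendental over the image of
  \<open>B\<close>, and it exists since that image is countable. Otherwise $\zeta$ is a root of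
  a nontrivial relation \<open>m\<close> of minimal degree, and the point is that a polynomial
  \<open>r\<close> of minimal degree that vanishes at $\zeta$ is itself a relation, because it
  divides \<open>m\<close> up to a factor from \<open>B\<close> and \<open>J\<close> is prime.
\<close>

lemma extend_generic_point:
  fixes \<phi> :: "'r::comm_ring_1 \<Rightarrow> complex"
  assumes hom: "is_hom \<phi>" and B: "subring_set B" "countable B"
    and J: "ideal_set J" and prime: "\<And>a b. a * b \<in> J \<Longrightarrow> a \<in> J \<or> b \<in> J"
    and ker: "\<And>b. b \<in> B \<Longrightarrow> \<phi> b = 0 \<longleftrightarrow> b \<in> J"
  shows "\<exists>\<zeta>. \<forall>q\<in>polys_over B. poly (map_poly \<phi> q) \<zeta> = 0 \<longleftrightarrow> poly q x \<in> J"
proof -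
  note mp = map_poly_hom[OF hom] and cl = polys_over_closed[OF B(1)] and tr = truncate_properties[OF hom]
  have zeroJ: "poly q x \<in> J" if "q \<in> polys_over B" "map_poly \<phi> q = 0" for q
  proof (rule poly_in_ideal[OF J])
    fix i
    have "\<phi> (coeff q i) = 0" using mp(1)[of q i] that(2) by simp
    then show "coeff q i \<in> J" using ker polys_overD[OF that(1)] by blast
  qed
  have trJ: "poly (truncate \<phi> q) x \<in> J \<longleftrightarrow> poly q x \<in> J" if "q \<in> polys_over B" for q
  proof -
    have "map_poly \<phi> (q - truncate \<phi> q) = 0"
    proof -
      have "map_poly \<phi> (q - truncate \<phi> q) = map_poly \<phi> q - map_poly \<phi> (truncate \<phi> q)"
        by (rule poly_eqI) (simp add: mp(1) is_homD(6)[OF hom])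
      then show ?thesis by (simp add: tr(1))
    qed
    then have d: "poly (q - truncate \<phi> q) x \<in> J" using zeroJ cl(7)[OF that tr(3)[OF B(1) that]] by blast
    show ?thesis
    proof
      assume "poly q x \<in> J"
      then have "poly q x - poly (q - truncate \<phi> q) x \<in> J" by (rule ideal_setD(5)[OF J _ d])
      then show "poly (truncate \<phi> q) x \<in> J" by simp
    next
      assume "poly (truncate \<phi> q) x \<in> J"
      then have "poly (q - truncate \<phi> q) x + poly (truncate \<phi> q) x \<in> J" by (rule ideal_setD(2)[OF J d])
      then show "poly q x \<in> J" by simp
    qed
  qed
  define S where "S = (\<lambda>q. q \<in> polys_over B \<and> poly q x \<in> J \<and> map_poly \<phi> q \<noteq> 0)"
  show ?thesis
  proof (cases "\<exists>q. S q")
    case False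
    have "countable (\<Union>q\<in>{q\<in>polys_over B. map_poly \<phi> q \<noteq> 0}. {\<zeta>. poly (map_poly \<phi> q) \<zeta> = 0})"
      by (intro countable_UN countable_subset[OF _ countable_polys_over[OF B(2)]] countable_finite poly_roots_finite) auto
    then have "(\<Union>q\<in>{q\<in>polys_over B. map_poly \<phi> q \<noteq> 0}. {\<zeta>. poly (map_poly \<phi> q) \<zeta> = 0}) \<noteq> UNIV"
      using uncountable_UNIV_complex by metis
    then obtain \<zeta> where z: "\<And>q. q \<in> polys_over B \<Longrightarrow> map_poly \<phi> q \<noteq> 0 \<Longrightarrow> poly (map_poly \<phi> q) \<zeta> \<noteq> 0" by blast
    have "poly (map_poly \<phi> q) \<zeta> = 0 \<longleftrightarrow> poly q x \<in> J" if "q \<in> polys_over B" for q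
    proof (cases "map_poly \<phi> q = 0")
      case True
      then show ?thesis using zeroJ that by simp
    next
      case q: False
      then show ?thesis using z that False by (auto simp: S_def)
    qed
    then show ?thesis by blast
  next
    case True
    define m where "m = arg_min (\<lambda>q. degree (map_poly \<phi> q)) S"
    have Sm: "S m" and mmin: "\<And>q. S q \<Longrightarrow> degree (map_poly \<phi> m) \<le> degree (map_poly \<phi> q)"
      using True arg_min_nat_lemma[of S _ "\<lambda>q. degree (map_poly \<phi> q)"] unfolding m_def by blast+
    have m: "m \<in> polys_over B" "poly m x \<in> J" "map_poly \<phi> m \<noteq> 0" using Sm by (auto simp: S_def)
    have "degree (map_poly \<phi> m) \<noteq> 0"
    proof
      assume d0: "degree (map_poly \<phi> m) = 0"
      then have dt: "degree (truncate \<phi> m) = 0" using tr(2) by simp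
      then obtain c where c: "truncate \<phi> m = [:c:]" by (metis degree_eq_zeroE)
      have "c \<in> B" using polys_overD[OF tr(3)[OF B(1) m(1)], of 0] c by simp
      moreover have "c \<in> J" using trJ[OF m(1)] m(2) c by simp
      ultimately have "\<phi> c = 0" using ker by blast
      then have "map_poly \<phi> (truncate \<phi> m) = 0" by (intro poly_eqI) (simp add: mp(1) c coeff_pCons is_homD(2)[OF hom] split: nat.split)
      then show False using tr(1) m(3) by simp
    qed
    then obtain \<zeta> where z: "poly (map_poly \<phi> m) \<zeta> = 0"
      using fundamental_theorem_of_algebra[of "map_poly \<phi> m"] by (metis constant_degree)
    define W where "W = (\<lambda>q. q \<in> polys_over B \<and> poly (map_poly \<phi> q) \<zeta> = 0 \<and> map_poly \<phi> q \<noteq> 0)"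
    have Wm: "W m" using m z by (simp add: W_def)
    define r0 where "r0 = arg_min (\<lambda>q. degree (map_poly \<phi> q)) W"
    have Wr0: "W r0" and rmin0: "\<And>q. W q \<Longrightarrow> degree (map_poly \<phi> r0) \<le> degree (map_poly \<phi> q)"
      using Wm arg_min_nat_lemma[of W _ "\<lambda>q. degree (map_poly \<phi> q)"] unfolding r0_def by blast+
    define r where "r = truncate \<phi> r0"
    have r: "r \<in> polys_over B" "map_poly \<phi> r = map_poly \<phi> r0" "degree (map_poly \<phi> r) = degree r"
      using tr B(1) Wr0 by (auto simp: r_def W_def)
    have Wr: "poly (map_poly \<phi> r) \<zeta> = 0" "map_poly \<phi> r \<noteq> 0" using Wr0 r(2) by (auto simp: W_def)
    have rmin: "degree r \<le> degree (map_poly \<phi> q)" if "W q" for q using rmin0[OF that] r by simp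
    have r_ne: "r \<noteq> 0" using Wr(2) is_homD(2)[OF hom] by auto
    define c where "c = lead_coeff r"
    have cB: "c \<in> B" unfolding c_def by (rule polys_overD[OF r(1)])
    have "\<phi> c \<noteq> 0" using Wr(2) unfolding c_def r(3)[symmetric] by (simp flip: mp(1) add: leading_coeff_0_iff)
    then have cJ: "c ^ N \<notin> J" for N
      using ker[OF subring_setD(7)[OF B(1) cB]] by (simp add: is_homD(7)[OF hom])
    have "degree r \<noteq> 0"
      using Wr r(3) by (metis degree_eq_zeroE mult_zero_right pCons_0_0 poly_0 poly_pCons add_0_right)
    have divide: "\<exists>N u w. u \<in> polys_over B \<and> w \<in> polys_over B \<and> smult (c ^ N) q = r * u + w \<and> (w = 0 \<or> degree w < degree r)"
      if "q \<in> polys_over B" for q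
      using pseudo_division[OF B(1) r(1) r_ne that] unfolding c_def by blast
    have small: "map_poly \<phi> w = 0" if "w \<in> polys_over B" "w = 0 \<or> degree w < degree r" "poly (map_poly \<phi> w) \<zeta> = 0" for w
    proof (rule ccontr)
      assume "map_poly \<phi> w \<noteq> 0"
      then have "W w" using that by (simp add: W_def)
      then have "degree r \<le> degree w" using rmin degree_map_poly_hom[OF hom, of w] by fastforce
      then show False using that(2) \<open>map_poly \<phi> w \<noteq> 0\<close> is_homD(2)[OF hom] by auto
    qed
    have rJ: "poly r x \<in> J"
    proof -
      obtain N u w where d: "u \<in> polys_over B" "w \<in> polys_over B" "smult (c ^ N) m = r * u + w" "w = 0 \<or> degree w < degree r"
        using divide[OF m(1)] by blast
      have e: "smult (\<phi> c ^ N) (map_poly \<phi> m) = map_poly \<phi> r * map_poly \<phi> u + map_poly \<phi> w"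
        using arg_cong[OF d(3), of "map_poly \<phi>"] by (simp add: mp is_homD(7)[OF hom])
      have "poly (map_poly \<phi> w) \<zeta> = 0" using arg_cong[OF e, of "\<lambda>p. poly p \<zeta>"] z Wr by simp
      then have w0: "map_poly \<phi> w = 0" using small d by blast
      have "poly r x * poly u x = c ^ N * poly m x - poly w x"
        using arg_cong[OF d(3), of "\<lambda>p. poly p x"] by simp
      moreover have "c ^ N * poly m x - poly w x \<in> J"
        by (rule ideal_setD(5)[OF J ideal_setD(3)[OF J m(2)] zeroJ[OF d(2) w0]])
      ultimately have "poly r x * poly u x \<in> J" by simp
      then have "poly r x \<in> J \<or> poly u x \<in> J" by (rule prime)
      moreover have "poly u x \<notin> J"
      proof
        assume uJ: "poly u x \<in> J"
        have e': "smult (\<phi> c ^ N) (map_poly \<phi> m) = map_poly \<phi> r * map_poly \<phi> u" using e w0 by simp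
        then have u0: "map_poly \<phi> u \<noteq> 0" using m(3) \<open>\<phi> c \<noteq> 0\<close> by auto
        then have "S u" using uJ d by (simp add: S_def)
        moreover have "degree (map_poly \<phi> m) = degree r + degree (map_poly \<phi> u)"
          using arg_cong[OF e', of degree] \<open>\<phi> c \<noteq> 0\<close> u0 Wr(2) r(3) by (simp add: degree_mult_eq)
        ultimately show False using mmin[of u] \<open>degree r \<noteq> 0\<close> by simp
      qed
      ultimately show ?thesis by blast
    qed
    have degm: "degree (map_poly \<phi> m) \<le> degree r" using mmin[of r] rJ r Wr by (simp add: S_def)
    have "poly (map_poly \<phi> q) \<zeta> = 0 \<longleftrightarrow> poly q x \<in> J" if q: "q \<in> polys_over B" for q
    proof -
      obtain N u w where d: "u \<in> polys_over B" "w \<in> polys_over B" "smult (c ^ N) q = r * u + w" "w = 0 \<or> degree w < degree r"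
        using divide[OF q] by blast
      have e: "smult (\<phi> c ^ N) (map_poly \<phi> q) = map_poly \<phi> r * map_poly \<phi> u + map_poly \<phi> w"
        using arg_cong[OF d(3), of "map_poly \<phi>"] by (simp add: mp is_homD(7)[OF hom])
      have 1: "poly (map_poly \<phi> q) \<zeta> = 0 \<longleftrightarrow> poly (map_poly \<phi> w) \<zeta> = 0"
        using arg_cong[OF e, of "\<lambda>p. poly p \<zeta>"] Wr \<open>\<phi> c \<noteq> 0\<close> by auto
      have ex: "c ^ N * poly q x = poly r x * poly u x + poly w x"
        using arg_cong[OF d(3), of "\<lambda>p. poly p x"] by simp
      have 2: "poly q x \<in> J \<longleftrightarrow> poly w x \<in> J"
      proof
        assume "poly q x \<in> J"
        then have "c ^ N * poly q x - poly r x * poly u x \<in> J" 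
          by (rule ideal_setD(5)[OF J ideal_setD(3)[OF J] ideal_setD(4)[OF J rJ]])
        then show "poly w x \<in> J" by (simp add: ex)
      next
        assume "poly w x \<in> J"
        then have "c ^ N * poly q x \<in> J" unfolding ex
          by (rule ideal_setD(2)[OF J ideal_setD(4)[OF J rJ]])
        then have "c ^ N \<in> J \<or> poly q x \<in> J" by (rule prime)
        then show "poly q x \<in> J" using cJ by blast
      qed
      have 3: "poly w x \<in> J \<longleftrightarrow> map_poly \<phi> w = 0"
      proof
        assume wJ: "poly w x \<in> J"
        show "map_poly \<phi> w = 0"
        proof (rule ccontr)
          assume w: "map_poly \<phi> w \<noteq> 0"
          then have "S w" using wJ d by (simp add: S_def)
          then have "degree (map_poly \<phi> m) \<le> degree w" using mmin degree_map_poly_hom[OF hom, of w] by fastforce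
          moreover have "degree r \<le> degree (map_poly \<phi> m)" using rmin Wm by blast
          ultimately show False using d(4) w is_homD(2)[OF hom] by auto
        qed
      qed (use zeroJ d in blast)
      show ?thesis using 1 2 3 small[OF d(2,4)] by auto
    qed
    then show ?thesis by blast
  qed
qed

lemma generic_point_exists:
  assumes k: "subring_set k" "countable k"
    and J: "ideal_set J" "1 \<notin> J" and prime: "\<And>a b. a * b \<in> J \<Longrightarrow> a \<in> J \<or> b \<in> J"
  shows "distinct l \<Longrightarrow> \<exists>z. \<forall>b\<in>poly_subring k l. ev b z = (0::complex) \<longleftrightarrow> b \<in> J"
proof (induction l)
  case Nil
  have "pconst c \<in> J \<longleftrightarrow> c = 0" for c
  proof
    assume c: "pconst c \<in> J"
    show "c = 0"
    proof (rule ccontr)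
      assume "c \<noteq> 0"
      then have "pconst (inverse c) * pconst c = 1" by (simp flip: pconst_simps)
      then show False using ideal_setD(3)[OF J(1) c] J(2) by metis
    qed
  qed (use ideal_setD(1)[OF J(1)] in \<open>simp add: pconst_simps\<close>)
  then show ?case by (auto simp: ev_pconst)
next
  case (Cons v l)
  then obtain z :: "'a \<Rightarrow> complex" where z: "\<And>b. b \<in> poly_subring k l \<Longrightarrow> ev b z = 0 \<longleftrightarrow> b \<in> J" by auto
  have "\<exists>\<zeta>. \<forall>q\<in>polys_over (poly_subring k l).
      poly (map_poly (\<lambda>b. ev b z) q) \<zeta> = 0 \<longleftrightarrow> poly q (pvar v) \<in> J"
    by (rule extend_generic_point[OF ev_hom subring_poly_subring[OF k(1)] countable_poly_subring[OF k(2)] J(1)])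
      (use prime z in blast)+
  then obtain \<zeta> where \<zeta>: "\<And>q. q \<in> polys_over (poly_subring k l) \<Longrightarrow>
      poly (map_poly (\<lambda>b. ev b z) q) \<zeta> = 0 \<longleftrightarrow> poly q (pvar v) \<in> J" by blast
  have "ev b (z(v := \<zeta>)) = 0 \<longleftrightarrow> b \<in> J" if b: "b \<in> poly_subring k (v # l)" for b
  proof -
    obtain q where q: "b = poly q (pvar v)" "q \<in> polys_over (poly_subring k l)" using b by auto
    have "map_poly (\<lambda>c. ev c (z(v := \<zeta>))) q = map_poly (\<lambda>c. ev c z) q"
      by (rule map_poly_cong_over[OF q(2)], rule ev_poly_subring_cong) (use Cons.prems in auto)
    then show ?thesis using \<zeta>[OF q(2)] by (simp add: q(1) ev_poly ev_pvar)
  qed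
  then show ?case by blast
qed

section \<open>Transfer to the real numbers\<close>

lemma ordered_reals: "ordered_subfield {0::real..}"
  by unfold_locales auto

lemma ordered_reals_simps:
  "ordered_subfield.pos {0::real..} x \<longleftrightarrow> x > 0" "ordered_subfield.K {0::real..} = UNIV"
  using ordered_subfield.pos_def[OF ordered_reals] ordered_subfield.in_K[OF ordered_reals] by (auto simp: less_le)

lemma real_closed_reals: "real_closed_subfield {0::real..}"
proof (rule real_closed_subfield.intro[OF ordered_reals], unfold_locales)
  fix p :: "real poly" and a b
  assume "ordered_subfield.pos {0..} (b - a)" "ordered_subfield.pos {0..} (- (poly p a * poly p b))"
  then show "\<exists>c\<in>ordered_subfield.K {0..}. ordered_subfield.pos {0..} (c - a) \<and> ordered_subfield.pos {0..} (b - c) \<and> poly p c = 0"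
    using poly_IVT[of a b p] by (auto simp: ordered_reals_simps)
qed

context maximal_preorder
begin

lemma two_real_closed_reals: "two_real_closed T {0::real..}"
  by (rule two_real_closed.intro[OF _ real_closed_reals]) (unfold_locales, rule intermediate_value)

lemma ev_in_K:
  assumes k: "subring_set k" "\<And>c. c \<in> k \<Longrightarrow> 0 \<le> c \<Longrightarrow> of_real c \<in> T"
    and z: "\<And>v. z v \<in> K" and b: "b \<in> poly_subring k l"
  shows "ev b z \<in> K"
  using b
proof (induction l arbitrary: b)
  case Nil
  then obtain c where c: "b = pconst c" "c \<in> k" by auto
  show ?case
  proof (cases "0 \<le> c")
    case True
    then show ?thesis using k(2) c by (simp add: ev_pconst T_K)
  next
    case False
    then have "of_real (- c) \<in> T" using k(2)[OF subring_setD(3)[OF k(1) c(2)]] by simp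
    then show ?thesis by (simp add: c ev_pconst in_K)
  qed
next
  case (Cons v l)
  then obtain q where q: "b = poly q (pvar v)" "q \<in> polys_over (poly_subring k l)" by auto
  have "map_poly (\<lambda>c. ev c z) q \<in> polys_over K"
    by (rule map_poly_polys_over[OF ev_hom q(2)]) (rule Cons.IH)
  then show ?case using K_polys(12) z by (simp add: q(1) ev_poly ev_pvar)
qed

text \<open>
  The principle of Artin and Lang: a finite system of sign conditions that holds at a point of
  the maximal ordered field holds at some real point. The coordinates of the real point are
  found one after the other by \<open>sign_family\<close>. For constants there is nothing to do,
  since the ordering of $K$ extends that of \<open>k\<close>.
\<close>

lemma transfer_to_reals:
  fixes z :: "'n::finite \<Rightarrow> complex"
  assumes k: "subring_set k" "\<And>c. c \<in> k \<Longrightarrow> 0 \<le> c \<Longrightarrow> of_real c \<in> T"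
    and z: "\<And>v. z v \<in> K"
  shows "distinct l \<Longrightarrow> finite G \<Longrightarrow> G \<subseteq> poly_subring k l \<Longrightarrow>
    \<exists>a :: 'n \<Rightarrow> real. \<forall>g\<in>G. sg (ev g z) = ordered_subfield.sg {0..} (ev g a)"
proof (induction l arbitrary: G)
  case Nil
  interpret R: ordered_subfield "{0::real..}" by (rule ordered_reals)
  have "sg (of_real c) = R.sg c" if "c \<in> k" for c
  proof (cases "0 \<le> c")
    case True
    then show ?thesis using k(2)[OF that] by (simp add: sg_def R.sg_def)
  next
    case False
    then have "of_real (- c) \<in> T" using k(2)[OF subring_setD(3)[OF k(1) that]] by simp
    then have "pos (- of_real c)" using False by (simp add: pos_def)
    then have "sg (of_real c) = - 1" using sg_neg[of "of_real c"] pos_K K_closed(3)[of "- of_real c"] by auto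
    then show ?thesis using False by (simp add: R.sg_def)
  qed
  then show ?case using Nil by (intro exI[of _ "\<lambda>_. 0"]) (auto simp: ev_pconst)
next
  case (Cons v l)
  interpret TR: two_real_closed T "{0::real..}" by (rule two_real_closed_reals)
  note B = subring_poly_subring[OF k(1), of l]
  have "\<forall>g\<in>G. \<exists>q. g = poly q (pvar v) \<and> q \<in> polys_over (poly_subring k l)" using Cons.prems(3) by auto
  then obtain qf where qf: "\<And>g. g \<in> G \<Longrightarrow> g = poly (qf g) (pvar v)" "\<And>g. g \<in> G \<Longrightarrow> qf g \<in> polys_over (poly_subring k l)"
    by metis
  have "\<exists>G'\<subseteq>poly_subring k l. finite G' \<and> (\<forall>\<psi>. is_hom \<psi> \<longrightarrow> (\<forall>b\<in>poly_subring k l. \<psi> b \<in> TR.B.K) \<longrightarrow>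
      (\<forall>g\<in>G'. sg (ev g z) = TR.B.sg (\<psi> g)) \<longrightarrow> (\<forall>x\<in>K. \<exists>y\<in>TR.B.K. \<forall>q\<in>qf ` G.
        sg (poly (map_poly (\<lambda>b. ev b z) q) x) = TR.B.sg (poly (map_poly \<psi> q) y)))"
    by (rule TR.sign_family[OF B ev_hom]) (use ev_in_K[OF k z] Cons.prems qf(2) in auto)
  then obtain G' where G': "G' \<subseteq> poly_subring k l" "finite G'"
    and tr: "\<And>\<psi> x. is_hom \<psi> \<Longrightarrow> \<forall>b\<in>poly_subring k l. \<psi> b \<in> TR.B.K \<Longrightarrow> \<forall>g\<in>G'. sg (ev g z) = TR.B.sg (\<psi> g) \<Longrightarrow>
      x \<in> K \<Longrightarrow> \<exists>y\<in>TR.B.K. \<forall>q\<in>qf ` G. sg (poly (map_poly (\<lambda>b. ev b z) q) x) = TR.B.sg (poly (map_poly \<psi> q) y)"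
    by metis
  obtain a :: "'n \<Rightarrow> real" where a: "\<forall>g\<in>G'. sg (ev g z) = TR.B.sg (ev g a)"
    using Cons.IH[OF _ G'(2,1)] Cons.prems(1) by auto
  obtain y where y: "\<And>q. q \<in> qf ` G \<Longrightarrow> sg (poly (map_poly (\<lambda>b. ev b z) q) (z v)) = TR.B.sg (poly (map_poly (\<lambda>b. ev b a) q) y)"
    using tr[OF ev_hom _ a z[of v]] by (auto simp: ordered_reals_simps)
  have "sg (ev g z) = TR.B.sg (ev g (a(v := y)))" if g: "g \<in> G" for g
  proof -
    have "map_poly (\<lambda>c. ev c (a(v := y))) (qf g) = map_poly (\<lambda>c. ev c a) (qf g)"
      by (rule map_poly_cong_over[OF qf(2)[OF g]], rule ev_poly_subring_cong) (use Cons.prems in auto)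
    then have "ev g (a(v := y)) = poly (map_poly (\<lambda>b. ev b a) (qf g)) y"
      by (subst qf(1)[OF g]) (simp add: ev_poly ev_pvar)
    moreover have "ev g z = poly (map_poly (\<lambda>b. ev b z) (qf g)) (z v)"
      by (subst qf(1)[OF g]) (simp add: ev_poly ev_pvar)
    ultimately show ?thesis using y g by simp
  qed
  then show ?case by blast
qed

end

section \<open>Real ideals and the real Nullstellensatz\<close>

definition real_ideal :: "'r::comm_ring_1 set \<Rightarrow> bool" where
  "real_ideal J \<longleftrightarrow> ideal_set J \<and> (\<forall>qs. (\<Sum>q\<leftarrow>qs. q\<^sup>2) \<in> J \<longrightarrow> set qs \<subseteq> J)"

lemma sum_squares_scaled: "(\<Sum>q\<leftarrow>map ((*) a) qs. q\<^sup>2) = a\<^sup>2 * (\<Sum>q\<leftarrow>qs. (q::'r::comm_ring_1)\<^sup>2)"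
  by (induction qs) (simp_all add: algebra_simps power_mult_distrib)

text \<open>
  If $a \sum_i q_i^2$ is in $J$, then so is $\sum_i (a q_i)^2$.
\<close>

lemma real_ideal_colon:
  assumes "real_ideal J"
  shows "real_ideal {x. a * x \<in> J}"
proof -
  have J: "ideal_set J" using assms by (simp add: real_ideal_def)
  have "ideal_set {x. a * x \<in> J}"
    unfolding ideal_set_def using ideal_setD(1)[OF J] ideal_setD(2)[OF J] ideal_setD(3)[OF J]
    by (auto simp: distrib_left mult.left_commute)
  moreover have "set qs \<subseteq> {x. a * x \<in> J}" if "a * (\<Sum>q\<leftarrow>qs. q\<^sup>2) \<in> J" for qs
  proof -
    have "a * (a * (\<Sum>q\<leftarrow>qs. q\<^sup>2)) \<in> J" by (rule ideal_setD(3)[OF J that])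
    then have "(\<Sum>q\<leftarrow>map ((*) a) qs. q\<^sup>2) \<in> J"
      unfolding sum_squares_scaled by (simp add: power2_eq_square mult.assoc)
    then have "set (map ((*) a) qs) \<subseteq> J" using assms unfolding real_ideal_def by blast
    then show ?thesis by auto
  qed
  ultimately show ?thesis by (auto simp: real_ideal_def)
qed

text \<open>
  Among the real ideals above \<open>J\<close> that avoid \<open>p\<close>, let \<open>M\<close>
  be maximal. The colon ideals of \<open>M\<close> are real, so each of them contains
  \<open>p\<close> or equals \<open>M\<close>. Since $p^2 \notin M$, the colon ideal of $p$ is
  $M$, and primality follows.
\<close>

lemma prime_real_ideal_exists:
  assumes J: "real_ideal J" "p \<notin> J"
  obtains M where "real_ideal M" "J \<subseteq> M" "p \<notin> M" "\<And>a b. a * b \<in> M \<Longrightarrow> a \<in> M \<or> b \<in> M"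
proof -
  define A where "A = {M. real_ideal M \<and> J \<subseteq> M \<and> p \<notin> M}"
  have "\<exists>M\<in>A. \<forall>X\<in>A. M \<subseteq> X \<longrightarrow> X = M"
  proof (rule subset_Zorn_nonempty)
    show "A \<noteq> {}" using J by (auto simp: A_def)
    fix C assume C: "C \<noteq> {}" "subset.chain A C"
    have each: "real_ideal S" "ideal_set S" "J \<subseteq> S" "p \<notin> S" if "S \<in> C" for S
      using C that by (auto simp: subset_chain_def A_def real_ideal_def)
    have two: "\<exists>S\<in>C. x \<in> S \<and> y \<in> S" if "x \<in> \<Union>C" "y \<in> \<Union>C" for x y
    proof -
      obtain S1 S2 where "S1 \<in> C" "x \<in> S1" "S2 \<in> C" "y \<in> S2" using \<open>x \<in> \<Union>C\<close> \<open>y \<in> \<Union>C\<close> by blast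
      then show ?thesis using C(2) by (metis subset_chain_def subsetD)
    qed
    have "ideal_set (\<Union>C)"
      unfolding ideal_set_def
    proof (intro conjI ballI allI)
      show "0 \<in> \<Union>C" using C(1) each(2) ideal_setD(1) by blast
      show "x + y \<in> \<Union>C" if xy: "x \<in> \<Union>C" "y \<in> \<Union>C" for x y
      proof -
        obtain S where S: "S \<in> C" "x \<in> S" "y \<in> S" using two[OF xy] by blast
        then show ?thesis using ideal_setD(2)[OF each(2)[OF S(1)] S(2,3)] by blast
      qed
      show "r * x \<in> \<Union>C" if x: "x \<in> \<Union>C" for x r
      proof -
        obtain S where S: "S \<in> C" "x \<in> S" using x by blast
        then show ?thesis using ideal_setD(3)[OF each(2)[OF S(1)] S(2)] by blast
      qed
    qed
    moreover have "set qs \<subseteq> \<Union>C" if "(\<Sum>q\<leftarrow>qs. q\<^sup>2) \<in> \<Union>C" for qs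
      using that each(1) unfolding real_ideal_def by blast
    moreover have "J \<subseteq> \<Union>C" using C(1) each(3) by blast
    moreover have "p \<notin> \<Union>C" using each(4) by blast
    ultimately show "\<Union>C \<in> A" by (simp add: A_def real_ideal_def)
  qed
  then obtain M where "M \<in> A" and max: "\<And>X. X \<in> A \<Longrightarrow> M \<subseteq> X \<Longrightarrow> X = M" by blast
  then have M: "real_ideal M" "J \<subseteq> M" "p \<notin> M" by (auto simp: A_def)
  have I: "ideal_set M" using M(1) by (simp add: real_ideal_def)
  have colon: "{x. a * x \<in> M} = M" if "a * p \<notin> M" for a
  proof (rule max)
    have "M \<subseteq> {x. a * x \<in> M}" using ideal_setD(3)[OF I] by blast
    then show "{x. a * x \<in> M} \<in> A" "M \<subseteq> {x. a * x \<in> M}"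
      using that M(2) real_ideal_colon[OF M(1)] by (auto simp: A_def)
  qed
  have "p * p \<notin> M"
  proof
    assume "p * p \<in> M"
    then have "(\<Sum>q\<leftarrow>[p]. q\<^sup>2) \<in> M" by (simp add: power2_eq_square)
    then have "set [p] \<subseteq> M" using M(1) unfolding real_ideal_def by blast
    then show False using M(3) by simp
  qed
  then have pc: "{x. p * x \<in> M} = M" by (rule colon)
  have "a \<in> M \<or> b \<in> M" if ab: "a * b \<in> M" for a b
  proof (cases "a * p \<in> M")
    case True
    then have "a \<in> {x. p * x \<in> M}" by (simp add: mult.commute)
    then show ?thesis using pc by blast
  next
    case False
    then show ?thesis using colon[OF False] ab by blast
  qed
  then show ?thesis using that M by blast
qed

lemma countable_subring_exists:
  fixes S :: "'r::comm_ring_1 set"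
  assumes "countable S"
  obtains k where "subring_set k" "countable k" "S \<subseteq> k"
proof -
  define step where "step = (\<lambda>X::'r set. X \<union> (\<lambda>(x, y). x - y) ` (X \<times> X) \<union> (\<lambda>(x, y). x * y) ` (X \<times> X))"
  define X where "X = (\<lambda>n. (step ^^ n) (insert 1 S))"
  have Suc: "X (Suc n) = step (X n)" for n by (simp add: X_def)
  have mono: "X m \<subseteq> X n" if "m \<le> n" for m n
    by (rule lift_Suc_mono_le[OF _ that]) (auto simp: Suc step_def)
  have "countable (X n)" for n
  proof (induction n)
    case 0
    then show ?case using assms by (simp add: X_def)
  next
    case (Suc n)
    then show ?case unfolding \<open>X (Suc n) = step (X n)\<close> step_def by (intro countable_Un countable_image countable_SIGMA)
  qed
  then have "countable (\<Union>n. X n)" by blast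
  moreover have "subring_set (\<Union>n. X n)"
    unfolding subring_set_def
  proof (intro conjI ballI)
    have "1 \<in> X 0" by (simp add: X_def)
    then show "1 \<in> (\<Union>n. X n)" by blast
    fix x y assume "x \<in> (\<Union>n. X n)" "y \<in> (\<Union>n. X n)"
    then obtain m n where "x \<in> X m" "y \<in> X n" by blast
    then have xy: "(x, y) \<in> X (max m n) \<times> X (max m n)" using mono[of m "max m n"] mono[of n "max m n"] by auto
    have "(\<lambda>(x, y). x - y) (x, y) \<in> X (Suc (max m n))" "(\<lambda>(x, y). x * y) (x, y) \<in> X (Suc (max m n))"
      unfolding Suc step_def using imageI[OF xy] by blast+
    then show "x - y \<in> (\<Union>n. X n)" "x * y \<in> (\<Union>n. X n)" by auto
  qed
  moreover have "S \<subseteq> (\<Union>n. X n)"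
  proof -
    have "S \<subseteq> X 0" by (auto simp: X_def)
    then show ?thesis by blast
  qed
  ultimately show ?thesis using that by blast
qed

lemma SOS_square: "SOS (q\<^sup>2)"
  unfolding SOS_def by (intro exI[of _ "[q]"]) simp

lemma SOS_add: "SOS p \<Longrightarrow> SOS q \<Longrightarrow> SOS (p + q)"
  unfolding SOS_def
proof (elim exE)
  fix ps qs assume "p = (\<Sum>q\<leftarrow>ps. q\<^sup>2)" "q = (\<Sum>q\<leftarrow>qs. q\<^sup>2)"
  then show "\<exists>qs. p + q = (\<Sum>q\<leftarrow>qs. q\<^sup>2)" by (intro exI[of _ "ps @ qs"]) simp
qed

lemma SOS_mult: assumes "SOS p" "SOS q" shows "SOS (p * q)"
proof -
  have sq: "SOS (a\<^sup>2 * q)" for a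
    using assms(2) unfolding SOS_def by (metis sum_squares_scaled)
  obtain ps where "p = (\<Sum>q\<leftarrow>ps. q\<^sup>2)" using assms(1) SOS_def by auto
  moreover have "SOS ((\<Sum>q\<leftarrow>ps. q\<^sup>2) * q)"
  proof (induction ps)
    case Nil
    then show ?case unfolding SOS_def by (intro exI[of _ "[]"]) simp
  next
    case (Cons a ps)
    then show ?case using SOS_add[OF sq[of a] Cons] by (simp add: distrib_right)
  qed
  ultimately show ?thesis by simp
qed

text \<open>
  Suppose that $p \notin J$, and enlarge $J$ to a real prime ideal $M$ that avoids $p$. A
  generic complex point $z$ of $M$ realizes the residue ring of $M$ (with coefficients in a
  countable ring $k$) inside of $\mathbb{C}$, and the quotients of sums of squares by nonzero
  squares form a preordering there because $M$ is real. In a maximal ordering above it, $F(z) =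
  0$ and $p(z) \ne 0$. Transfer gives a real point with the same two signs, against the
  assumption.
\<close>

theorem real_nullstellensatz:
  fixes F p :: "'n::finite rpoly"
  assumes J: "real_ideal J" and F: "F \<in> J" and zeros: "\<And>x. peval F x = 0 \<Longrightarrow> peval p x = 0"
  shows "p \<in> J"
proof (rule ccontr)
  assume "p \<notin> J"
  then obtain M where M: "real_ideal M" "J \<subseteq> M" "p \<notin> M" and prime: "\<And>a b. a * b \<in> M \<Longrightarrow> a \<in> M \<or> b \<in> M"
    using prime_real_ideal_exists[OF J] by metis
  have I: "ideal_set M" using M(1) by (simp add: real_ideal_def)
  have one: "1 \<notin> M" using ideal_setD(3)[OF I, of 1 p] M(3) by auto
  have "countable (range (Poly_Mapping.lookup F) \<union> range (Poly_Mapping.lookup p))"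
  proof -
    have "countable (range (Poly_Mapping.lookup q))" for q :: "'n rpoly"
    proof (rule countable_subset)
      show "range (Poly_Mapping.lookup q) \<subseteq> insert 0 (Poly_Mapping.lookup q ` Poly_Mapping.keys q)"
        by (auto simp: in_keys_iff)
      show "countable (insert 0 (Poly_Mapping.lookup q ` Poly_Mapping.keys q))"
        by (intro countable_finite finite.insertI finite_imageI finite_keys)
    qed
    then show ?thesis by blast
  qed
  then obtain k where k: "subring_set k" "countable k"
    and kF: "range (Poly_Mapping.lookup F) \<union> range (Poly_Mapping.lookup p) \<subseteq> k"
    by (rule countable_subring_exists)
  obtain l :: "'n list" where l: "set l = UNIV" "distinct l" using finite_distinct_list[of "UNIV :: 'n set"] by auto
  define B where "B = poly_subring k l"
  have B: "subring_set B" unfolding B_def by (rule subring_poly_subring[OF k(1)])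
  note Bc = subring_setD[OF B]
  have FB: "F \<in> B" "p \<in> B" unfolding B_def
    by (rule poly_subring_all[OF k(1) l(1)]; use kF in blast)+
  obtain z :: "'n \<Rightarrow> complex" where z: "\<And>b. b \<in> B \<Longrightarrow> ev b z = 0 \<longleftrightarrow> b \<in> M"
    using generic_point_exists[OF k I one prime l(2)] unfolding B_def by blast
  note ev = is_homD[OF ev_hom]
  \<comment> \<open>Denominators that are squares make this set closed under inverses: $(s/g^2)^{-1} = g^2 s / s^2$.\<close>
  define T0 where "T0 = {ev s z / (ev g z)\<^sup>2 |s g. s \<in> B \<and> g \<in> B \<and> SOS s \<and> ev g z \<noteq> 0}"
  have T0I: "ev s z / (ev g z)\<^sup>2 \<in> T0" if "s \<in> B" "g \<in> B" "SOS s" "ev g z \<noteq> 0" for s g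
    using that unfolding T0_def by blast
  have T0_int: "ev s z \<in> T0" if "s \<in> B" "SOS s" for s
    using T0I[OF that(1) Bc(2) that(2)] by (simp add: ev)
  have "field_preorder T0"
    unfolding field_preorder_def
  proof (intro conjI ballI)
    have "SOS 1" using SOS_square[of 1] by simp
    then show "1 \<in> T0" using T0_int[OF Bc(2)] by (simp add: ev)
    show "- 1 \<notin> T0"
    proof
      assume "- 1 \<in> T0"
      then obtain s g where sg: "s \<in> B" "g \<in> B" "SOS s" "ev g z \<noteq> 0" "- 1 = ev s z / (ev g z)\<^sup>2"
        unfolding T0_def by blast
      have "ev s z = - (ev g z)\<^sup>2" using sg(4,5) by (simp add: field_simps)
      then have "ev (s + g\<^sup>2) z = 0" by (simp add: ev)
      then have "s + g\<^sup>2 \<in> M" using z[of "s + g\<^sup>2"] sg Bc(4,7) by blast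
      moreover obtain qs where "s = (\<Sum>q\<leftarrow>qs. q\<^sup>2)" using sg(3) SOS_def by auto
      ultimately have "(\<Sum>q\<leftarrow>g # qs. q\<^sup>2) \<in> M" by (simp add: add.commute)
      then have "set (g # qs) \<subseteq> M" using M(1) unfolding real_ideal_def by blast
      then show False using z[OF sg(2)] sg(4) by simp
    qed
    fix x assume "x \<in> T0"
    then obtain s g where x: "s \<in> B" "g \<in> B" "SOS s" "ev g z \<noteq> 0" "x = ev s z / (ev g z)\<^sup>2"
      unfolding T0_def by blast
    show "inverse x \<in> T0"
    proof (cases "ev s z = 0")
      case True
      then show ?thesis using x \<open>x \<in> T0\<close> by simp
    next
      case False
      have "inverse x = ev (g\<^sup>2 * s) z / (ev s z)\<^sup>2"
        using False x(4) by (simp add: x(5) ev field_simps power2_eq_square)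
      then show ?thesis using T0I[of "g\<^sup>2 * s" s] False x SOS_mult[OF SOS_square x(3)] Bc(6,7) by metis
    qed
    fix y assume "y \<in> T0"
    then obtain s' g' where y: "s' \<in> B" "g' \<in> B" "SOS s'" "ev g' z \<noteq> 0" "y = ev s' z / (ev g' z)\<^sup>2"
      unfolding T0_def by blast
    have gg: "g * g' \<in> B" "ev (g * g') z \<noteq> 0" using x y Bc(6) by (auto simp: ev)
    have b: "s * g'\<^sup>2 \<in> B" "s' * g\<^sup>2 \<in> B" using x(1,2) y(1,2) Bc(6,7) by auto
    have so: "SOS (s * g'\<^sup>2)" "SOS (s' * g\<^sup>2)" using x y SOS_mult SOS_square by auto
    have "x + y = ev (s * g'\<^sup>2 + s' * g\<^sup>2) z / (ev (g * g') z)\<^sup>2"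
      using x(4) y(4) by (simp add: x(5) y(5) ev field_simps)
    then show "x + y \<in> T0" using T0I[OF Bc(4)[OF b] gg(1) SOS_add[OF so] gg(2)] by simp
    have "x * y = ev (s * s') z / (ev (g * g') z)\<^sup>2"
      by (simp add: x(5) y(5) ev power_mult_distrib)
    then show "x * y \<in> T0" using T0I[OF Bc(6)[OF x(1) y(1)] gg(1) SOS_mult[OF x(3) y(3)] gg(2)] by simp
    have "x - y = ev (s * g'\<^sup>2 - s' * g\<^sup>2) z / (ev (g * g') z)\<^sup>2"
      using x(4) y(4) by (simp add: x(5) y(5) ev field_simps)
    then have "(x - y)\<^sup>2 = ev ((s * g'\<^sup>2 - s' * g\<^sup>2)\<^sup>2) z / (ev ((g * g')\<^sup>2) z)\<^sup>2"
      by (simp add: ev power_divide)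
    then show "(x - y)\<^sup>2 \<in> T0"
      using T0I[OF Bc(7)[OF Bc(5)[OF b], of 2] Bc(7)[OF gg(1), of 2] SOS_square] gg(2) by (simp add: ev)
  qed
  then obtain T where T: "field_preorder T" "T0 \<subseteq> T" "\<forall>T'. field_preorder T' \<longrightarrow> T \<subseteq> T' \<longrightarrow> T' = T"
    by (rule field_preorder_extend) blast
  interpret maximal_preorder T by unfold_locales (use T in auto)
  have kT: "of_real c \<in> T" if "c \<in> k" "0 \<le> c" for c
  proof -
    have "pconst c \<in> B" unfolding B_def by (rule poly_subring_generators(1)[OF k(1) that(1)])
    moreover have "pconst c = (pconst (sqrt c))\<^sup>2" using that(2) by (simp add: power2_eq_square flip: pconst_simps)
    ultimately have "ev (pconst c) z \<in> T0" using T0_int SOS_square by metis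
    then show ?thesis using T(2) by (auto simp: ev_pconst)
  qed
  have zK: "z v \<in> K" for v
  proof -
    have v: "pvar v \<in> B" unfolding B_def by (rule poly_subring_generators(2)[OF k(1)]) (simp add: l)
    have two: "2 \<in> B" "ev 2 z = (2::complex)" using Bc(10)[of 2] ev(8)[of 2] by simp_all
    \<comment> \<open>Coordinates are differences of squares.\<close>
    have "ev ((pvar v + 1)\<^sup>2) z / (ev 2 z)\<^sup>2 \<in> T" "ev ((pvar v - 1)\<^sup>2) z / (ev 2 z)\<^sup>2 \<in> T"
      using T0I[OF Bc(7)[OF Bc(4)[OF v Bc(2)]] two(1) SOS_square] T0I[OF Bc(7)[OF Bc(5)[OF v Bc(2)]] two(1) SOS_square]
        T(2) two(2) by auto
    then have "ev ((pvar v + 1)\<^sup>2) z / (ev 2 z)\<^sup>2 - ev ((pvar v - 1)\<^sup>2) z / (ev 2 z)\<^sup>2 \<in> K"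
      by (rule K_diff)
    moreover have "ev ((pvar v + 1)\<^sup>2) z / (ev 2 z)\<^sup>2 - ev ((pvar v - 1)\<^sup>2) z / (ev 2 z)\<^sup>2 = z v"
      by (simp add: ev ev_pvar two(2) field_simps power2_eq_square)
    ultimately show ?thesis by simp
  qed
  interpret R: ordered_subfield "{0::real..}" by (rule ordered_reals)
  have "\<exists>a :: 'n \<Rightarrow> real. \<forall>g\<in>{F, p}. sg (ev g z) = R.sg (ev g a)"
    by (rule transfer_to_reals[OF k(1) kT]) (use zK l(2) FB B_def in auto)
  then obtain a :: "'n \<Rightarrow> real" where a: "\<forall>g\<in>{F, p}. sg (ev g z) = R.sg (ev g a)" by blast
  have "ev F z = 0" using z[OF FB(1)] F M(2) by blast
  then have "ev F a = 0" using a R.sg_zero by fastforce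
  then have "ev p a = 0" using zeros[of "\<chi> i. a i"] by (simp add: ev_real)
  then have "ev p z = 0" using a sg_zero by fastforce
  then show False using z[OF FB(2)] M(3) by blast
qed

section \<open>Degrees and sums of squares\<close>

definition deg_le :: "'n::finite rpoly \<Rightarrow> nat \<Rightarrow> bool" where
  "deg_le p m \<longleftrightarrow> Poly_Mapping.keys p \<subseteq> mexps m"

lemma mdeg_add: "mdeg (\<alpha> + \<beta>) = mdeg \<alpha> + mdeg \<beta>"
  by (simp add: mdeg_def lookup_add sum.distrib)

lemma mexps_add: "\<alpha> \<in> mexps m \<Longrightarrow> \<beta> \<in> mexps n \<Longrightarrow> \<alpha> + \<beta> \<in> mexps (m + n)"
  by (simp add: mexps_def mdeg_add)

lemma mexps_mono: "m \<le> n \<Longrightarrow> mexps m \<subseteq> mexps n"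
  by (auto simp: mexps_def)

lemma deg_le_mono: "deg_le p m \<Longrightarrow> m \<le> n \<Longrightarrow> deg_le p n"
  unfolding deg_le_def using mexps_mono by blast

lemma deg_le_add: "deg_le p m \<Longrightarrow> deg_le q m \<Longrightarrow> deg_le (p + q) m"
  unfolding deg_le_def using keys_add[of p q] by blast

lemma deg_le_diff: "deg_le p m \<Longrightarrow> deg_le q m \<Longrightarrow> deg_le (p - q) m"
  unfolding deg_le_def using keys_diff[of p q] by blast

lemma deg_le_mult: "deg_le p m \<Longrightarrow> deg_le q n \<Longrightarrow> deg_le (p * q) (m + n)"
  unfolding deg_le_def using keys_mult[of p q] mexps_add by blast

lemma deg_le_single: "deg_le (Poly_Mapping.single \<alpha> c) m" if "\<alpha> \<in> mexps m"
  using that by (simp add: deg_le_def)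

lemma zero_mexps: "0 \<in> mexps m" by (simp add: mexps_def mdeg_def)

lemma deg_le_pconst: "deg_le (pconst c) m"
  unfolding pconst_def by (rule deg_le_single[OF zero_mexps])

lemma deg_le_one: "deg_le 1 m" using deg_le_pconst[of 1 m] by (simp add: pconst_simps)

lemma deg_le_zero: "deg_le 0 m" by (simp add: deg_le_def)

lemma deg_le_sum: "(\<And>i. i \<in> I \<Longrightarrow> deg_le (g i) m) \<Longrightarrow> deg_le (sum g I) m"
  by (induction I rule: infinite_finite_induct) (auto simp: deg_le_zero deg_le_add)

lemma deg_le_tdeg: "deg_le p (tdeg p)"
  unfolding deg_le_def tdeg_def mexps_def by auto

lemma deg_le_prod: "(\<And>i. i \<in> I \<Longrightarrow> deg_le (g i) 1) \<Longrightarrow> finite I \<Longrightarrow> deg_le (prod g I) (card I)"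
proof (induction I rule: infinite_finite_induct)
  case (insert x F)
  then show ?case using deg_le_mult[of "g x" 1 "prod g F" "card F"] by simp
qed (auto simp: deg_le_one)

text \<open>
  If $\beta + \gamma = 2 \alpha$, then $|\beta|^2 + |\gamma|^2 = 2 |\alpha|^2 + 2 |\beta -
  \alpha|^2$ for the Euclidean norm. So when $\alpha$ has maximal norm among the exponents of
  top degree, only $\beta = \gamma = \alpha$ contributes to the coefficient of $x^{2\alpha}$.
\<close>

lemma lookup_square_extreme:
  assumes e: "\<And>\<beta>. \<beta> \<in> Poly_Mapping.keys q \<Longrightarrow> mdeg \<beta> \<le> mdeg \<alpha>"
    and N: "\<And>\<beta>. \<beta> \<in> Poly_Mapping.keys q \<Longrightarrow> mdeg \<beta> = mdeg \<alpha> \<Longrightarrow>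
      (\<Sum>i\<in>UNIV. (int (Poly_Mapping.lookup \<beta> i))\<^sup>2) \<le> (\<Sum>i\<in>UNIV. (int (Poly_Mapping.lookup \<alpha> i))\<^sup>2)"
  shows "Poly_Mapping.lookup (q\<^sup>2) (\<alpha> + \<alpha>) = (Poly_Mapping.lookup (q::'n::finite rpoly) \<alpha>)\<^sup>2"
proof -
  let ?l = Poly_Mapping.lookup and ?K = "Poly_Mapping.keys q"
  have eq: "\<beta> = \<alpha> \<and> \<gamma> = \<alpha>" if k: "\<beta> \<in> ?K" "\<gamma> \<in> ?K" and s: "\<beta> + \<gamma> = \<alpha> + \<alpha>" for \<beta> \<gamma>
  proof -
    have "mdeg \<beta> + mdeg \<gamma> = mdeg \<alpha> + mdeg \<alpha>" using arg_cong[OF s, of mdeg] by (simp add: mdeg_add)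
    then have d: "mdeg \<beta> = mdeg \<alpha>" "mdeg \<gamma> = mdeg \<alpha>" using e[OF k(1)] e[OF k(2)] by linarith+
    have c: "int (?l \<gamma> i) = 2 * int (?l \<alpha> i) - int (?l \<beta> i)" for i
    proof -
      have "?l \<beta> i + ?l \<gamma> i = ?l \<alpha> i + ?l \<alpha> i" using arg_cong[OF s, of "\<lambda>x. ?l x i"] by (simp add: lookup_add)
      then show ?thesis by linarith
    qed
    have "(\<Sum>i\<in>UNIV. (int (?l \<beta> i))\<^sup>2) + (\<Sum>i\<in>UNIV. (int (?l \<gamma> i))\<^sup>2) =
        2 * (\<Sum>i\<in>UNIV. (int (?l \<alpha> i))\<^sup>2) + 2 * (\<Sum>i\<in>UNIV. (int (?l \<beta> i) - int (?l \<alpha> i))\<^sup>2)"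
      unfolding sum_distrib_left sum.distrib[symmetric]
      by (intro sum.cong refl) (simp add: c power2_eq_square algebra_simps)
    then have "(\<Sum>i\<in>UNIV. (int (?l \<beta> i) - int (?l \<alpha> i))\<^sup>2) \<le> 0"
      using N[OF k(1) d(1)] N[OF k(2) d(2)] by linarith
    then have "(\<Sum>i\<in>UNIV. (int (?l \<beta> i) - int (?l \<alpha> i))\<^sup>2) = 0"
      by (meson antisym sum_nonneg zero_le_power2)
    then have "\<forall>i\<in>UNIV. (int (?l \<beta> i) - int (?l \<alpha> i))\<^sup>2 = 0"
      by (subst (asm) sum_nonneg_eq_0_iff) auto
    then have "?l \<beta> i = ?l \<alpha> i" for i by simp
    then have "\<beta> = \<alpha>" by (intro poly_mapping_eqI)
    moreover have "?l \<gamma> i = ?l \<alpha> i" for i using c[of i] \<open>\<beta> = \<alpha>\<close> by simp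
    then have "\<gamma> = \<alpha>" by (intro poly_mapping_eqI)
    ultimately show ?thesis by simp
  qed
  have "?l (q * q) (\<alpha> + \<alpha>) = (\<Sum>\<beta>\<in>?K. \<Sum>\<gamma>\<in>?K. if \<beta> + \<gamma> = \<alpha> + \<alpha> then ?l q \<beta> * ?l q \<gamma> else 0)"
    by (subst times_expand) (simp add: lookup_sum lookup_single when_def)
  also have "\<dots> = (\<Sum>\<beta>\<in>?K. \<Sum>\<gamma>\<in>?K. if \<beta> = \<alpha> then if \<gamma> = \<alpha> then (?l q \<alpha>)\<^sup>2 else 0 else 0)"
  proof (rule sum.cong[OF refl], rule sum.cong[OF refl])
    fix \<beta> \<gamma> assume k: "\<beta> \<in> ?K" "\<gamma> \<in> ?K"
    show "(if \<beta> + \<gamma> = \<alpha> + \<alpha> then ?l q \<beta> * ?l q \<gamma> else 0) =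
        (if \<beta> = \<alpha> then if \<gamma> = \<alpha> then (?l q \<alpha>)\<^sup>2 else 0 else 0)"
    proof (cases "\<beta> + \<gamma> = \<alpha> + \<alpha>")
      case True
      then show ?thesis using eq[OF k True] by (simp add: power2_eq_square)
    next
      case False
      then have "\<not> (\<beta> = \<alpha> \<and> \<gamma> = \<alpha>)" by blast
      then show ?thesis using False by auto
    qed
  qed
  also have "\<dots> = (\<Sum>\<beta>\<in>?K. if \<beta> = \<alpha> then (\<Sum>\<gamma>\<in>?K. if \<gamma> = \<alpha> then (?l q \<alpha>)\<^sup>2 else 0) else 0)"
    by (intro sum.cong refl) simp
  also have "\<dots> = (?l q \<alpha>)\<^sup>2"
    by (cases "\<alpha> \<in> ?K") (simp_all add: sum.delta in_keys_iff)
  finally show ?thesis by (simp add: power2_eq_square)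
qed

lemma lookup_sum_list: "Poly_Mapping.lookup (\<Sum>q\<leftarrow>qs. g q) \<alpha> = (\<Sum>q\<leftarrow>qs. Poly_Mapping.lookup (g q) \<alpha>)"
  by (induction qs) (simp_all add: lookup_add)

text \<open>
  Leading terms do not cancel in a sum of squares: at an exponent of top degree and maximal
  norm, the coefficient is a sum of squares of real numbers.
\<close>

lemma SOS_degree:
  fixes qs :: "'n::finite rpoly list"
  assumes deg: "deg_le (\<Sum>q\<leftarrow>qs. q\<^sup>2) (2 * d)" and q: "q \<in> set qs"
  shows "deg_le q d"
proof (rule ccontr)
  assume nd: "\<not> deg_le q d"
  let ?K = "\<Union>q\<in>set qs. Poly_Mapping.keys q"
  let ?N = "\<lambda>\<alpha>. \<Sum>i\<in>UNIV. (int (Poly_Mapping.lookup \<alpha> i))\<^sup>2"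
  have finK: "finite ?K" by simp
  from nd obtain \<beta>0 where "\<beta>0 \<in> Poly_Mapping.keys q" "\<beta>0 \<notin> mexps d" unfolding deg_le_def by blast
  then have b0: "\<beta>0 \<in> Poly_Mapping.keys q" "mdeg \<beta>0 > d" by (simp_all add: mexps_def)
  then have neK: "?K \<noteq> {}" using q by blast
  define e where "e = Max (mdeg ` ?K)"
  have le: "mdeg \<beta> \<le> e" if "\<beta> \<in> ?K" for \<beta> unfolding e_def using finK that by (intro Max_ge) auto
  have "e \<in> mdeg ` ?K" unfolding e_def using finK neK by (intro Max_in) auto
  then have ne: "{\<beta>\<in>?K. mdeg \<beta> = e} \<noteq> {}" by auto
  have "\<beta>0 \<in> ?K" using b0 q by blast
  then have "e > d" using le[of \<beta>0] b0(2) by simp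
  define m where "m = Max (?N ` {\<beta>\<in>?K. mdeg \<beta> = e})"
  have "m \<in> ?N ` {\<beta>\<in>?K. mdeg \<beta> = e}" unfolding m_def using finK ne by (intro Max_in) auto
  then obtain \<alpha> where a: "\<alpha> \<in> ?K" "mdeg \<alpha> = e" "?N \<alpha> = m" by auto
  have "?N \<beta> \<le> ?N \<alpha>" if "\<beta> \<in> ?K" "mdeg \<beta> = e" for \<beta>
    unfolding a(3) m_def using finK that by (intro Max_ge) auto
  then have l: "Poly_Mapping.lookup (r\<^sup>2) (\<alpha> + \<alpha>) = (Poly_Mapping.lookup r \<alpha>)\<^sup>2" if "r \<in> set qs" for r
    by (intro lookup_square_extreme) (use that le a in auto)
  have "Poly_Mapping.lookup (\<Sum>q\<leftarrow>qs. q\<^sup>2) (\<alpha> + \<alpha>) = (\<Sum>q\<leftarrow>qs. (Poly_Mapping.lookup q \<alpha>)\<^sup>2)"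
    unfolding lookup_sum_list by (intro arg_cong[of _ _ sum_list] map_cong refl l)
  moreover have "(\<Sum>q\<leftarrow>qs. (Poly_Mapping.lookup q \<alpha>)\<^sup>2) \<noteq> 0"
  proof
    assume z: "(\<Sum>q\<leftarrow>qs. (Poly_Mapping.lookup q \<alpha>)\<^sup>2) = 0"
    obtain r where r: "r \<in> set qs" "Poly_Mapping.lookup r \<alpha> \<noteq> 0" using a(1) by (auto simp: in_keys_iff)
    have "\<forall>x\<in>set (map (\<lambda>q. (Poly_Mapping.lookup q \<alpha>)\<^sup>2) qs). x = 0"
      by (subst sum_list_nonneg_eq_0_iff[symmetric]) (use z in auto)
    then show False using r by auto
  qed
  ultimately have "\<alpha> + \<alpha> \<in> Poly_Mapping.keys (\<Sum>q\<leftarrow>qs. q\<^sup>2)" by (simp add: in_keys_iff)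
  then have "mdeg (\<alpha> + \<alpha>) \<le> 2 * d" using deg by (auto simp: deg_le_def mexps_def)
  then show False using \<open>e > d\<close> a(2) by (simp add: mdeg_add)
qed

section \<open>Moment functionals\<close>

lemma pairing_linext: "pairing p y = linext y p"
  by (simp add: pairing_def linext_def)

lemma linext_pconst: "linext (y :: _ \<Rightarrow> real) (pconst c * p) = c * linext y p"
proof -
  have "pconst c * p = (\<Sum>\<alpha>\<in>Poly_Mapping.keys p. Poly_Mapping.single \<alpha> (c * Poly_Mapping.lookup p \<alpha>))"
    by (subst sum_of_monomials[of p]) (simp add: pconst_def sum_distrib_left mult_single)
  then show ?thesis by (simp add: linext_sum linext_single) (simp add: linext_def sum_distrib_left mult.assoc)
qed

lemma pairing_simps:
  "pairing (p + q) y = pairing p y + pairing q y" "pairing (p - q) y = pairing p y - pairing q y"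
  "pairing (pconst c * p) y = c * pairing p y" "pairing (pconst c) y = c * pairing 1 y"
  "pairing 0 y = 0"
proof -
  show 1: "pairing (p + q) y = pairing p y + pairing q y" for p q by (simp add: pairing_linext linext_add)
  show "pairing (p - q) y = pairing p y - pairing q y" using 1[of "p - q" q] by simp
  show 3: "pairing (pconst c * p) y = c * pairing p y" for p by (simp add: pairing_linext linext_pconst)
  show "pairing (pconst c) y = c * pairing 1 y" using 3[of 1] by simp
  show "pairing 0 y = 0" by (simp add: pairing_linext)
qed

lemma pairing_square_nonneg:
  assumes y: "y \<in> moment_feasible k" and h: "deg_le h k"
  shows "0 \<le> pairing (h\<^sup>2) y"
proof -
  let ?l = "Poly_Mapping.lookup h"
  have "pairing (h\<^sup>2) y = (\<Sum>\<alpha>\<in>Poly_Mapping.keys h. \<Sum>\<beta>\<in>Poly_Mapping.keys h. ?l \<alpha> * y (\<alpha> + \<beta>) * ?l \<beta>)"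
    unfolding pairing_linext power2_eq_square linext_mult by (intro sum.cong refl) simp
  also have "\<dots> = (\<Sum>\<alpha>\<in>mexps k. \<Sum>\<beta>\<in>Poly_Mapping.keys h. ?l \<alpha> * y (\<alpha> + \<beta>) * ?l \<beta>)"
    by (rule sum.mono_neutral_left[OF finite_mexps]) (use h in \<open>auto simp: deg_le_def in_keys_iff\<close>)
  also have "\<dots> = (\<Sum>\<alpha>\<in>mexps k. \<Sum>\<beta>\<in>mexps k. ?l \<alpha> * y (\<alpha> + \<beta>) * ?l \<beta>)"
    by (intro sum.cong refl sum.mono_neutral_left[OF finite_mexps]) (use h in \<open>auto simp: deg_le_def in_keys_iff\<close>)
  also have "\<dots> \<ge> 0"
    using y by (simp add: moment_feasible_def psd_on_def moment_matrix_def)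
  finally show ?thesis .
qed

lemma pairing_sum_squares_nonneg:
  assumes y: "y \<in> moment_feasible k" and h: "\<And>q. q \<in> set qs \<Longrightarrow> deg_le q k"
  shows "0 \<le> pairing (\<Sum>q\<leftarrow>qs. q\<^sup>2) y"
  using h by (induction qs) (auto simp: pairing_simps intro: add_nonneg_nonneg pairing_square_nonneg[OF y])

text \<open>
  The Cauchy-Schwarz inequality for the positive semidefinite form $(u, v) \mapsto \langle u v,
  y \rangle$.
\<close>

lemma pairing_orthogonal:
  assumes y: "y \<in> moment_feasible k" and u: "deg_le u k" "pairing (u\<^sup>2) y = 0" and v: "deg_le v k"
  shows "pairing (v * u) y = 0"
proof (rule ccontr)
  assume n: "pairing (v * u) y \<noteq> 0"
  have *: "0 \<le> pairing (v\<^sup>2) y + 2 * t * pairing (v * u) y" for t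
  proof -
    have "deg_le (v + pconst t * u) k"
      using deg_le_mult[OF deg_le_pconst[of t 0] u(1)] v by (simp add: deg_le_add)
    then have "0 \<le> pairing ((v + pconst t * u)\<^sup>2) y" by (rule pairing_square_nonneg[OF y])
    also have "(v + pconst t * u)\<^sup>2 = v\<^sup>2 + (pconst (2 * t) * (v * u) + pconst (t * t) * u\<^sup>2)"
    proof -
      have two: "pconst (2 * t) = pconst t + pconst t" by (simp flip: pconst_simps)
      show ?thesis unfolding two pconst_simps(3)[of t t] power2_eq_square by (simp add: algebra_simps)
    qed
    finally show ?thesis by (simp add: pairing_simps(1,3) u(2))
  qed
  show False using *[of "- (pairing (v\<^sup>2) y + 1) / (2 * pairing (v * u) y)"] n by (simp add: field_simps)
qed

definition point_moments :: "nat \<Rightarrow> real ^ 'n \<Rightarrow> 'n::finite mexp \<Rightarrow> real" where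
  "point_moments k x \<alpha> = (if \<alpha> \<in> mexps (2 * k) then \<Prod>i\<in>UNIV. (x $ i) ^ Poly_Mapping.lookup \<alpha> i else 0)"

lemma pairing_point_moments: "deg_le p (2 * k) \<Longrightarrow> pairing p (point_moments k x) = peval p x"
  unfolding pairing_def peval_def by (intro sum.cong refl) (auto simp: point_moments_def deg_le_def)

lemma point_moments_feasible: "point_moments k x \<in> moment_feasible k"
  unfolding moment_feasible_def psd_on_def
proof (intro CollectI conjI ballI allI)
  show "point_moments k x \<in> tms (2 * k)" by (simp add: tms_def point_moments_def)
  show "pairing 1 (point_moments k x) = 1"
    by (simp add: pairing_point_moments[OF deg_le_one] ev_real is_homD(1)[OF ev_hom])
  show "moment_matrix (point_moments k x) i j = moment_matrix (point_moments k x) j i" for i j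
    by (simp add: moment_matrix_def add.commute)
  fix v :: "'a mexp \<Rightarrow> real"
  let ?m = "\<lambda>\<alpha>. \<Prod>i\<in>UNIV. (x $ i) ^ Poly_Mapping.lookup \<alpha> i"
  have "moment_matrix (point_moments k x) i j = ?m i * ?m j" if "i \<in> mexps k" "j \<in> mexps k" for i j
    using mexps_add[OF that] by (simp add: moment_matrix_def point_moments_def lookup_add power_add prod.distrib flip: mult_2)
  then have "(\<Sum>i\<in>mexps k. \<Sum>j\<in>mexps k. v i * moment_matrix (point_moments k x) i j * v j) =
      (\<Sum>i\<in>mexps k. \<Sum>j\<in>mexps k. (v i * ?m i) * (v j * ?m j))"
    by (intro sum.cong refl) simp
  also have "\<dots> = (\<Sum>i\<in>mexps k. v i * ?m i)\<^sup>2"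
    by (simp only: power2_eq_square sum_product)
  finally show "0 \<le> (\<Sum>i\<in>mexps k. \<Sum>j\<in>mexps k. v i * moment_matrix (point_moments k x) i j * v j)" by simp
qed

section \<open>Minimizers of the relaxation\<close>

text \<open>
  Here \<open>m\<close> is attained by \<open>f\<close>, and $f - \gamma$ is a sum of squares
  for some $\gamma$ arbitrarily close to \<open>m\<close>. Working with such $\gamma$ instead of
  \<open>m\<close> avoids the closedness of the cone of sums of squares.
\<close>

locale tight_sos =
  fixes f :: "'n::finite rpoly" and d :: nat and m :: real and u :: "real ^ 'n"
  assumes degf: "deg_le f (2 * d)" and u: "peval f u = m"
    and sos: "\<And>\<epsilon>. \<epsilon> > 0 \<Longrightarrow> \<exists>\<gamma>>m - \<epsilon>. SOS (f - pconst \<gamma>)"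
begin

definition F :: "'n rpoly" where "F = f - pconst m"

lemma degF: "deg_le F (2 * d)"
  unfolding F_def by (intro deg_le_diff degf deg_le_pconst)

text \<open>
  By \<open>SOS_degree\<close> the squares in $f - \gamma$ are those of polynomials $q$ of
  degree at most $d$; so the products $q g$ have degree at most $k$, and \<open>y\<close> is
  nonnegative on their squares.
\<close>

lemma SOS_pairing:
  assumes y: "y \<in> moment_feasible k" and s: "SOS (f - pconst \<gamma>)" and g: "deg_le g e" "d + e \<le> k"
  shows "0 \<le> pairing ((f - pconst \<gamma>) * g\<^sup>2) y"
proof -
  obtain qs where qs: "f - pconst \<gamma> = (\<Sum>q\<leftarrow>qs. q\<^sup>2)" using s SOS_def by auto
  have "deg_le (f - pconst \<gamma>) (2 * d)" by (intro deg_le_diff degf deg_le_pconst)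
  then have "deg_le q d" if "q \<in> set qs" for q using SOS_degree that unfolding qs by blast
  then have "deg_le (q * g) k" if "q \<in> set qs" for q
    using deg_le_mono[OF deg_le_mult[OF _ g(1)] g(2)] that by blast
  then have "0 \<le> pairing (\<Sum>q\<leftarrow>map ((*) g) qs. q\<^sup>2) y"
    by (intro pairing_sum_squares_nonneg[OF y]) (auto simp: mult.commute)
  then show ?thesis unfolding sum_squares_scaled qs by (simp add: mult.commute)
qed

text \<open>
  The moments of the point \<open>u\<close> bound the optimal value from above, sums of squares
  $f - \gamma$ bound it from below.
\<close>

lemma minimal_value:
  assumes y: "y \<in> moment_minimizers f k" and k: "d \<le> k"
  shows "pairing f y = m" "SOS (f - pconst \<gamma>) \<Longrightarrow> \<gamma> \<le> m"
proof -
  have feas: "y \<in> moment_feasible k" and "pairing f y \<le> pairing f (point_moments k u)"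
    using y point_moments_feasible[of k u] by (auto simp: moment_minimizers_def)
  moreover have "deg_le f (2 * k)" using deg_le_mono[OF degf] k by simp
  ultimately have le: "pairing f y \<le> m" using u by (simp add: pairing_point_moments)
  have one: "pairing 1 y = 1" using feas by (simp add: moment_feasible_def)
  have low: "\<gamma> \<le> pairing f y" if "SOS (f - pconst \<gamma>)" for \<gamma>
    using SOS_pairing[OF feas that deg_le_one[of 0]] k by (simp add: pairing_simps one)
  have "m \<le> pairing f y"
  proof (rule field_le_epsilon)
    fix \<epsilon> :: real assume "\<epsilon> > 0"
    then obtain \<gamma> where "\<gamma> > m - \<epsilon>" "SOS (f - pconst \<gamma>)" using sos by blast
    then show "m \<le> pairing f y + \<epsilon>" using low[of \<gamma>] by simp
  qed
  then show "pairing f y = m" using le by simp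
  then show "SOS (f - pconst \<gamma>) \<Longrightarrow> \<gamma> \<le> m" using low by simp
qed

text \<open>
  For small $s \ge 0$ such that $F + s$ is a sum of squares, $\langle (F + s)(t - F)^2, y
  \rangle \ge 0$. As $s$ tends to $0$ and since $\langle F, y \rangle = 0$, this becomes $-2 t
  \langle F^2, y \rangle + \langle F^3, y \rangle \ge 0$ for all real $t$, so the coefficient of
  $t$ vanishes. The squares involved are those of $q (t - F)$ with $\deg q \le d$, whence the
  bound $3 d$.
\<close>

lemma pairing_F_square:
  assumes y: "y \<in> moment_minimizers f k" and k: "3 * d \<le> k"
  shows "pairing (F\<^sup>2) y = 0"
proof -
  have feas: "y \<in> moment_feasible k" using y by (simp add: moment_minimizers_def)
  have one: "pairing 1 y = 1" using feas by (simp add: moment_feasible_def)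
  have F0: "pairing F y = 0"
    using minimal_value(1)[OF y] k by (simp add: F_def pairing_simps one)
  have ineq: "0 \<le> - 2 * t * pairing (F\<^sup>2) y + pairing (F ^ 3) y" for t
  proof (rule field_le_epsilon)
    fix \<epsilon> :: real assume e: "\<epsilon> > 0"
    \<comment> \<open>With $s \le \varepsilon / c$ all terms that contain $s$ add up to at most $\varepsilon$.\<close>
    define c where "c = t * t + \<bar>pairing (F\<^sup>2) y\<bar> + 1"
    have c: "c > 0" unfolding c_def by (simp add: add_nonneg_pos)
    obtain \<gamma> where g: "\<gamma> > m - \<epsilon> / c" "SOS (f - pconst \<gamma>)" using sos[of "\<epsilon> / c"] e c by auto
    define s where "s = m - \<gamma>"
    have s: "0 \<le> s" "s * c \<le> \<epsilon>"
      using g minimal_value(2)[OF y _ g(2)] k c by (auto simp: s_def field_simps)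
    have "deg_le (pconst t - F) (2 * d)" by (intro deg_le_diff degF deg_le_pconst)
    then have "0 \<le> pairing ((f - pconst \<gamma>) * (pconst t - F)\<^sup>2) y"
      using SOS_pairing[OF feas g(2)] k by simp
    also have "(f - pconst \<gamma>) * (pconst t - F)\<^sup>2 =
        pconst (t * t) * F - pconst (2 * t) * F\<^sup>2 + F ^ 3 + pconst (s * t * t) - pconst (2 * s * t) * F + pconst s * F\<^sup>2"
    proof -
      have a: "f - pconst \<gamma> = F + pconst s" by (simp add: F_def s_def pconst_simps)
      have b: "pconst (2 * t) = pconst t + pconst t" by (simp flip: pconst_simps)
      have c: "pconst (2 * s * t) = pconst s * pconst t + pconst s * pconst t"
        by (simp add: mult.assoc flip: pconst_simps)
      show ?thesis unfolding a b c pconst_simps(3)[of t t] pconst_simps(3)[of "s * t" t] pconst_simps(3)[of s t]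
        by (simp add: power2_eq_square power3_eq_cube algebra_simps)
    qed
    finally have "0 \<le> - 2 * t * pairing (F\<^sup>2) y + pairing (F ^ 3) y + s * (t * t + pairing (F\<^sup>2) y)"
      by (simp add: pairing_simps F0 one) (simp add: algebra_simps)
    also have "s * (t * t + pairing (F\<^sup>2) y) \<le> s * c"
      using s(1) by (intro mult_left_mono) (auto simp: c_def)
    finally show "0 \<le> - 2 * t * pairing (F\<^sup>2) y + pairing (F ^ 3) y + \<epsilon>" using s(2) by linarith
  qed
  show ?thesis
  proof (rule ccontr)
    assume n: "pairing (F\<^sup>2) y \<noteq> 0"
    show False using ineq[of "(pairing (F ^ 3) y + 1) / (2 * pairing (F\<^sup>2) y)"] n by (simp add: field_simps)
  qed
qed

text \<open>
  The polynomials that are in the kernel of the moment matrix of every minimizer, as soon as the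
  order of the relaxation is large.
\<close>

definition J :: "'n rpoly set" where
  "J = {h. \<forall>\<^sub>F k in sequentially. \<forall>y\<in>moment_minimizers f k. pairing (h\<^sup>2) y = 0}"

lemma J_orthogonal:
  assumes "h \<in> J"
  shows "\<forall>\<^sub>F k in sequentially. \<forall>y\<in>moment_minimizers f k. \<forall>v. deg_le v k \<longrightarrow> pairing (v * h) y = 0"
proof -
  have "\<forall>\<^sub>F k in sequentially. \<forall>y\<in>moment_minimizers f k. pairing (h\<^sup>2) y = 0" using assms by (simp add: J_def)
  moreover have "\<forall>\<^sub>F k in sequentially. tdeg h \<le> k" by (rule eventually_ge_at_top)
  ultimately show ?thesis
  proof eventually_elim
    case (elim k)
    show ?case
    proof (intro ballI allI impI)
      fix y and v :: "'n rpoly" assume y: "y \<in> moment_minimizers f k" and v: "deg_le v k"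
      have "y \<in> moment_feasible k" using y by (simp add: moment_minimizers_def)
      then show "pairing (v * h) y = 0"
        using pairing_orthogonal[OF _ deg_le_mono[OF deg_le_tdeg elim(2)] _ v] elim(1) y by blast
    qed
  qed
qed

text \<open>
  If $\langle h^2, y \rangle = 0$, then $h$ is orthogonal to every polynomial of degree at most
  $k$, hence to $r^2 h$ once $k$ is large. And if $\sum_i q_i^2$ is orthogonal to $1$, then the
  nonnegative numbers $\langle q_i^2, y \rangle$ add up to $0$.
\<close>

lemma real_ideal_J: "real_ideal J"
  unfolding real_ideal_def ideal_set_def
proof (intro conjI ballI allI impI)
  show "0 \<in> J" by (simp add: J_def pairing_simps)
next
  fix g h assume gh: "g \<in> J" "h \<in> J"
  define N where "N = max (tdeg g) (tdeg h)"
  have "\<forall>\<^sub>F k in sequentially. N \<le> k" by (rule eventually_ge_at_top)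
  with J_orthogonal[OF gh(1)] J_orthogonal[OF gh(2)]
  have "\<forall>\<^sub>F k in sequentially. \<forall>y\<in>moment_minimizers f k. pairing ((g + h)\<^sup>2) y = 0"
  proof eventually_elim
    case (elim k)
    have "deg_le (g + h) k"
      using elim(3) unfolding N_def
      by (intro deg_le_add deg_le_mono[OF deg_le_tdeg]) auto
    moreover have "(g + h)\<^sup>2 = (g + h) * g + (g + h) * h" by (simp add: power2_eq_square algebra_simps)
    ultimately show ?case using elim(1,2) by (simp add: pairing_simps(1))
  qed
  then show "g + h \<in> J" by (simp add: J_def)
next
  fix h r assume h: "h \<in> J"
  define N where "N = tdeg (r * r * h)"
  have "\<forall>\<^sub>F k in sequentially. N \<le> k" by (rule eventually_ge_at_top)
  with J_orthogonal[OF h]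
  have "\<forall>\<^sub>F k in sequentially. \<forall>y\<in>moment_minimizers f k. pairing ((r * h)\<^sup>2) y = 0"
  proof eventually_elim
    case (elim k)
    have "deg_le (r * r * h) k" using elim(2) unfolding N_def by (rule deg_le_mono[OF deg_le_tdeg])
    moreover have "(r * h)\<^sup>2 = (r * r * h) * h" by (simp add: power2_eq_square algebra_simps)
    ultimately show ?case using elim(1) by simp
  qed
  then show "r * h \<in> J" by (simp add: J_def)
next
  fix qs assume s: "(\<Sum>q\<leftarrow>qs. q\<^sup>2) \<in> J"
  show "set qs \<subseteq> J"
  proof
    fix q assume q: "q \<in> set qs"
    define N where "N = Max (tdeg ` set qs)"
    have N: "tdeg q' \<le> N" if "q' \<in> set qs" for q' unfolding N_def using that by simp
    have "\<forall>\<^sub>F k in sequentially. N \<le> k" by (rule eventually_ge_at_top)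
    with J_orthogonal[OF s]
    have "\<forall>\<^sub>F k in sequentially. \<forall>y\<in>moment_minimizers f k. pairing (q\<^sup>2) y = 0"
    proof eventually_elim
      case (elim k)
      show ?case
      proof
        fix y assume y: "y \<in> moment_minimizers f k"
        then have feas: "y \<in> moment_feasible k" by (simp add: moment_minimizers_def)
        have deg: "deg_le q' k" if "q' \<in> set qs" for q'
          by (rule deg_le_mono[OF deg_le_tdeg order_trans[OF N[OF that] elim(2)]])
        have "pairing (1 * (\<Sum>q\<leftarrow>qs. q\<^sup>2)) y = 0" using elim(1) y deg_le_one by blast
        then have "(\<Sum>q\<leftarrow>qs. pairing (q\<^sup>2) y) = 0"
        proof -
          have "pairing (\<Sum>q\<leftarrow>rs. q\<^sup>2) y = (\<Sum>q\<leftarrow>rs. pairing (q\<^sup>2) y)" for rs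
            by (induction rs) (simp_all add: pairing_simps)
          then show ?thesis using \<open>pairing (1 * _) y = 0\<close> by simp
        qed
        then have "\<forall>x\<in>set (map (\<lambda>q. pairing (q\<^sup>2) y) qs). x = 0"
          by (subst sum_list_nonneg_eq_0_iff[symmetric]) (use deg pairing_square_nonneg[OF feas] in auto)
        then show "pairing (q\<^sup>2) y = 0" using q by auto
      qed
    qed
    then show "q \<in> J" by (simp add: J_def)
  qed
qed

lemma F_in_J: "F \<in> J"
proof -
  have "\<forall>\<^sub>F k in sequentially. 3 * d \<le> k" by (rule eventually_ge_at_top)
  then have "\<forall>\<^sub>F k in sequentially. \<forall>y\<in>moment_minimizers f k. pairing (F\<^sup>2) y = 0"
    by eventually_elim (use pairing_F_square in blast)
  then show ?thesis by (simp add: J_def)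
qed

lemma vanishing_in_J:
  assumes "\<And>x. peval f x = m \<Longrightarrow> peval p x = 0"
  shows "p \<in> J"
proof (rule real_nullstellensatz[OF real_ideal_J F_in_J])
  fix x assume "peval F x = 0"
  then have "peval f x = m" by (simp add: F_def ev_real is_homD(6)[OF ev_hom] ev_pconst)
  then show "peval p x = 0" by (rule assms)
qed

end

section \<open>Interpolation on a finite set\<close>

lemma separating_polynomial:
  fixes u v :: "real ^ 'n::finite"
  assumes "u \<noteq> v"
  shows "\<exists>l. deg_le l 1 \<and> peval l u = 1 \<and> peval l v = 0"
proof -
  obtain i where i: "u $ i \<noteq> v $ i" using assms by (auto simp: vec_eq_iff)
  define l where "l = pconst (1 / (u $ i - v $ i)) * (pvar i - pconst (v $ i))"
  have "deg_le (pvar i) 1" unfolding pvar_def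
    by (rule deg_le_single) (simp add: mexps_def mdeg_def lookup_single when_def)
  then have "deg_le l (0 + 1)" unfolding l_def by (intro deg_le_mult deg_le_diff deg_le_pconst)
  moreover have "peval l x = (x $ i - v $ i) / (u $ i - v $ i)" for x
    by (simp add: l_def ev_real is_homD[OF ev_hom] ev_pconst ev_pvar)
  ultimately show ?thesis using i by (intro exI[of _ l]) simp
qed

lemma interpolating_polynomial:
  fixes S :: "(real ^ 'n::finite) set"
  assumes S: "finite S"
  shows "\<exists>q. deg_le q (card S - 1) \<and> (\<forall>x\<in>S. peval q x = g x)"
proof -
  note ev = is_homD[OF ev_hom]
  obtain l where l: "\<And>u v :: real ^ 'n. u \<noteq> v \<Longrightarrow> deg_le (l u v) 1 \<and> peval (l u v) u = 1 \<and> peval (l u v) v = 0"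
    using separating_polynomial by metis
  have ev_prod: "peval (prod h I) x = (\<Prod>i\<in>I. peval (h i) x)" for h :: "'b \<Rightarrow> 'n rpoly" and I x
    by (induction I rule: infinite_finite_induct) (simp_all add: ev_real ev)
  define L where "L = (\<lambda>u. \<Prod>v\<in>S - {u}. l u v)"
  define q where "q = (\<Sum>u\<in>S. pconst (g u) * L u)"
  have "deg_le (L u) (card S - 1)" if "u \<in> S" for u
  proof -
    have "deg_le (l u v) 1" if "v \<in> S - {u}" for v using l[of u v] that by auto
    then show ?thesis using deg_le_prod[of "S - {u}" "l u"] S that by (simp add: L_def)
  qed
  then have "deg_le (pconst (g u) * L u) (card S - 1)" if "u \<in> S" for u
    using deg_le_mult[OF deg_le_pconst[of _ 0]] that by fastforce
  then have "deg_le q (card S - 1)" unfolding q_def by (rule deg_le_sum)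
  moreover have "peval q x = g x" if x: "x \<in> S" for x
  proof -
    have Lx: "peval (L u) x = (if u = x then 1 else 0)" if u: "u \<in> S" for u
    proof (cases "u = x")
      case True
      have "peval (l u v) x = 1" if "v \<in> S - {u}" for v using l[of u v] that True by auto
      then show ?thesis unfolding L_def ev_prod using True by (simp add: prod.neutral)
    next
      case False
      then have "\<exists>v\<in>S - {u}. peval (l u v) x = 0" using l x by (intro bexI[of _ x]) auto
      then show ?thesis unfolding L_def ev_prod using S False by (simp add: prod_zero)
    qed
    have "peval q x = (\<Sum>u\<in>S. g u * peval (L u) x)" by (simp add: q_def ev_real ev ev_pconst)
    also have "\<dots> = (\<Sum>u\<in>S. if u = x then g u else 0)" by (intro sum.cong refl) (simp add: Lx)
    also have "\<dots> = g x" using S x by simp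
    finally show ?thesis .
  qed
  ultimately show ?thesis by blast
qed

section \<open>Rank of a matrix whose columns depend on some of them\<close>

lemma lookup_scaleR: "Poly_Mapping.lookup (c *\<^sub>R x) i = c * Poly_Mapping.lookup (x :: 'a \<Rightarrow>\<^sub>0 real) i"
proof -
  have "finite {i. c *\<^sub>R Poly_Mapping.lookup x i \<noteq> 0}"
    by (rule finite_subset[OF _ finite_keys[of x]]) (auto simp: in_keys_iff)
  then show ?thesis by (simp add: scaleR_poly_mapping_def Abs_poly_mapping_inverse)
qed

text \<open>
  The columns in \<open>I\<close> are combinations of those in \<open>I0\<close>. By symmetry
  the same relations hold between the rows, so restricting columns to the rows in
  \<open>I0\<close> is injective on the column space, and passing to the smaller matrix changes
  neither the span of the columns nor its dimension.
\<close>

lemma rank_on_eq: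
  fixes A :: "'a \<Rightarrow> 'a \<Rightarrow> real"
  assumes I: "finite I" "I0 \<subseteq> I" and sym: "\<And>i j. i \<in> I \<Longrightarrow> j \<in> I \<Longrightarrow> A i j = A j i"
    and c: "\<And>i j. i \<in> I \<Longrightarrow> j \<in> I \<Longrightarrow> A i j = (\<Sum>l\<in>I0. c j l * A i l)"
  shows "rank_on I0 A = rank_on I A"
proof -
  have I0: "finite I0" using I finite_subset by blast
  note look = lookup_column_on[OF I(1), of A] lookup_column_on[OF I0, of A]
  let ?C = "column_on I A"
  define V where "V = ?C ` I0"
  have col: "?C j \<in> span V" if j: "j \<in> I" for j
  proof -
    have "?C j = (\<Sum>l\<in>I0. c j l *\<^sub>R ?C l)"
      by (rule poly_mapping_eqI) (use c j in \<open>simp add: lookup_sum lookup_scaleR look\<close>)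
    also have "\<dots> \<in> span V" unfolding V_def by (intro span_sum span_scale span_base) auto
    finally show ?thesis .
  qed
  have "span (?C ` I) = span V"
  proof
    show "span (?C ` I) \<subseteq> span V" by (rule span_minimal) (use col in auto)
    show "span V \<subseteq> span (?C ` I)" unfolding V_def by (rule span_mono) (use I in auto)
  qed
  then have r1: "rank_on I A = dim V" unfolding rank_on_def by (metis dim_span)
  define \<rho> where "\<rho> = (\<lambda>x. \<Sum>i\<in>I0. Poly_Mapping.single i (Poly_Mapping.lookup (x :: 'a \<Rightarrow>\<^sub>0 real) i))"
  have lr: "Poly_Mapping.lookup (\<rho> x) i = (if i \<in> I0 then Poly_Mapping.lookup x i else 0)" for x i
    using I0 by (simp add: \<rho>_def lookup_sum lookup_single when_def)
  have lin: "linear \<rho>"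
    by (rule linearI) (auto intro!: poly_mapping_eqI simp: lr lookup_add lookup_scaleR)
  have "\<rho> (?C j) = column_on I0 A j" for j
    by (rule poly_mapping_eqI) (use I in \<open>auto simp: lr look\<close>)
  then have r2: "rank_on I0 A = dim (\<rho> ` V)" by (simp add: rank_on_def V_def image_image)
  define P where "P = {x. \<forall>i. Poly_Mapping.lookup (x :: 'a \<Rightarrow>\<^sub>0 real) i = (if i \<in> I then \<Sum>l\<in>I0. c i l * Poly_Mapping.lookup x l else 0)}"
  have "subspace P"
    by (rule subspaceI)
      (auto simp: P_def lookup_add lookup_scaleR sum.distrib distrib_left sum_distrib_left mult.left_commute)
  moreover have "V \<subseteq> P"
  proof -
    have "A i j = (\<Sum>l\<in>I0. c i l * (if l \<in> I then A l j else 0))" if "i \<in> I" "j \<in> I0" for i j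
    proof -
      have j: "j \<in> I" using that I by blast
      have "A i j = A j i" by (rule sym[OF that(1) j])
      also have "\<dots> = (\<Sum>l\<in>I0. c i l * A j l)" by (rule c[OF j that(1)])
      also have "\<dots> = (\<Sum>l\<in>I0. c i l * (if l \<in> I then A l j else 0))"
        by (intro sum.cong refl) (use I j sym in auto)
      finally show ?thesis .
    qed
    then show ?thesis by (auto simp: V_def P_def look)
  qed
  ultimately have span: "span V \<subseteq> P" by (simp add: span_minimal)
  have inj: "inj_on \<rho> (span V)"
  proof (rule inj_onI)
    fix x y assume xy: "x \<in> span V" "y \<in> span V" "\<rho> x = \<rho> y"
    then have "x \<in> P" "y \<in> P" using span by auto
    moreover have "Poly_Mapping.lookup x l = Poly_Mapping.lookup y l" if "l \<in> I0" for l
      using arg_cong[OF xy(3), of "\<lambda>z. Poly_Mapping.lookup z l"] that by (simp add: lr)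
    ultimately show "x = y" by (intro poly_mapping_eqI) (auto simp: P_def intro: sum.cong)
  qed
  obtain B where B: "B \<subseteq> V" "independent B" "V \<subseteq> span B" "card B = dim V"
    using basis_exists by blast
  have "inj_on \<rho> (span B)" using inj span_mono[OF B(1)] inj_on_subset by blast
  then have "independent (\<rho> ` B)" by (rule linear_independent_injective_image[OF lin B(2)])
  moreover have "\<rho> ` V \<subseteq> span (\<rho> ` B)" using B(3) linear_span_image[OF lin, of B] by blast
  moreover have "card (\<rho> ` B) = dim V"
    using B(4) card_image[OF inj_on_subset[OF inj], of B] B(1) span_superset[of V] by auto
  ultimately have "dim (\<rho> ` V) = dim V" by (intro dim_unique[of "\<rho> ` B"]) (use B in auto)
  then show ?thesis using r1 r2 by simp
qed

section \<open>Flat truncation of minimizers\<close>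

theorem corollary4p1:
  fixes f :: "'n::finite rpoly" and d :: nat
  assumes "tdeg f = 2 * d"
    and "f_min f = f_sos f"
    and "global_minimizers f \<noteq> {}"
    and "finite (global_minimizers f)"
  shows "\<forall>\<^sub>F k in sequentially. \<forall>y \<in> moment_minimizers f k. flat_truncation d k y"
proof -
  obtain u where u: "u \<in> global_minimizers f" using assms(3) by blast
  define m where "m = peval f u"
  have m: "m \<le> peval f x" for x using u by (simp add: global_minimizers_def m_def)
  have "f_min f = ereal m"
    unfolding f_min_def
  proof (rule antisym)
    show "(INF x. ereal (peval f x)) \<le> ereal m" unfolding m_def by (rule INF_lower) simp
    show "ereal m \<le> (INF x. ereal (peval f x))" by (rule INF_greatest) (simp add: m)
  qed
  then have sup: "(SUP \<gamma>\<in>{\<gamma>. SOS (f - pconst \<gamma>)}. ereal \<gamma>) = ereal m" using assms(2) by (simp add: f_sos_def)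
  interpret tight_sos f d m u
  proof
    show "deg_le f (2 * d)" using deg_le_tdeg[of f] assms(1) by simp
    show "peval f u = m" by (simp add: m_def)
    fix \<epsilon> :: real assume "\<epsilon> > 0"
    then have "ereal (m - \<epsilon>) < (SUP \<gamma>\<in>{\<gamma>. SOS (f - pconst \<gamma>)}. ereal \<gamma>)" by (simp add: sup)
    then show "\<exists>\<gamma>>m - \<epsilon>. SOS (f - pconst \<gamma>)" by (auto simp: less_SUP_iff)
  qed
  define S where "S = global_minimizers f"
  have S: "x \<in> S" if "peval f x = m" for x using that m by (simp add: S_def global_minimizers_def)
  define t where "t = max d (max 1 (card S))"
  have t: "max d 1 \<le> t" "card S - 1 \<le> t - 1" by (auto simp: t_def)
  have "\<forall>\<alpha>. \<exists>q. deg_le q (card S - 1) \<and> (\<forall>x\<in>S. peval q x = peval (Poly_Mapping.single \<alpha> 1) x)"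
    using interpolating_polynomial[of S] assms(4) unfolding S_def by blast
  then obtain q where q: "\<And>\<alpha>. deg_le (q \<alpha>) (card S - 1)"
    "\<And>\<alpha> x. x \<in> S \<Longrightarrow> peval (q \<alpha>) x = peval (Poly_Mapping.single \<alpha> 1) x" by metis
  have inJ: "Poly_Mapping.single \<alpha> 1 - q \<alpha> \<in> J" for \<alpha>
    by (rule vanishing_in_J) (use q(2)[OF S] in \<open>simp add: ev_real is_homD(6)[OF ev_hom]\<close>)
  have "\<forall>\<^sub>F k in sequentially. \<forall>\<alpha>\<in>mexps t. \<forall>y\<in>moment_minimizers f k. \<forall>v. deg_le v k \<longrightarrow>
      pairing (v * (Poly_Mapping.single \<alpha> 1 - q \<alpha>)) y = 0"
    by (intro eventually_ball_finite finite_mexps ballI J_orthogonal inJ)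
  moreover have "\<forall>\<^sub>F k in sequentially. t \<le> k" by (rule eventually_ge_at_top)
  ultimately show ?thesis
  proof eventually_elim
    case (elim k)
    show ?case
    proof
      fix y assume y: "y \<in> moment_minimizers f k"
      have "moment_matrix y \<alpha> \<beta> = (\<Sum>\<gamma>\<in>mexps (t - 1). Poly_Mapping.lookup (q \<beta>) \<gamma> * moment_matrix y \<alpha> \<gamma>)"
        if ab: "\<alpha> \<in> mexps t" "\<beta> \<in> mexps t" for \<alpha> \<beta>
      proof -
        let ?v = "Poly_Mapping.single \<alpha> (1::real)"
        have "deg_le ?v k" by (rule deg_le_mono[OF deg_le_single[OF ab(1)] elim(2)])
        then have "pairing (?v * (Poly_Mapping.single \<beta> 1 - q \<beta>)) y = 0" using elim(1) ab(2) y by blast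
        then have "pairing (Poly_Mapping.single (\<alpha> + \<beta>) 1) y = pairing (?v * q \<beta>) y"
          by (simp add: right_diff_distrib pairing_simps mult_single)
        then have "y (\<alpha> + \<beta>) = pairing (?v * q \<beta>) y" by (simp add: pairing_linext linext_single)
        also have "\<dots> = (\<Sum>\<gamma>\<in>Poly_Mapping.keys (q \<beta>). Poly_Mapping.lookup (q \<beta>) \<gamma> * y (\<alpha> + \<gamma>))"
          by (simp add: pairing_linext linext_mult)
        also have "\<dots> = (\<Sum>\<gamma>\<in>mexps (t - 1). Poly_Mapping.lookup (q \<beta>) \<gamma> * y (\<alpha> + \<gamma>))"
          by (rule sum.mono_neutral_left[OF finite_mexps])
            (use deg_le_mono[OF q(1) t(2), of \<beta>] in \<open>auto simp: deg_le_def in_keys_iff\<close>)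
        finally show ?thesis by (simp add: moment_matrix_def)
      qed
      then have "rank_on (mexps (t - 1)) (moment_matrix y) = rank_on (mexps t) (moment_matrix y)"
        by (intro rank_on_eq[where c = "\<lambda>\<beta> \<gamma>. Poly_Mapping.lookup (q \<beta>) \<gamma>"] finite_mexps mexps_mono)
          (auto simp: moment_matrix_def add.commute)
      then show "flat_truncation d k y" unfolding flat_truncation_def using t(1) elim(2) by blast
    qed
  qed
qed

end
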